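(* For each integer $N\ge 1$ let $X_1^{(N)},X_2^{(N)},\dots$ be independent, identically distributed random real $N\times N$ matrices which satisfy: (A) (rotational invariance) each $X_i^{(N)}$ is rotationally invariant; (B) (Furstenberg--Kesten) for all $N$, $E\log^{+}\|X_i^{(N)}\|$ exists (is finite). Suppose in addition that one of the following two alternatives holds: (1) (Gaussian case) for all $N$, the entries of $X_i^{(N)}$ are independent Gaussian random variables with distribution $\mathcal N(0,\sigma^2/N)$, where $\sigma>0$ does not depend on $N$; or (2) the following two conditions hold: (C) (uniformly bounded singular values) there is a constant $b$, not depending on $N$, such that with probability 1, $\max_k s_k^{(i,N)}\le b\,\overline{s}^{(i,N)}$; (D) (comparability across $N$) $\operatorname{var}[\log \overline{s}^{(i,N)}]$ exists and is bounded by a constant which does not depend on $N$. Let $\Pi_n=X_n^{(N)}\cdots X_1^{(N)}$ and let $v\in\mathbb R^N$ be an arbitrary unit vector. Then $n^{-1}\log\|\Pi_n\|$ converges in probability, as $n\to\infty$, to $E\log\|X_1^{(N)}v\|$, and the convergence is uniform in $N$. That is, for each $\delta>0$ there exists $n_0(\delta)$ such that for all $n\ge n_0(\delta)$ and all $N\ge 1$, $$\Pr\left\{\left|n^{-1}\log\|\Pi_n\|-E\log\|X_1^{(N)}v\|\right|\ge\delta\right\}\le\delta .$$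
   Context: $\|\cdot\|$ is the Euclidean norm of vectors and the operator norm of matrices. A random $N\times N$ matrix $X$ is called rotationally invariant if for every integer $k\ge1$, every collection of vectors $\{v_i,w_i\}_{i=1}^k$ and every orthogonal matrix $U$, the joint distributions of $\{\langle w_i,Xv_i\rangle\}_{i=1}^k$ and $\{\langle Uw_i,XUv_i\rangle\}_{i=1}^k$ are the same. The numbers $s_1^{(i,N)},\dots,s_N^{(i,N)}$ are the eigenvalues of $X_i^{(N)*}X_i^{(N)}$ (the squared singular values of $X_i^{(N)}$), and $\overline{s}^{(i,N)}=\frac1N\sum_{k=1}^N s_k^{(i,N)}=\frac1N\operatorname{tr}\big(X_i^{(N)*}X_i^{(N)}\big)$. $\log^+x=\max(\log x,0)$. *)

theory Defs
  imports
    "HOL-Probability.Probability"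
    "Jordan_Normal_Form.Char_Poly"
begin

text \<open>
  The dimension \<open>N\<close> is quantified inside the statement, so matrices and vectors are the
  carrier-based ones of \<^theory>\<open>Jordan_Normal_Form.Matrix\<close>. Inner products are written
  \<^const>\<open>scalar_prod\<close> because the infix symbol is shared with \<^const>\<open>inner\<close>.
\<close>

definition euclid_norm :: "real Matrix.vec \<Rightarrow> real" where
  "euclid_norm v = sqrt (scalar_prod v v)"

text \<open>The supremum is taken over the closed unit ball, a bounded nonempty family in each dimension.\<close>

definition op_norm :: "real Matrix.mat \<Rightarrow> real" where
  "op_norm A =
    (SUP v \<in> {v \<in> carrier_vec (dim_col A). euclid_norm v \<le> 1}. euclid_norm (A *\<^sub>v v))"

definition orthogonal_matrices :: "nat \<Rightarrow> real Matrix.mat set" where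
  "orthogonal_matrices N =
    {U \<in> carrier_mat N N. transpose_mat U * U = 1\<^sub>m N \<and> U * transpose_mat U = 1\<^sub>m N}"

text \<open>
  The Borel sigma-algebra on real \<open>N\<close> by \<open>N\<close> matrices, pulled back along the identification of a
  matrix with its family of entries.
\<close>

definition borel_mat :: "nat \<Rightarrow> real Matrix.mat measure" where
  "borel_mat N =
    vimage_algebra (carrier_mat N N)
      (\<lambda>A. \<lambda>(j, k) \<in> {..<N} \<times> {..<N}. A $$ (j, k))
      (PiM ({..<N} \<times> {..<N}) (\<lambda>_. borel))"

definition rotationally_invariant ::
    "'a measure \<Rightarrow> nat \<Rightarrow> ('a \<Rightarrow> real Matrix.mat) \<Rightarrow> bool" where
  "rotationally_invariant M N X \<longleftrightarrow>
    (\<forall>k \<ge> 1. \<forall>v w :: nat \<Rightarrow> real Matrix.vec. \<forall>U \<in> orthogonal_matrices N.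
      (\<forall>i \<in> {1..k}. v i \<in> carrier_vec N \<and> w i \<in> carrier_vec N) \<longrightarrow>
      distr M (PiM {1..k} (\<lambda>_. borel))
        (\<lambda>\<omega>. \<lambda>i \<in> {1..k}. scalar_prod (w i) (X \<omega> *\<^sub>v v i)) =
      distr M (PiM {1..k} (\<lambda>_. borel))
        (\<lambda>\<omega>. \<lambda>i \<in> {1..k}. scalar_prod (U *\<^sub>v w i) (X \<omega> *\<^sub>v (U *\<^sub>v v i))))"

text \<open>
  The eigenvalues of \<open>A\<^sup>T A\<close>, with algebraic multiplicity. They are all real, so for \<open>A\<close> of
  size \<open>N\<close> this multiset has \<open>N\<close> elements.
\<close>

definition sq_singular_values :: "real Matrix.mat \<Rightarrow> real multiset" where
  "sq_singular_values A = proots (char_poly (transpose_mat A * A))"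

definition mean_sq_singular_value :: "real Matrix.mat \<Rightarrow> real" where
  "mean_sq_singular_value A = sum_mset (sq_singular_values A) / real (dim_col A)"

definition max_sq_singular_value :: "real Matrix.mat \<Rightarrow> real" where
  "max_sq_singular_value A = Max (set_mset (sq_singular_values A))"

definition log_plus :: "real \<Rightarrow> real" where
  "log_plus x = max (ln x) 0"

text \<open>
  Since \<open>ln 0 = 0\<close> in HOL, finiteness of the mean of \<open>log Y\<close> for \<open>Y \<ge> 0\<close> also needs \<open>Y > 0\<close>
  almost surely; likewise for the variance.
\<close>

definition log_mean_exists :: "'a measure \<Rightarrow> ('a \<Rightarrow> real) \<Rightarrow> bool" where
  "log_mean_exists M Y \<longleftrightarrow> (AE \<omega> in M. 0 < Y \<omega>) \<and> integrable M (\<lambda>\<omega>. ln (Y \<omega>))"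

definition log_variance_exists :: "'a measure \<Rightarrow> ('a \<Rightarrow> real) \<Rightarrow> bool" where
  "log_variance_exists M Y \<longleftrightarrow>
    log_mean_exists M Y \<and> integrable M (\<lambda>\<omega>. (ln (Y \<omega>))\<^sup>2)"

text \<open>The factors are indexed from \<open>1\<close>: \<open>mat_prod N A n = A n * \<dots> * A 1\<close>.\<close>

primrec mat_prod :: "nat \<Rightarrow> (nat \<Rightarrow> real Matrix.mat) \<Rightarrow> nat \<Rightarrow> real Matrix.mat" where
  "mat_prod N A 0 = 1\<^sub>m N"
| "mat_prod N A (Suc n) = A (Suc n) * mat_prod N A n"

definition iid_matrices ::
    "'a measure \<Rightarrow> nat \<Rightarrow> (nat \<Rightarrow> 'a \<Rightarrow> real Matrix.mat) \<Rightarrow> bool" where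
  "iid_matrices M N X \<longleftrightarrow>
    prob_space.indep_vars M (\<lambda>_. borel_mat N) X {1..} \<and>
    (\<forall>i \<ge> 1. distr M (borel_mat N) (X i) = distr M (borel_mat N) (X 1))"

definition gaussian_matrix ::
    "'a measure \<Rightarrow> nat \<Rightarrow> real \<Rightarrow> ('a \<Rightarrow> real Matrix.mat) \<Rightarrow> bool" where
  "gaussian_matrix M N \<sigma> X \<longleftrightarrow>
    prob_space.indep_vars M (\<lambda>_. borel) (\<lambda>(j, k) \<omega>. X \<omega> $$ (j, k)) ({..<N} \<times> {..<N}) \<and>
    (\<forall>j < N. \<forall>k < N.
      distributed M lborel (\<lambda>\<omega>. X \<omega> $$ (j, k))
        (\<lambda>x. ennreal (normal_density 0 (sqrt (\<sigma>\<^sup>2 / real N)) x)))"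

end

theory Submission
  imports Defs
begin

text \<open>
  By rotational invariance the law of \<open>|X u|\<close> is the same for all unit vectors \<open>u\<close>. If \<open>u\<^sub>i\<close> is the
  direction of \<open>\<Pi>\<^sub>i v\<close>, then \<open>|\<Pi>\<^sub>n v|\<close> is the product of the i.i.d. numbers \<open>|X\<^sub>i u|\<close> with
  \<open>u = u\<^sub>i\<^sub>-\<^sub>1\<close>, and Chebyshev's inequality bounds the operator norm of \<open>\<Pi>\<^sub>n\<close> from below. For bounded \<open>N\<close>
  the columns of \<open>\<Pi>\<^sub>n\<close> also give the upper bound.

  For large \<open>N\<close> write \<open>|X u|\<^sup>2 = S(X) Z\<close>, where \<open>S\<close> is the mean squared singular value, or \<open>\<sigma>\<^sup>2\<close> in
  the Gaussian case. Replacing \<open>u\<close> by a vector of random signs, which does not change the law,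
  yields \<open>E Z^k \<le> exp (C k\<^sup>2 / N)\<close>. For a standard Gaussian vector \<open>g\<close> independent of the matrices,
  \<open>E |B g|^(2k) \<ge> k! \<parallel>B\<parallel>^(2k)\<close> and \<open>E |g|^(2k) \<le> k! 4^k 2^(N/2)\<close>; hence the \<open>2k\<close>-th moment of
  \<open>\<parallel>\<Pi>\<^sub>n\<parallel>\<close>, normalised by the product of the \<open>S(X\<^sub>i)\<close>, is at most \<open>4^k 2^(N/2) (E Z^k)^n\<close>. With \<open>k\<close>
  a small multiple of \<open>N\<close>, Markov's inequality absorbs the factor \<open>4^k 2^(N/2)\<close> uniformly in \<open>N\<close> once \<open>n\<close>
  is large. The centring is right because \<open>E (log Z)\<^sup>2\<close> is bounded (replace \<open>u\<close> by a Gaussian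
  vector) and \<open>E (Z - 1)\<^sup>2 = O(1/N)\<close>, so that \<open>E log Z\<close> tends to \<open>0\<close>.
\<close>

text \<open>Uniformity in the dimension is the obstacle. The column bound pays a factor N in the
  probability and another in the norm, so it serves only below some N0. For large N one Gaussian
  average controls the whole unit ball at once, at the price 4^k 2^(N/2). With k at least N / C this
  price is at most (4 * 2^C)^k, and Markov's inequality leaves a gain exp (- n k \<delta>) against
  it. This requires E Z^k \<le> exp (k \<delta>) with k of order N, which is what the form exp (C
  k^2 / N) of the moment bound provides. S is split off because only the first two moments of its
  logarithm are controlled: its product is treated by Chebyshev's inequality, and the k-th moment is
  taken of the normalised product alone. Signs are used for the moments of Z because flipping one
  coordinate acts as a discrete integration by parts. Gaussian entries satisfy no bound like (C)
  uniformly in N; there S is constant and Z is a normalised chi-square variable.\<close>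

no_notation vec_nth (infixl "$" 90)

section \<open>Symmetric matrices and squared singular values\<close>

text \<open>Take the reflection in the hyperplane orthogonal to d = u - w. Symmetric involutions are
  the only orthogonal matrices used below: they move any unit vector to any other, and conjugation
  by them is simply \<open>U * A * U\<close>.\<close>

lemma householder_exists:
  fixes u w :: "real Matrix.vec"
  assumes u: "u \<in> carrier_vec N" and w: "w \<in> carrier_vec N"
    and uu: "scalar_prod u u = 1" and ww: "scalar_prod w w = 1"
  obtains U where "U \<in> carrier_mat N N" "transpose_mat U = U" "U * U = 1\<^sub>m N" "U *\<^sub>v u = w"
proof (cases "u = w")
  case True
  then show ?thesis using that[of "1\<^sub>m N"] u by simp
next
  case False
  define d where "d i = u $ i - w $ i" for i
  define D where "D = (\<Sum>k<N. d k * d k)"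
  define U where "U = Matrix.mat N N (\<lambda>(i,j). (if i = j then 1 else 0) - 2 / D * d i * d j)"
  have uu': "(\<Sum>k<N. u $ k * u $ k) = 1" and ww': "(\<Sum>k<N. w $ k * w $ k) = 1"
    using uu ww u w by (auto simp: scalar_prod_def lessThan_atLeast0)
  obtain i where i: "i < N" "u $ i \<noteq> w $ i"
    using False u w by (metis carrier_vecD eq_vecI)
  have "D > 0" unfolding D_def
    by (rule sum_pos2[of _ i]) (use i in \<open>auto simp: d_def mult_eq_0_iff zero_less_mult_iff linorder_neq_iff\<close>)
  \<comment> \<open>Because u and w have equal length, <d, u> is half of |d|^2; hence the reflection
    sends u to u - d = w.\<close>
  have du: "(\<Sum>k<N. d k * u $ k) = D / 2"
  proof -
    have "D = (\<Sum>k<N. u $ k * u $ k) + (\<Sum>k<N. w $ k * w $ k) - 2 * (\<Sum>k<N. w $ k * u $ k)"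
      unfolding D_def d_def sum_distrib_left sum.distrib[symmetric] sum_subtractf[symmetric]
      by (rule sum.cong) (auto simp: algebra_simps)
    moreover have "(\<Sum>k<N. d k * u $ k) = (\<Sum>k<N. u $ k * u $ k) - (\<Sum>k<N. w $ k * u $ k)"
      unfolding d_def sum_subtractf[symmetric] by (rule sum.cong) (auto simp: algebra_simps)
    ultimately show ?thesis using uu' ww' by simp
  qed
  have Uc: "U \<in> carrier_mat N N" by (simp add: U_def)
  have "transpose_mat U = U" by (rule eq_matI) (auto simp: U_def)
  moreover have "U * U = 1\<^sub>m N"
  proof (rule eq_matI)
    fix i j assume "i < dim_row (1\<^sub>m N :: real mat)" "j < dim_col (1\<^sub>m N :: real mat)"
    then have ij: "i < N" "j < N" by auto
    have "(U * U) $$ (i,j) = (\<Sum>k<N. ((if i = k then 1 else 0) - 2 / D * d i * d k) * ((if k = j then 1 else 0) - 2 / D * d k * d j))"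
      using ij by (simp add: U_def scalar_prod_def lessThan_atLeast0)
    also have "\<dots> = (\<Sum>k<N. (if i = k then (if k = j then 1 else 0) else 0) - (if i = k then 2 / D * d i * d j else 0)
         - (if k = j then 2 / D * d i * d j else 0) + 4 / (D*D) * d i * d j * (d k * d k))"
      by (rule sum.cong) (auto simp: algebra_simps)
    also have "\<dots> = (if i = j then 1 else 0) - 2 / D * d i * d j - 2 / D * d i * d j + 4 / (D*D) * d i * d j * D"
      using ij unfolding sum.distrib sum_subtractf D_def sum_distrib_left[symmetric] by (simp add: sum.delta sum.delta')
    also have "\<dots> = (if i = j then 1 else 0)" using \<open>D > 0\<close> by (simp add: field_simps)
    finally show "(U * U) $$ (i,j) = 1\<^sub>m N $$ (i,j)" using ij by simp
  qed (auto simp: U_def)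
  moreover have "U *\<^sub>v u = w"
  proof (rule eq_vecI)
    fix i assume "i < dim_vec w"
    then have i: "i < N" using w by simp
    have "(U *\<^sub>v u) $ i = (\<Sum>k<N. ((if i = k then 1 else 0) - 2 / D * d i * d k) * u $ k)"
      using i u by (simp add: U_def scalar_prod_def lessThan_atLeast0)
    also have "\<dots> = (\<Sum>k<N. (if i = k then u $ k else 0) - 2 / D * d i * (d k * u $ k))"
      by (rule sum.cong) (auto simp: algebra_simps)
    also have "\<dots> = u $ i - 2 / D * d i * (D / 2)"
      using i unfolding sum_subtractf sum_distrib_left[symmetric] du by (simp add: sum.delta)
    also have "\<dots> = u $ i - d i" using \<open>D > 0\<close> by simp
    also have "\<dots> = w $ i" by (simp add: d_def)
    finally show "(U *\<^sub>v u) $ i = w $ i" .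
  qed (use w Uc in auto)
  ultimately show ?thesis using that Uc by blast
qed

text \<open>The characteristic polynomial has a complex root z with eigenvector x. By symmetry the
  Hermitian form of A at x equals its own conjugate; it is also z |x|^2, so z is real. A real
  eigenvector is then chosen afresh.\<close>

lemma symmetric_real_eigenvector:
  fixes A :: "real Matrix.mat"
  assumes A: "A \<in> carrier_mat N N" and sym: "transpose_mat A = A" and N: "N > 0"
  obtains e v where "v \<in> carrier_vec N" "scalar_prod v v = 1" "A *\<^sub>v v = e \<cdot>\<^sub>v v"
proof -
  let ?C = "map_mat complex_of_real A"
  have C: "?C \<in> carrier_mat N N" using A by simp
  have "degree (char_poly ?C) = N" using degree_monic_char_poly[OF C] by simp
  then have "\<not> constant (poly (char_poly ?C))" using N by (simp add: constant_degree)
  from fundamental_theorem_of_algebra[OF this] obtain z where z: "poly (char_poly ?C) z = 0" by blast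
  then have "eigenvalue ?C z" using eigenvalue_root_char_poly[OF C] by simp
  then obtain x where x: "x \<in> carrier_vec N" "x \<noteq> 0\<^sub>v N" "?C *\<^sub>v x = z \<cdot>\<^sub>v x"
    unfolding eigenvalue_def eigenvector_def using A by auto
  have eq: "(\<Sum>k<N. complex_of_real (A $$ (j,k)) * x $ k) = z * x $ j" if "j < N" for j
  proof -
    have "(?C *\<^sub>v x) $ j = (z \<cdot>\<^sub>v x) $ j" using x(3) by simp
    then show ?thesis using that A x(1) by (simp add: scalar_prod_def lessThan_atLeast0)
  qed
  define S where "S = (\<Sum>j<N. cnj (x $ j) * x $ j)"
  have zS: "z * S = (\<Sum>j<N. \<Sum>k<N. cnj (x $ j) * complex_of_real (A $$ (j,k)) * x $ k)"
  proof -
    have "z * S = (\<Sum>j<N. cnj (x $ j) * (\<Sum>k<N. complex_of_real (A $$ (j,k)) * x $ k))"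
      unfolding S_def sum_distrib_left[of z] by (rule sum.cong) (use eq in \<open>auto simp: mult_ac\<close>)
    then show ?thesis by (simp add: sum_distrib_left mult.assoc)
  qed
  have Asym: "A $$ (j,k) = A $$ (k,j)" if "j < N" "k < N" for j k
    using arg_cong[OF sym, of "\<lambda>M. M $$ (j,k)"] A that by simp
  have "cnj (z * S) = (\<Sum>j<N. \<Sum>k<N. cnj (x $ k) * complex_of_real (A $$ (k,j)) * x $ j)"
    unfolding zS cnj_sum by (intro sum.cong) (auto simp: Asym)
  also have "\<dots> = z * S" unfolding zS by (rule sum.swap)
  finally have "cnj (z * S) = z * S" .
  moreover define T where "T = (\<Sum>j<N. (cmod (x $ j))\<^sup>2)"
  have "S = complex_of_real T"
    unfolding S_def T_def of_real_sum by (intro sum.cong refl) (metis complex_norm_square mult.commute of_real_power)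
  moreover have "T \<noteq> 0"
  proof
    assume "T = 0"
    then have "(\<Sum>j<N. (cmod (x $ j))\<^sup>2) = 0" unfolding T_def .
    then have "\<forall>j<N. x $ j = 0" by (simp add: sum_nonneg_eq_0_iff)
    then have "x = 0\<^sub>v N" using x(1) by (intro eq_vecI) auto
    then show False using x(2) by simp
  qed
  ultimately have "cnj z = z" by simp
  then obtain r where r: "z = complex_of_real r" by (metis Reals_cnj_iff Reals_cases)
  have "char_poly ?C = map_poly complex_of_real (char_poly A)"
    using of_real_hom.char_poly_hom[OF A] by simp
  then have "poly (char_poly A) r = 0" using z r by simp
  then have "eigenvalue A r" using eigenvalue_root_char_poly[OF A] by simp
  then obtain y where y: "y \<in> carrier_vec N" "y \<noteq> 0\<^sub>v N" "A *\<^sub>v y = r \<cdot>\<^sub>v y"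
    unfolding eigenvalue_def eigenvector_def using A by auto
  have pos: "scalar_prod y y > 0"
  proof -
    obtain i where "i < N" "y $ i \<noteq> 0" using y(1,2) by (metis carrier_vecD eq_vecI index_zero_vec)
    then have "0 < (\<Sum>k<N. y $ k * y $ k)"
      by (intro sum_pos2[of _ i]) (auto simp: zero_less_mult_iff linorder_neq_iff)
    then show ?thesis using y(1) by (simp add: scalar_prod_def lessThan_atLeast0)
  qed
  define c where "c = 1 / sqrt (scalar_prod y y)"
  have "scalar_prod (c \<cdot>\<^sub>v y) (c \<cdot>\<^sub>v y) = c * c * scalar_prod y y"
    using y(1) by simp
  also have "\<dots> = 1" using pos unfolding c_def by (simp add: field_simps)
  finally have "scalar_prod (c \<cdot>\<^sub>v y) (c \<cdot>\<^sub>v y) = 1" .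
  moreover have "A *\<^sub>v (c \<cdot>\<^sub>v y) = r \<cdot>\<^sub>v (c \<cdot>\<^sub>v y)"
    using y A by (simp add: mult_mat_vec smult_smult_assoc mult.commute)
  ultimately show ?thesis using that[of "c \<cdot>\<^sub>v y" r] y(1) by simp
qed

section \<open>The spectrum of a symmetric real matrix\<close>

definition mat_trace :: "real Matrix.mat \<Rightarrow> real" where
  "mat_trace A = (\<Sum>i<dim_row A. A $$ (i,i))"

lemma mat_trace_comm:
  assumes "A \<in> carrier_mat N N" "B \<in> carrier_mat N N"
  shows "mat_trace (A * B) = mat_trace (B * A)"
proof -
  have "mat_trace (A * B) = (\<Sum>i<N. \<Sum>k<N. A $$ (i,k) * B $$ (k,i))"
    using assms unfolding mat_trace_def by (intro sum.cong) (auto simp: scalar_prod_def lessThan_atLeast0)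
  also have "\<dots> = (\<Sum>k<N. \<Sum>i<N. A $$ (i,k) * B $$ (k,i))" by (rule sum.swap)
  also have "\<dots> = mat_trace (B * A)"
    using assms unfolding mat_trace_def by (intro sum.cong) (auto simp: scalar_prod_def lessThan_atLeast0 mult.commute)
  finally show ?thesis .
qed

text \<open>Deflation: a reflection carrying e_0 to a unit eigenvector splits off a 1 by 1 block and
  leaves a smaller symmetric matrix. One list of eigenvalues serves the characteristic polynomial,
  the trace and the quadratic form. The form is bounded by an arbitrary upper bound m of the list,
  because for N = 0 the list has no maximum.\<close>

lemma symmetric_real_spectrum:
  fixes A :: "real Matrix.mat"
  assumes "A \<in> carrier_mat N N" "transpose_mat A = A"
  shows "\<exists>es. char_poly A = (\<Prod>e\<leftarrow>es. [:- e, 1:]) \<and> mat_trace A = sum_list es \<and>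
     (\<forall>m. (\<forall>e\<in>set es. e \<le> m) \<longrightarrow>
        (\<forall>w\<in>carrier_vec N. scalar_prod w (A *\<^sub>v w) \<le> m * scalar_prod w w))"
  using assms
proof (induction N arbitrary: A)
  case 0
  then have "char_poly A = 1" using degree_monic_char_poly[OF 0(1)] by (metis degree_0_id lead_coeff_1 one_pCons)
  then show ?case using 0 by (intro exI[of _ "[]"]) (auto simp: mat_trace_def scalar_prod_def)
next
  case (Suc n)
  let ?N = "Suc n"
  note A = Suc.prems(1) and sym = Suc.prems(2)
  obtain e v where v: "v \<in> carrier_vec ?N" "scalar_prod v v = 1" "A *\<^sub>v v = e \<cdot>\<^sub>v v"
    using symmetric_real_eigenvector[OF A sym] by (metis zero_less_Suc)
  obtain U where U: "U \<in> carrier_mat ?N ?N" "transpose_mat U = U" "U * U = 1\<^sub>m ?N" "U *\<^sub>v unit_vec ?N 0 = v"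
    using householder_exists[of "unit_vec ?N 0" ?N v] v by auto
  have Uv: "U *\<^sub>v v = unit_vec ?N 0"
    using U(1,3,4) by (metis assoc_mult_mat_vec one_mult_mat_vec unit_vec_carrier)
  define B where "B = U * A * U"
  have B: "B \<in> carrier_mat ?N ?N" using A U by (simp add: B_def)
  have Bsym: "transpose_mat B = B" unfolding B_def
    using A U sym by (simp add: transpose_mult[of _ ?N ?N _ ?N] assoc_mult_mat[of _ ?N ?N _ ?N _ ?N])
  have Bcol: "B *\<^sub>v unit_vec ?N 0 = e \<cdot>\<^sub>v unit_vec ?N 0"
    using A U v Uv by (simp add: B_def assoc_mult_mat_vec[of _ ?N ?N _ ?N] mult_mat_vec[of _ ?N ?N])
  have B0: "B $$ (i,0) = (if i = 0 then e else 0)" if "i < ?N" for i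
  proof -
    have "(B *\<^sub>v unit_vec ?N 0) $ i = B $$ (i,0)" using that B by simp
    then show ?thesis using arg_cong[OF Bcol, of "\<lambda>x. x $ i"] that by (auto simp: index_unit_vec simp del: index_mult_mat_vec)
  qed
  \<comment> \<open>Symmetry clears the first row as well, so B is block diagonal.\<close>
  have B0': "B $$ (0,i) = (if i = 0 then e else 0)" if "i < ?N" for i
    using B0[OF that] arg_cong[OF Bsym, of "\<lambda>M. M $$ (0,i)"] B that by simp
  define C where "C = Matrix.mat n n (\<lambda>(i,j). B $$ (Suc i, Suc j))"
  have C: "C \<in> carrier_mat n n" by (simp add: C_def)
  have Bs: "B $$ (i,j) = B $$ (j,i)" if "i < ?N" "j < ?N" for i j
    using arg_cong[OF Bsym, of "\<lambda>M. M $$ (i,j)"] B that by simp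
  have Csym: "transpose_mat C = C" using Bs by (intro eq_matI) (auto simp: C_def)
  obtain es where es: "char_poly C = (\<Prod>e\<leftarrow>es. [:- e, 1:])" "mat_trace C = sum_list es"
    "\<And>m w. (\<forall>e\<in>set es. e \<le> m) \<Longrightarrow> w\<in>carrier_vec n \<Longrightarrow> scalar_prod w (C *\<^sub>v w) \<le> m * scalar_prod w w"
    using Suc.IH[OF C Csym] by blast
  have "similar_mat A B"
    unfolding similar_mat_def similar_mat_wit_def Let_def
    using A U B by (intro exI[of _ U]) (auto simp: B_def assoc_mult_mat[of _ ?N ?N _ ?N _ ?N]
        assoc_mult_mat[of U ?N ?N U ?N _ ?N, symmetric])
  then have "char_poly A = char_poly B" by (rule char_poly_similar)
  also have "B = four_block_mat (Matrix.mat 1 1 (\<lambda>_. e)) (0\<^sub>m 1 n) (0\<^sub>m n 1) C"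
    using B B0 B0' by (intro eq_matI) (auto simp: C_def)
  also have "char_poly \<dots> = char_poly (Matrix.mat 1 1 (\<lambda>_. e)) * char_poly C"
    by (rule char_poly_four_block_zeros_col[OF _ _ C]) auto
  also have "char_poly (Matrix.mat 1 1 (\<lambda>_. e)) = [:- e, 1:]"
    by (simp add: char_poly_defs det_def sign_def)
  finally have cp: "char_poly A = (\<Prod>e\<leftarrow>e # es. [:- e, 1:])" by (simp add: es(1))
  have "mat_trace A = mat_trace (U * (U * A))"
    using A U by (simp add: assoc_mult_mat[of U ?N ?N U ?N _ ?N, symmetric])
  also have "\<dots> = mat_trace B" unfolding B_def using A U by (intro mat_trace_comm[of _ ?N]) auto
  also have "\<dots> = e + mat_trace C"
    using B B0[of 0] unfolding mat_trace_def C_def by (simp add: sum.lessThan_Suc_shift del: sum.lessThan_Suc)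
  finally have tr: "mat_trace A = sum_list (e # es)" by (simp add: es(2))
  have "scalar_prod w (A *\<^sub>v w) \<le> m * scalar_prod w w"
    if m: "\<forall>x\<in>set (e # es). x \<le> m" and w: "w \<in> carrier_vec ?N" for m w
  proof -
    define x where "x = U *\<^sub>v w"
    define y where "y = Matrix.vec n (\<lambda>i. x $ Suc i)"
    have x: "x \<in> carrier_vec ?N" and y: "y \<in> carrier_vec n" using U w by (auto simp: x_def y_def)
    have trU: "scalar_prod (U *\<^sub>v a) b = scalar_prod a (U *\<^sub>v b)" if "a \<in> carrier_vec ?N" "b \<in> carrier_vec ?N" for a b
      using transpose_vec_mult_scalar[of U ?N ?N b a] U that by simp
    have Uw: "U *\<^sub>v x = w" using U(1,3) w unfolding x_def
      by (metis assoc_mult_mat_vec one_mult_mat_vec)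
    have "scalar_prod w (A *\<^sub>v w) = scalar_prod (U *\<^sub>v x) (A *\<^sub>v (U *\<^sub>v x))" by (simp add: Uw)
    also have "\<dots> = scalar_prod x (B *\<^sub>v x)"
      using A U x by (simp add: trU B_def assoc_mult_mat_vec[of _ ?N ?N _ ?N])
    also have "\<dots> = e * (x $ 0 * x $ 0) + scalar_prod y (C *\<^sub>v y)"
    proof -
      have "(B *\<^sub>v x) $ 0 = e * x $ 0"
        using B x B0' by (simp add: scalar_prod_def lessThan_atLeast0[symmetric] sum.lessThan_Suc_shift del: sum.lessThan_Suc)
      moreover have "(B *\<^sub>v x) $ Suc i = (C *\<^sub>v y) $ i" if "i < n" for i
        using B x B0 that C by (simp add: scalar_prod_def lessThan_atLeast0[symmetric] sum.lessThan_Suc_shift C_def y_def del: sum.lessThan_Suc)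
      ultimately show ?thesis
        using B C x y unfolding scalar_prod_def
        by (simp add: lessThan_atLeast0[symmetric] sum.lessThan_Suc_shift y_def del: sum.lessThan_Suc index_mult_mat_vec)
    qed
    also have "\<dots> \<le> m * (x $ 0 * x $ 0) + m * scalar_prod y y"
      using es(3)[OF _ y, of m] m by (intro add_mono mult_right_mono) auto
    also have "\<dots> = m * scalar_prod x x"
      using x y unfolding scalar_prod_def
      by (simp add: lessThan_atLeast0[symmetric] sum.lessThan_Suc_shift y_def algebra_simps del: sum.lessThan_Suc)
    also have "scalar_prod x x = scalar_prod w w" using trU[OF w x] Uw by (simp add: x_def)
    finally show ?thesis .
  qed
  then show ?case using cp tr by (intro exI[of _ "e # es"]) blast
qed

lemma proots_prod_list_linear: "proots (\<Prod>e\<leftarrow>es. [:- e, 1:]) = mset (es :: real list)"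
proof (induction es)
  case (Cons e es)
  have "(\<Prod>e\<leftarrow>es. [:- e, 1:]) \<noteq> (0 :: real poly)"
    by (auto simp: prod_list_zero_iff)
  then show ?case using Cons by (simp add: proots_mult del: mult_pCons_left)
qed simp

text \<open>Conditions (C) and (D) enter the estimates through these two facts: the mean becomes a
  sum of squared entries by the trace of A^T A, and the maximum becomes a bound for |A w|^2 by the
  quadratic form.\<close>

lemma sq_singular_values_facts:
  fixes A :: "real Matrix.mat"
  assumes A: "A \<in> carrier_mat N N" and N: "N \<ge> 1"
  shows "mean_sq_singular_value A = (\<Sum>i<N. \<Sum>j<N. (A $$ (i,j))\<^sup>2) / real N"
    and "w \<in> carrier_vec N \<Longrightarrow>
      scalar_prod (A *\<^sub>v w) (A *\<^sub>v w) \<le> max_sq_singular_value A * scalar_prod w w"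
proof -
  let ?B = "transpose_mat A * A"
  have B: "?B \<in> carrier_mat N N" using A by simp
  have "transpose_mat ?B = ?B" using A by (simp add: transpose_mult[of _ N N _ N])
  from symmetric_real_spectrum[OF B this] obtain es where es:
    "char_poly ?B = (\<Prod>e\<leftarrow>es. [:- e, 1:])" "mat_trace ?B = sum_list es"
    "\<And>m w. (\<forall>e\<in>set es. e \<le> m) \<Longrightarrow> w \<in> carrier_vec N \<Longrightarrow> scalar_prod w (?B *\<^sub>v w) \<le> m * scalar_prod w w"
    by blast
  have sv: "sq_singular_values A = mset es"
    unfolding sq_singular_values_def es(1) by (rule proots_prod_list_linear)
  have "mat_trace ?B = (\<Sum>j<N. \<Sum>i<N. (A $$ (i,j))\<^sup>2)"
    using A unfolding mat_trace_def
    by (intro sum.cong) (auto simp: scalar_prod_def lessThan_atLeast0 power2_eq_square)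
  then show "mean_sq_singular_value A = (\<Sum>i<N. \<Sum>j<N. (A $$ (i,j))\<^sup>2) / real N"
    using A es(2) sum.swap[of "\<lambda>i j. (A $$ (i,j))\<^sup>2" "{..<N}" "{..<N}"]
    unfolding mean_sq_singular_value_def sv by (simp add: sum_mset_sum_list)
  assume w: "w \<in> carrier_vec N"
  have "scalar_prod (A *\<^sub>v w) (A *\<^sub>v w) = scalar_prod w (?B *\<^sub>v w)"
    using transpose_vec_mult_scalar[of A N N w "A *\<^sub>v w"] A w
    by (simp add: assoc_mult_mat_vec[of _ N N _ N] comm_scalar_prod[of _ N])
  also have "\<dots> \<le> max_sq_singular_value A * scalar_prod w w"
    by (rule es(3)[OF _ w]) (auto simp: max_sq_singular_value_def sv)
  finally show "scalar_prod (A *\<^sub>v w) (A *\<^sub>v w) \<le> max_sq_singular_value A * scalar_prod w w" .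
qed

section \<open>Rotational invariance\<close>

text \<open>From here on vectors are functions of which only the values below N matter, which avoids
  carrier conditions for directions and Gaussian samples. Squared norms are used throughout, so that
  products and moments need no roots; \<open>frob\<close> below is the squared Frobenius
  norm.\<close>

definition sqn :: "nat \<Rightarrow> (nat \<Rightarrow> real) \<Rightarrow> real" where
  "sqn N f = (\<Sum>k<N. (f k)\<^sup>2)"

definition mulv :: "nat \<Rightarrow> real Matrix.mat \<Rightarrow> (nat \<Rightarrow> real) \<Rightarrow> nat \<Rightarrow> real" where
  "mulv N A f j = (\<Sum>k<N. A $$ (j,k) * f k)"

definition frob :: "nat \<Rightarrow> real Matrix.mat \<Rightarrow> real" where
  "frob N A = (\<Sum>i<N. \<Sum>j<N. (A $$ (i,j))\<^sup>2)"

lemma sqn_nonneg [simp]: "0 \<le> sqn N f"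
  by (simp add: sqn_def sum_nonneg)

lemma frob_nonneg [simp]: "0 \<le> frob N A"
  by (simp add: frob_def sum_nonneg)

lemma sqn_cong: "(\<And>k. k < N \<Longrightarrow> f k = g k) \<Longrightarrow> sqn N f = sqn N g"
  unfolding sqn_def by (rule sum.cong) auto

lemma mulv_cong: "(\<And>k. k < N \<Longrightarrow> f k = g k) \<Longrightarrow> mulv N A f = mulv N A g"
  unfolding mulv_def by (rule ext, rule sum.cong) auto

lemma sqn_scale: "sqn N (\<lambda>k. c * f k) = c\<^sup>2 * sqn N f"
  by (simp add: sqn_def power_mult_distrib sum_distrib_left)

lemma mulv_scale: "mulv N A (\<lambda>k. c * f k) = (\<lambda>j. c * mulv N A f j)"
  by (rule ext) (simp add: mulv_def sum_distrib_left mult.left_commute)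

lemma sqn_mulv_scale: "sqn N (mulv N A (\<lambda>k. c * f k)) = c\<^sup>2 * sqn N (mulv N A f)"
  by (simp add: mulv_scale sqn_scale)

lemma sqn_eq_scalar_prod: "v \<in> carrier_vec N \<Longrightarrow> sqn N (($) v) = scalar_prod v v"
  by (simp add: sqn_def scalar_prod_def lessThan_atLeast0 power2_eq_square)

lemma mulv_eq_mult_mat_vec:
  "A \<in> carrier_mat N N \<Longrightarrow> v \<in> carrier_vec N \<Longrightarrow> j < N \<Longrightarrow> mulv N A (($) v) j = (A *\<^sub>v v) $ j"
  by (simp add: mulv_def scalar_prod_def lessThan_atLeast0)

lemma mulv_vec: "A \<in> carrier_mat N N \<Longrightarrow> j < N \<Longrightarrow> mulv N A f j = (A *\<^sub>v Matrix.vec N f) $ j"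
  by (simp add: mulv_def scalar_prod_def lessThan_atLeast0)

lemma sqn_mulv_eq_scalar_prod:
  "A \<in> carrier_mat N N \<Longrightarrow> v \<in> carrier_vec N \<Longrightarrow> sqn N (mulv N A (($) v)) = scalar_prod (A *\<^sub>v v) (A *\<^sub>v v)"
  by (subst sqn_eq_scalar_prod[symmetric, where N=N])
     (auto intro!: sqn_cong simp: mulv_eq_mult_mat_vec simp del: index_mult_mat_vec)

lemma mulv_mult:
  assumes "A \<in> carrier_mat N N" "B \<in> carrier_mat N N" "j < N"
  shows "mulv N (A * B) f j = mulv N A (mulv N B f) j"
proof -
  have "mulv N (A * B) f j = (\<Sum>k<N. \<Sum>l<N. A $$ (j,l) * B $$ (l,k) * f k)"
    using assms by (auto intro!: sum.cong simp: mulv_def scalar_prod_def lessThan_atLeast0 sum_distrib_right)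
  also have "\<dots> = (\<Sum>l<N. \<Sum>k<N. A $$ (j,l) * B $$ (l,k) * f k)" by (rule sum.swap)
  finally show ?thesis by (simp add: mulv_def sum_distrib_left mult.assoc)
qed

lemma sqn_mulv_mult:
  "A \<in> carrier_mat N N \<Longrightarrow> B \<in> carrier_mat N N \<Longrightarrow>
   sqn N (mulv N (A * B) f) = sqn N (mulv N A (mulv N B f))"
  by (intro sqn_cong) (rule mulv_mult)

lemma mulv_one: "j < N \<Longrightarrow> mulv N (1\<^sub>m N) f j = f j"
proof -
  assume "j < N"
  then have "mulv N (1\<^sub>m N) f j = (\<Sum>k<N. if j = k then f k else 0)"
    unfolding mulv_def by (intro sum.cong) auto
  then show ?thesis using \<open>j < N\<close> by simp
qed

lemma frob_eq_mat_trace: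
  assumes A: "A \<in> carrier_mat N N"
  shows "frob N A = mat_trace (transpose_mat A * A)"
proof -
  have "mat_trace (transpose_mat A * A) = (\<Sum>j<N. \<Sum>i<N. (A $$ (i,j))\<^sup>2)"
    using A unfolding mat_trace_def
    by (intro sum.cong) (auto simp: scalar_prod_def lessThan_atLeast0 power2_eq_square)
  also have "\<dots> = frob N A" unfolding frob_def by (rule sum.swap)
  finally show ?thesis by simp
qed

text \<open>The trace of A^T A is cyclic and \<open>U\<close> cancels against itself. This supplies
  the invariance required of S = frob / N.\<close>

lemma frob_conj:
  assumes A: "A \<in> carrier_mat N N" and U: "U \<in> carrier_mat N N" "transpose_mat U = U" "U * U = 1\<^sub>m N"
  shows "frob N (U * A * U) = frob N A"
proof -
  have "U * (U * M) = M" if "M \<in> carrier_mat N N" for M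
    using U that by (simp add: assoc_mult_mat[of U N N U N _ N, symmetric])
  note UU = this
  have "frob N (U * A * U) = mat_trace (transpose_mat (U * A * U) * (U * A * U))"
    using A U by (intro frob_eq_mat_trace) auto
  also have "transpose_mat (U * A * U) * (U * A * U) = U * (transpose_mat A * A * U)"
    using A U UU by (simp add: transpose_mult[of _ N N _ N] assoc_mult_mat[of _ N N _ N _ N])
  also have "mat_trace \<dots> = mat_trace (transpose_mat A * A * U * U)"
    using A U by (intro mat_trace_comm[of _ N]) auto
  also have "transpose_mat A * A * U * U = transpose_mat A * A"
    using A U by (simp add: assoc_mult_mat[of _ N N _ N _ N])
  finally show ?thesis using frob_eq_mat_trace[OF A] by simp
qed

lemma sqn_mulv_involution:
  assumes U: "U \<in> carrier_mat N N" "transpose_mat U = U" "U * U = 1\<^sub>m N"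
  shows "sqn N (mulv N U f) = sqn N f"
proof -
  define v where "v = Matrix.vec N f"
  have v: "v \<in> carrier_vec N" by (simp add: v_def)
  have "sqn N (mulv N U f) = sqn N (mulv N U (($) v))"
    by (intro arg_cong[where f="sqn N"] mulv_cong) (simp add: v_def)
  also have "\<dots> = scalar_prod (U *\<^sub>v v) (U *\<^sub>v v)" using U v by (intro sqn_mulv_eq_scalar_prod)
  also have "\<dots> = scalar_prod v (U *\<^sub>v (U *\<^sub>v v))"
    using transpose_vec_mult_scalar[of U N N "U *\<^sub>v v" v] U v by simp
  also have "U *\<^sub>v (U *\<^sub>v v) = v" using U v by (metis assoc_mult_mat_vec one_mult_mat_vec)
  also have "scalar_prod v v = sqn N (($) v)" by (simp add: sqn_eq_scalar_prod[OF v])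
  also have "\<dots> = sqn N f" by (intro sqn_cong) (simp add: v_def)
  finally show ?thesis .
qed

section \<open>The Borel structure on matrices and invariance of the law\<close>

lemma space_borel_mat [simp]: "space (borel_mat N) = carrier_mat N N"
  by (simp add: borel_mat_def)

lemma measurable_entry [measurable]:
  assumes "j < N" "k < N"
  shows "(\<lambda>A. A $$ (j,k)) \<in> borel_measurable (borel_mat N)"
proof -
  have "(\<lambda>A. (\<lambda>(j, k) \<in> {..<N} \<times> {..<N}. A $$ (j, k)) (j,k)) \<in> borel_measurable (borel_mat N)"
    unfolding borel_mat_def
    by (rule measurable_compose[OF measurable_vimage_algebra1 measurable_component_singleton])
       (use assms in \<open>auto simp: space_PiM PiE_def extensional_def\<close>)
  then show ?thesis using assms by simp
qed

lemma measurable_borel_matI: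
  assumes "\<And>x. x \<in> space M \<Longrightarrow> F x \<in> carrier_mat N N"
    and "\<And>j k. j < N \<Longrightarrow> k < N \<Longrightarrow> (\<lambda>x. F x $$ (j,k)) \<in> borel_measurable M"
  shows "F \<in> measurable M (borel_mat N)"
  unfolding borel_mat_def
proof (rule measurable_vimage_algebra2)
  show "(\<lambda>x. \<lambda>(j, k)\<in>{..<N} \<times> {..<N}. F x $$ (j, k)) \<in> measurable M (Pi\<^sub>M ({..<N} \<times> {..<N}) (\<lambda>_. borel))"
  proof (rule measurable_restrict)
    fix i :: "nat \<times> nat" assume i: "i \<in> {..<N} \<times> {..<N}"
    obtain j k where jk: "i = (j,k)" by (cases i)
    then have "j < N" "k < N" using i by auto
    then show "(\<lambda>x. case i of (j, k) \<Rightarrow> F x $$ (j, k)) \<in> borel_measurable M"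
      using assms(2) by (simp add: jk)
  qed
  show "F \<in> space M \<rightarrow> carrier_mat N N" using assms(1) by blast
qed

lemma measurable_mulv [measurable]:
  assumes "j < N"
  shows "(\<lambda>A. mulv N A f j) \<in> borel_measurable (borel_mat N)"
  unfolding mulv_def using assms by (intro borel_measurable_sum borel_measurable_times measurable_entry) auto

lemma measurable_sqn_mulv [measurable]: "(\<lambda>A. sqn N (mulv N A f)) \<in> borel_measurable (borel_mat N)"
  unfolding sqn_def by (intro borel_measurable_sum borel_measurable_power measurable_mulv) auto

lemma measurable_frob [measurable]: "frob N \<in> borel_measurable (borel_mat N)"
  unfolding frob_def[abs_def] by (intro borel_measurable_sum borel_measurable_power measurable_entry) auto

lemma measurable_mult_mat:
  assumes "F \<in> measurable M (borel_mat N)" "G \<in> measurable M (borel_mat N)"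
  shows "(\<lambda>x. F x * G x) \<in> measurable M (borel_mat N)"
proof (rule measurable_borel_matI)
  have c: "F x \<in> carrier_mat N N" "G x \<in> carrier_mat N N" if "x \<in> space M" for x
    using assms that by (auto dest: measurable_space)
  show "F x * G x \<in> carrier_mat N N" if "x \<in> space M" for x using c[OF that] by simp
  fix j k assume jk: "j < N" "k < N"
  have "(\<lambda>x. \<Sum>l<N. F x $$ (j,l) * G x $$ (l,k)) \<in> borel_measurable M"
    using jk by (intro borel_measurable_sum borel_measurable_times
        measurable_compose[OF assms(1) measurable_entry] measurable_compose[OF assms(2) measurable_entry]) auto
  then show "(\<lambda>x. (F x * G x) $$ (j,k)) \<in> borel_measurable M"
    by (rule measurable_cong[THEN iffD1, rotated])
       (use carrier_matD[OF c(1)] carrier_matD[OF c(2)] jk in \<open>simp add: scalar_prod_def lessThan_atLeast0\<close>)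
qed

text \<open>Rotational invariance speaks only of finite families of bilinear values. Testing with
  all N * N pairs of basis vectors reads off every entry, so the law of the whole matrix is
  recovered: \<open>H\<close> lists the entries and \<open>\<tau>\<close> reassembles them.\<close>

lemma rotationally_invariant_distr:
  fixes M :: "'a measure"
  assumes X: "X \<in> measurable M (borel_mat N)" and inv: "rotationally_invariant M N X"
    and U: "U \<in> carrier_mat N N" "transpose_mat U = U" "U * U = 1\<^sub>m N" and N: "N \<ge> 1"
  shows "distr M (borel_mat N) (\<lambda>\<omega>. U * X \<omega> * U) = distr M (borel_mat N) X"
proof -
  let ?P = "PiM {1..N*N} (\<lambda>_. borel) :: (nat \<Rightarrow> real) measure"
  \<comment> \<open>Entry (j, k) sits at position Suc (j * N + k), since test vectors are indexed
    from 1; hence the shift by one before \<open>div\<close> and \<open>mod\<close>.\<close>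
  define v where "v i = (unit_vec N ((i - 1) mod N) :: real Matrix.vec)" for i :: nat
  define w where "w i = (unit_vec N ((i - 1) div N) :: real Matrix.vec)" for i :: nat
  define \<tau> where "\<tau> h = Matrix.mat N N (\<lambda>(j,k). h (Suc (j * N + k)) :: real)" for h :: "nat \<Rightarrow> real"
  define H where "H Y = (\<lambda>\<omega>. \<lambda>i\<in>{1..N*N}. scalar_prod (w i) (Y \<omega> *\<^sub>v v i))" for Y :: "'a \<Rightarrow> real mat"
  have lt: "Suc (j * N + k) \<in> {1..N*N}" if "j < N" "k < N" for j k
  proof -
    have "j * N + k < j * N + N" using that by simp
    also have "\<dots> = Suc j * N" by simp
    also have "\<dots> \<le> N * N" using that by (intro mult_le_mono1) simp
    finally show ?thesis by simp
  qed
  have c: "X \<omega> \<in> carrier_mat N N" if "\<omega> \<in> space M" for \<omega>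
    using X that by (auto dest: measurable_space)
  have Y: "(\<lambda>\<omega>. U * X \<omega> * U) \<in> measurable M (borel_mat N)"
    using X U by (intro measurable_mult_mat) auto
  have \<tau>: "\<tau> \<in> measurable ?P (borel_mat N)"
  proof (rule measurable_borel_matI)
    fix j k assume jk: "j < N" "k < N"
    have "(\<lambda>x. x (Suc (j * N + k))) \<in> borel_measurable ?P"
      by (rule measurable_component_singleton[OF lt[OF jk]])
    then show "(\<lambda>x. \<tau> x $$ (j, k)) \<in> borel_measurable ?P" using jk by (simp add: \<tau>_def)
  qed (simp add: \<tau>_def)
  have tH: "\<tau> (H Y \<omega>) = Y \<omega>" if "Y \<omega> \<in> carrier_mat N N" for Y \<omega>
  proof (rule eq_matI)
    fix j k assume "j < dim_row (Y \<omega>)" "k < dim_col (Y \<omega>)"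
    then have jk: "j < N" "k < N" using that by auto
    then show "\<tau> (H Y \<omega>) $$ (j,k) = Y \<omega> $$ (j,k)"
      using lt[OF jk] that by (auto simp: \<tau>_def H_def v_def w_def)
  qed (use that in \<open>auto simp: \<tau>_def\<close>)
  have d0: "(i - 1) div N < N" "(i - 1) mod N < N" if "i \<in> {1..N*N}" for i
    using that N by (auto simp: less_mult_imp_div_less)
  have Hm: "H Y \<in> measurable M ?P" if Ym: "Y \<in> measurable M (borel_mat N)" for Y
    unfolding H_def
  proof (rule measurable_restrict)
    fix i assume i: "i \<in> {1..N*N}"
    have "(\<lambda>x. Y x $$ ((i - 1) div N, (i - 1) mod N)) \<in> borel_measurable M"
      by (rule measurable_compose[OF Ym measurable_entry]) (use d0[OF i] in auto)
    moreover have "scalar_prod (w i) (Y x *\<^sub>v v i) = Y x $$ ((i - 1) div N, (i - 1) mod N)"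
      if x: "x \<in> space M" for x
    proof -
      have Yx: "Y x \<in> carrier_mat N N" using measurable_space[OF Ym x] by simp
      then have "scalar_prod (w i) (Y x *\<^sub>v v i) = (Y x *\<^sub>v v i) $ ((i - 1) div N)"
        using d0[OF i] unfolding w_def by (intro scalar_prod_left_unit[of _ N]) (auto simp: carrier_vecI)
      also have "\<dots> = Y x $$ ((i - 1) div N, (i - 1) mod N)"
        using Yx d0[OF i] unfolding v_def by simp
      finally show ?thesis .
    qed
    ultimately show "(\<lambda>x. scalar_prod (w i) (Y x *\<^sub>v v i)) \<in> borel_measurable M"
      by (simp cong: measurable_cong)
  qed
  have dist: "distr M (borel_mat N) Y = distr (distr M ?P (H Y)) (borel_mat N) \<tau>"
    if "Y \<in> measurable M (borel_mat N)" for Y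
  proof -
    have "distr (distr M ?P (H Y)) (borel_mat N) \<tau> = distr M (borel_mat N) (\<tau> \<circ> H Y)"
      by (rule distr_distr[OF \<tau> Hm[OF that]])
    also have "\<dots> = distr M (borel_mat N) Y"
      by (rule distr_cong) (use measurable_space[OF that] tH in auto)
    finally show ?thesis by simp
  qed
  have "distr M ?P (H X) = distr M ?P (\<lambda>\<omega>. \<lambda>i \<in> {1..N*N}. scalar_prod (U *\<^sub>v w i) (X \<omega> *\<^sub>v (U *\<^sub>v v i)))"
  proof -
    have "N * N \<ge> 1" using N by simp
    moreover have "U \<in> orthogonal_matrices N" using U by (simp add: orthogonal_matrices_def)
    moreover have "\<forall>i\<in>{1..N*N}. v i \<in> carrier_vec N \<and> w i \<in> carrier_vec N" by (simp add: v_def w_def)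
    ultimately show ?thesis using inv unfolding rotationally_invariant_def H_def by blast
  qed
  also have "\<dots> = distr M ?P (H (\<lambda>\<omega>. U * X \<omega> * U))"
  proof (rule distr_cong)
    fix \<omega> assume "\<omega> \<in> space M"
    note c = c[OF this]
    have "scalar_prod (U *\<^sub>v w i) (X \<omega> *\<^sub>v (U *\<^sub>v v i)) = scalar_prod (w i) ((U * X \<omega> * U) *\<^sub>v v i)" for i
    proof -
      have vw: "v i \<in> carrier_vec N" "w i \<in> carrier_vec N" by (simp_all add: v_def w_def)
      have "(U * X \<omega> * U) *\<^sub>v v i = U *\<^sub>v (X \<omega> *\<^sub>v (U *\<^sub>v v i))"
        using U c vw by (simp add: assoc_mult_mat_vec[of _ N N _ N])
      then show ?thesis
        using transpose_vec_mult_scalar[of U N N "X \<omega> *\<^sub>v (U *\<^sub>v v i)" "w i"] U c vw by simp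
    qed
    then show "(\<lambda>i \<in> {1..N*N}. scalar_prod (U *\<^sub>v w i) (X \<omega> *\<^sub>v (U *\<^sub>v v i))) = H (\<lambda>\<omega>. U * X \<omega> * U) \<omega>"
      by (simp add: H_def)
  qed auto
  finally show ?thesis using dist[OF X] dist[OF Y] by simp
qed

text \<open>With a reflection U taking f to g, |U X U f| = |U X g| = |X g|, and S does not see U.
  The pair enters through an arbitrary G because the norm and S are dependent and their quotient is
  needed.\<close>

lemma rotationally_invariant_unit_law:
  fixes G :: "real \<times> real \<Rightarrow> real"
  assumes X: "X \<in> measurable M (borel_mat N)" and inv: "rotationally_invariant M N X" and N: "N \<ge> 1"
    and S: "S \<in> borel_measurable (borel_mat N)"
    and Sinv: "\<And>A U. A \<in> carrier_mat N N \<Longrightarrow> U \<in> carrier_mat N N \<Longrightarrow> transpose_mat U = U \<Longrightarrow>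
      U * U = 1\<^sub>m N \<Longrightarrow> S (U * A * U) = S A"
    and G: "G \<in> borel_measurable borel"
    and f: "sqn N f = 1" and g: "sqn N g = 1"
  shows "distr M borel (\<lambda>\<omega>. G (sqn N (mulv N (X \<omega>) f), S (X \<omega>))) =
    distr M borel (\<lambda>\<omega>. G (sqn N (mulv N (X \<omega>) g), S (X \<omega>)))"
proof -
  have c: "X \<omega> \<in> carrier_mat N N" if "\<omega> \<in> space M" for \<omega>
    using X that by (auto dest: measurable_space)
  define u w where "u = Matrix.vec N f" and "w = Matrix.vec N g"
  have uw: "u \<in> carrier_vec N" "w \<in> carrier_vec N" by (auto simp: u_def w_def)
  have "sqn N (($) u) = 1" using f by (subst sqn_cong[of N "($) u" f]) (simp_all add: u_def)
  moreover have "sqn N (($) w) = 1" using g by (subst sqn_cong[of N "($) w" g]) (simp_all add: w_def)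
  ultimately have "scalar_prod u u = 1" "scalar_prod w w = 1"
    using sqn_eq_scalar_prod[OF uw(1)] sqn_eq_scalar_prod[OF uw(2)] by simp_all
  then obtain U where U: "U \<in> carrier_mat N N" "transpose_mat U = U" "U * U = 1\<^sub>m N" "U *\<^sub>v u = w"
    by (rule householder_exists[OF uw])
  have Ug: "mulv N U f j = g j" if "j < N" for j
    using mulv_vec[OF U(1) that, of f] U(4) that by (simp add: u_def w_def)
  let ?G = "\<lambda>A. G (sqn N (mulv N A f), S A)"
  have Gm: "?G \<in> borel_measurable (borel_mat N)"
    by (rule measurable_compose[OF borel_measurable_Pair[OF measurable_sqn_mulv S] G])
  have Y: "(\<lambda>\<omega>. U * X \<omega> * U) \<in> measurable M (borel_mat N)"
    using X U by (intro measurable_mult_mat) auto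
  have 1: "distr M borel (\<lambda>\<omega>. ?G (X \<omega>)) = distr M borel (\<lambda>\<omega>. ?G (U * X \<omega> * U))"
    using distr_distr[OF Gm X, unfolded comp_def] distr_distr[OF Gm Y, unfolded comp_def]
    unfolding rotationally_invariant_distr[OF X inv U(1-3) N] by (rule trans[OF sym])
  have 2: "distr M borel (\<lambda>\<omega>. ?G (U * X \<omega> * U)) =
    distr M borel (\<lambda>\<omega>. G (sqn N (mulv N (X \<omega>) g), S (X \<omega>)))"
  proof (rule distr_cong)
    fix \<omega> assume "\<omega> \<in> space M"
    note c = c[OF this]
    have "sqn N (mulv N (U * X \<omega> * U) f) = sqn N (mulv N (U * X \<omega>) (mulv N U f))"
      using U c by (intro sqn_mulv_mult) auto
    also have "\<dots> = sqn N (mulv N U (mulv N (X \<omega>) (mulv N U f)))"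
      using U c by (intro sqn_mulv_mult) auto
    also have "\<dots> = sqn N (mulv N (X \<omega>) (mulv N U f))" using sqn_mulv_involution[OF U(1-3)] .
    also have "mulv N (X \<omega>) (mulv N U f) = mulv N (X \<omega>) g" by (rule mulv_cong) (rule Ug)
    finally have "sqn N (mulv N (U * X \<omega> * U) f) = sqn N (mulv N (X \<omega>) g)" .
    then show "?G (U * X \<omega> * U) = G (sqn N (mulv N (X \<omega>) g), S (X \<omega>))"
      unfolding Sinv[OF c U(1-3)] by (rule arg_cong)
  qed (rule refl)+
  show ?thesis by (rule trans[OF 1 2])
qed

section \<open>Growth of a fixed vector\<close>

text \<open>The value at \<open>B f = 0\<close> keeps the direction a unit vector whenever \<open>f\<close> is one.\<close>

definition direction :: "nat \<Rightarrow> (nat \<Rightarrow> real) \<Rightarrow> real Matrix.mat \<Rightarrow> nat \<Rightarrow> real" where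
  "direction N f B k = (if sqn N (mulv N B f) = 0 then f k else mulv N B f k / sqrt (sqn N (mulv N B f)))"

lemma sqn_direction: "sqn N f = 1 \<Longrightarrow> sqn N (direction N f B) = 1"
proof (cases "sqn N (mulv N B f) = 0")
  case False
  then have "sqn N (mulv N B f) > 0" using sqn_nonneg[of N "mulv N B f"] by linarith
  moreover have "direction N f B = (\<lambda>k. 1 / sqrt (sqn N (mulv N B f)) * mulv N B f k)"
    using False by (auto simp: direction_def)
  ultimately show ?thesis by (simp only: sqn_scale) (simp add: power_divide)
qed (simp add: direction_def[abs_def])

lemma sqn_mulv_direction:
  assumes "A \<in> carrier_mat N N" "B \<in> carrier_mat N N"
  shows "sqn N (mulv N (A * B) f) = sqn N (mulv N A (direction N f B)) * sqn N (mulv N B f)"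
proof (cases "sqn N (mulv N B f) = 0")
  case True
  then have "\<And>k. k < N \<Longrightarrow> mulv N B f k = 0" unfolding sqn_def by (simp add: sum_nonneg_eq_0_iff)
  then have "mulv N A (mulv N B f) = (\<lambda>j. 0)" by (auto simp: mulv_def[of N A] fun_eq_iff)
  then show ?thesis using True sqn_mulv_mult[OF assms] by (simp add: sqn_def)
next
  case False
  then have pos: "sqn N (mulv N B f) > 0" using sqn_nonneg[of N "mulv N B f"] by linarith
  have "direction N f B = (\<lambda>k. 1 / sqrt (sqn N (mulv N B f)) * mulv N B f k)"
    using False by (auto simp: direction_def)
  then show ?thesis using pos by (simp only: sqn_mulv_mult[OF assms] sqn_mulv_scale) (simp add: power_divide)
qed

lemma sqn_mulv_mat_prod:
  assumes "\<And>i. i \<ge> 1 \<Longrightarrow> A i \<in> carrier_mat N N" and f: "sqn N f = 1"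
  shows "mat_prod N A n \<in> carrier_mat N N"
    and "sqn N (mulv N (mat_prod N A n) f) =
      (\<Prod>i=1..n. sqn N (mulv N (A i) (direction N f (mat_prod N A (i - 1)))))"
proof -
  show c: "mat_prod N A n \<in> carrier_mat N N" for n
    by (induction n) (use assms(1) in \<open>auto intro!: mult_carrier_mat\<close>)
  show "sqn N (mulv N (mat_prod N A n) f) =
      (\<Prod>i=1..n. sqn N (mulv N (A i) (direction N f (mat_prod N A (i - 1)))))"
  proof (induction n)
    case 0
    have "sqn N (mulv N (1\<^sub>m N) f) = sqn N f" by (rule sqn_cong) (rule mulv_one)
    then show ?case using f by simp
  next
    case (Suc n)
    then show ?case using sqn_mulv_direction[OF assms(1)[of "Suc n"] c[of n], of f] by simp
  qed
qed

section \<open>Independence of the successive steps\<close>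

lemma mat_prod_cong: "(\<And>i. i \<in> {1..n} \<Longrightarrow> A i = B i) \<Longrightarrow> mat_prod N A n = mat_prod N B n"
  by (induction n) auto

lemma measurable_mat_prod:
  assumes "\<And>i. i \<in> {1..n} \<Longrightarrow> (\<lambda>x. F x i) \<in> measurable M (borel_mat N)"
  shows "(\<lambda>x. mat_prod N (F x) n) \<in> measurable M (borel_mat N)"
  using assms
proof (induction n)
  case (Suc n)
  have "(\<lambda>x. F x (Suc n) * mat_prod N (F x) n) \<in> measurable M (borel_mat N)"
    by (intro measurable_mult_mat Suc.IH) (rule Suc.prems, simp)+
  then show ?case by simp
qed simp

lemma measurable_sqn_mulv_direction:
  "(\<lambda>(A, B). sqn N (mulv N A (direction N f B))) \<in> borel_measurable (borel_mat N \<Otimes>\<^sub>M borel_mat N)"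
proof -
  have [measurable]: "(\<lambda>x. fst x $$ (j,k)) \<in> borel_measurable (borel_mat N \<Otimes>\<^sub>M borel_mat N)" if "j < N" "k < N" for j k
    by (rule measurable_compose[OF measurable_fst measurable_entry[OF that]])
  have [measurable]: "(\<lambda>x. sqn N (mulv N (snd x) f)) \<in> borel_measurable (borel_mat N \<Otimes>\<^sub>M borel_mat N)"
    by (rule measurable_compose[OF measurable_snd measurable_sqn_mulv])
  have [measurable]: "(\<lambda>x. mulv N (snd x) f k) \<in> borel_measurable (borel_mat N \<Otimes>\<^sub>M borel_mat N)" if "k < N" for k
    by (rule measurable_compose[OF measurable_snd measurable_mulv[OF that]])
  have "(\<lambda>x. sqn N (mulv N (fst x) (direction N f (snd x)))) \<in> borel_measurable (borel_mat N \<Otimes>\<^sub>M borel_mat N)"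
    unfolding sqn_def[of N "mulv N (fst _) (direction N f (snd _))"] mulv_def[of N "fst _" "direction N f (snd _)"] direction_def
    by (intro borel_measurable_sum borel_measurable_power borel_measurable_times) auto
  then show ?thesis by (simp add: case_prod_beta')
qed

text \<open>Describes how factor i acts on the direction left by the first i - 1 factors. With G
  open, one independence theorem covers the logarithms, the positivity and the powers of the
  quotient.\<close>

definition step_stat ::
    "nat \<Rightarrow> (real \<times> real \<Rightarrow> real) \<Rightarrow> (real Matrix.mat \<Rightarrow> real) \<Rightarrow> (nat \<Rightarrow> real) \<Rightarrow> (nat \<Rightarrow> real Matrix.mat) \<Rightarrow> nat \<Rightarrow> real" where
  "step_stat N G S f A i = G (sqn N (mulv N (A i) (direction N f (mat_prod N A (i - 1)))), S (A i))"

text \<open>The directions depend on the past, but by \<open>law\<close> a step has the same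
  distribution along every unit direction. Conditionally on the past it therefore has law D, which
  yields independence and identical distribution together.\<close>

lemma (in prob_space) step_stat_iid:
  fixes X :: "nat \<Rightarrow> 'a \<Rightarrow> real Matrix.mat" and G :: "real \<times> real \<Rightarrow> real"
  assumes ind: "indep_vars (\<lambda>_. borel_mat N) X {1..}"
    and G: "G \<in> borel_measurable borel" and S: "S \<in> borel_measurable (borel_mat N)"
    and f: "sqn N f = 1"
    and law: "\<And>i h. i \<ge> 1 \<Longrightarrow> sqn N h = 1 \<Longrightarrow>
      distr M borel (\<lambda>\<omega>. G (sqn N (mulv N (X i \<omega>) h), S (X i \<omega>))) = D"
  shows "indep_vars (\<lambda>_. borel) (\<lambda>i \<omega>. step_stat N G S f (\<lambda>i. X i \<omega>) i) {1..}" (is "indep_vars _ ?Y _")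
    and "i \<ge> 1 \<Longrightarrow> distr M borel (\<lambda>\<omega>. step_stat N G S f (\<lambda>i. X i \<omega>) i) = D"
proof -
  have X: "X i \<in> measurable M (borel_mat N)" if "i \<ge> 1" for i
    using ind that unfolding indep_vars_def by auto
  let ?Q = "\<lambda>n. PiM {1..n} (\<lambda>_. borel_mat N)"
  have ymeas: "(\<lambda>x. G (sqn N (mulv N (a x) (direction N f (b x))), S (a x))) \<in> borel_measurable K"
    if a: "a \<in> measurable K (borel_mat N)" and b: "b \<in> measurable K (borel_mat N)" for a b and K :: "'k measure"
  proof -
    have "(\<lambda>x. sqn N (mulv N (a x) (direction N f (b x)))) \<in> borel_measurable K"
      using measurable_compose[OF measurable_Pair[OF a b] measurable_sqn_mulv_direction] by simp
    then show ?thesis by (rule measurable_compose[OF borel_measurable_Pair[OF _ measurable_compose[OF a S]] G])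
  qed
  have Ymeas: "(\<lambda>x. step_stat N G S f (F x) i) \<in> borel_measurable K"
    if F: "\<And>j. j \<in> {1..i} \<Longrightarrow> (\<lambda>x. F x j) \<in> measurable K (borel_mat N)" and i: "i \<ge> 1" for F i and K :: "'k measure"
    unfolding step_stat_def
  proof (rule ymeas)
    show "(\<lambda>x. F x i) \<in> measurable K (borel_mat N)" by (rule F) (use i in simp)
    show "(\<lambda>x. mat_prod N (F x) (i - 1)) \<in> measurable K (borel_mat N)"
      by (rule measurable_mat_prod, rule F) auto
  qed
  have Ym: "?Y i \<in> borel_measurable M" if i: "i \<ge> 1" for i
    by (rule Ymeas[OF X i]) simp
  have "(\<lambda>A. G (sqn N (mulv N A f), S A)) \<in> borel_measurable (borel_mat N)"
    by (rule measurable_compose[OF borel_measurable_Pair[OF measurable_sqn_mulv S] G])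
  from measurable_compose[OF X[OF order_refl] this]
  have "prob_space (distr M borel (\<lambda>\<omega>. G (sqn N (mulv N (X 1 \<omega>) f), S (X 1 \<omega>))))"
    by (rule prob_space_distr)
  then interpret D: prob_space D by (simp only: law[OF order_refl f])
  have setsD: "sets D = sets borel" unfolding law[OF order_refl f, symmetric] by simp
  \<comment> \<open>Rectangles over an initial segment are factorised by induction, splitting off
    the last factor.\<close>
  have key: "emeasure M {\<omega>\<in>space M. \<forall>i\<in>{1..n}. ?Y i \<omega> \<in> B i} = (\<Prod>i=1..n. emeasure D (B i))"
    if B: "\<And>i. B i \<in> sets borel" for n B
  proof (induction n)
    case 0
    then show ?case by (simp add: emeasure_space_1)
  next
    case (Suc n)
    define past where "past = (\<lambda>\<omega>. restrict (\<lambda>i. X i \<omega>) {1..n})"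
    define E where "E = {p \<in> space (?Q n). \<forall>i\<in>{1..n}. step_stat N G S f p i \<in> B i}"
    have iv: "indep_var (?Q n) past (PiM {Suc n} (\<lambda>_. borel_mat N)) (\<lambda>\<omega>. restrict (\<lambda>i. X i \<omega>) {Suc n})"
      unfolding past_def by (rule indep_var_restrict[OF ind]) auto
    define now where "now = (\<lambda>\<omega>. restrict (\<lambda>i. X i \<omega>) {Suc n})"
    let ?R = "PiM {Suc n} (\<lambda>_. borel_mat N)"
    from iv have rv: "past \<in> measurable M (?Q n)" "now \<in> measurable M ?R"
      and prodeq: "distr M (?Q n) past \<Otimes>\<^sub>M distr M ?R now = distr M (?Q n \<Otimes>\<^sub>M ?R) (\<lambda>\<omega>. (past \<omega>, now \<omega>))"
      unfolding indep_var_distribution_eq now_def by auto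
    have comp: "(\<lambda>q. q (Suc n)) \<in> measurable ?R (borel_mat N)"
      by (rule measurable_component_singleton) simp
    let ?P = "distr M (?Q n) past" and ?L = "distr M ?R now"
    interpret L: prob_space ?L using rv by (intro prob_space_distr)
    interpret P: prob_space ?P using rv by (intro prob_space_distr)
    interpret PL: pair_prob_space ?P ?L ..
    let ?y = "\<lambda>p A. G (sqn N (mulv N A (direction N f (mat_prod N p n))), S A)"
    let ?F = "{x \<in> space (?Q n \<Otimes>\<^sub>M ?R). fst x \<in> E \<and> ?y (fst x) (snd x (Suc n)) \<in> B (Suc n)}"
    have mp: "(\<lambda>p. mat_prod N p n) \<in> measurable (?Q n) (borel_mat N)"
      by (intro measurable_mat_prod measurable_component_singleton)
    have Em: "E \<in> sets (?Q n)"
    proof -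
      have "(\<lambda>p. step_stat N G S f p i) \<in> borel_measurable (?Q n)" if "i \<in> {1..n}" for i
        by (rule Ymeas, rule measurable_component_singleton) (use that in auto)
      then have "{p \<in> space (?Q n). step_stat N G S f p i \<in> B i} \<in> sets (?Q n)" if "i \<in> {1..n}" for i
        using that measurable_sets[OF _ B[of i], of "\<lambda>p. step_stat N G S f p i" "?Q n"]
        by (simp add: vimage_def Int_def conj_commute)
      then show ?thesis unfolding E_def by (intro sets.sets_Collect_finite_All) auto
    qed
    have ym: "(\<lambda>x. ?y (fst x) (snd x (Suc n))) \<in> borel_measurable (?Q n \<Otimes>\<^sub>M ?R)"
      by (intro ymeas measurable_compose[OF measurable_fst mp] measurable_compose[OF measurable_snd comp])
    have Fm: "?F \<in> sets (?Q n \<Otimes>\<^sub>M ?R)"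
    proof -
      have "?F = (fst -` E \<inter> space (?Q n \<Otimes>\<^sub>M ?R)) \<inter>
          ((\<lambda>x. ?y (fst x) (snd x (Suc n))) -` B (Suc n) \<inter> space (?Q n \<Otimes>\<^sub>M ?R))" by auto
      also have "\<dots> \<in> sets (?Q n \<Otimes>\<^sub>M ?R)"
        by (intro sets.Int measurable_sets[OF measurable_fst Em] measurable_sets[OF ym B])
      finally show ?thesis .
    qed
    have yp: "past \<omega> \<in> E \<longleftrightarrow> (\<forall>i\<in>{1..n}. ?Y i \<omega> \<in> B i)" if "\<omega> \<in> space M" for \<omega>
    proof -
      have "step_stat N G S f (past \<omega>) i = ?Y i \<omega>" if "i \<in> {1..n}" for i
      proof -
        have "mat_prod N (past \<omega>) (i - 1) = mat_prod N (\<lambda>i. X i \<omega>) (i - 1)"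
          using that by (intro mat_prod_cong) (auto simp: past_def)
        then show ?thesis using that by (simp add: step_stat_def past_def)
      qed
      then show ?thesis using measurable_space[OF rv(1) that] by (auto simp: E_def)
    qed
    have mpe: "mat_prod N (past \<omega>) n = mat_prod N (\<lambda>i. X i \<omega>) n" for \<omega>
      by (intro mat_prod_cong) (auto simp: past_def)
    have "{\<omega>\<in>space M. \<forall>i\<in>{1..Suc n}. ?Y i \<omega> \<in> B i} =
      (\<lambda>\<omega>. (past \<omega>, now \<omega>)) -` ?F \<inter> space M"
    proof (intro Set.set_eqI iffI)
      fix \<omega>
      have 1: "(\<forall>i\<in>{1..Suc n}. ?Y i \<omega> \<in> B i) \<longleftrightarrow> (\<forall>i\<in>{1..n}. ?Y i \<omega> \<in> B i) \<and> ?Y (Suc n) \<omega> \<in> B (Suc n)"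
        by (metis (no_types, lifting) One_nat_def Suc_leI atLeastAtMost_iff le_Suc_eq zero_less_Suc)
      have 2: "?Y (Suc n) \<omega> = ?y (past \<omega>) (now \<omega> (Suc n))" by (simp add: step_stat_def mpe now_def)
      { assume "\<omega> \<in> {\<omega>\<in>space M. \<forall>i\<in>{1..Suc n}. ?Y i \<omega> \<in> B i}"
        then show "\<omega> \<in> (\<lambda>\<omega>. (past \<omega>, now \<omega>)) -` ?F \<inter> space M"
          using 1 2 yp[of \<omega>] measurable_space[OF rv(1), of \<omega>] measurable_space[OF rv(2), of \<omega>]
          by (simp add: space_pair_measure del: space_borel_mat) }
      { assume "\<omega> \<in> (\<lambda>\<omega>. (past \<omega>, now \<omega>)) -` ?F \<inter> space M"
        then show "\<omega> \<in> {\<omega>\<in>space M. \<forall>i\<in>{1..Suc n}. ?Y i \<omega> \<in> B i}"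
          using 1 2 yp[of \<omega>] by (simp del: space_borel_mat) }
    qed
    then have "emeasure M {\<omega>\<in>space M. \<forall>i\<in>{1..Suc n}. ?Y i \<omega> \<in> B i} =
      emeasure (distr M (?Q n \<Otimes>\<^sub>M ?R) (\<lambda>\<omega>. (past \<omega>, now \<omega>))) ?F"
      using emeasure_distr[OF measurable_Pair[OF rv] Fm] by simp
    also have "\<dots> = emeasure (?P \<Otimes>\<^sub>M ?L) ?F" by (simp only: prodeq)
    also have "\<dots> = (\<integral>\<^sup>+p. emeasure ?L (Pair p -` ?F) \<partial>?P)"
      using Fm by (intro L.emeasure_pair_measure_alt) (simp add: sets_pair_measure_cong[of ?P "?Q n" ?L ?R])
    \<comment> \<open>With the past frozen at p, its direction is a fixed unit vector, so the inner
      measure is the same constant for every p in E.\<close>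
    also have "\<dots> = (\<integral>\<^sup>+p. emeasure D (B (Suc n)) * indicator E p \<partial>?P)"
    proof (rule nn_integral_cong)
      fix p assume "p \<in> space ?P"
      then have p: "p \<in> space (?Q n)" by simp
      show "emeasure ?L (Pair p -` ?F) = emeasure D (B (Suc n)) * indicator E p"
      proof (cases "p \<in> E")
        case True
        have unit: "sqn N (direction N f (mat_prod N p n)) = 1" by (rule sqn_direction[OF f])
        have m: "(\<lambda>A. ?y p A) \<in> borel_measurable (borel_mat N)"
          by (rule measurable_compose[OF borel_measurable_Pair[OF measurable_sqn_mulv S] G])
        have m': "(\<lambda>q. ?y p (q (Suc n))) \<in> borel_measurable ?R" by (rule measurable_compose[OF comp m])
        have "Pair p -` ?F = (\<lambda>q. ?y p (q (Suc n))) -` B (Suc n) \<inter> space ?L"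
          using True p by (auto simp: space_pair_measure)
        then have 1: "emeasure ?L (Pair p -` ?F) = emeasure (distr ?L borel (\<lambda>q. ?y p (q (Suc n)))) (B (Suc n))"
          using emeasure_distr[of "\<lambda>q. ?y p (q (Suc n))" ?L borel "B (Suc n)"] m' B[of "Suc n"] by simp
        have "distr ?L borel (\<lambda>q. ?y p (q (Suc n))) = distr M borel (\<lambda>\<omega>. ?y p (X (Suc n) \<omega>))"
          using distr_distr[OF m' rv(2)] by (simp add: comp_def now_def)
        also have "\<dots> = D" using law[OF _ unit, of "Suc n"] by simp
        finally show ?thesis using True 1 by simp
      next
        case False
        then have "Pair p -` ?F = {}" by auto
        then show ?thesis using False by simp
      qed
    qed
    also have "\<dots> = emeasure D (B (Suc n)) * emeasure ?P E"
      using Em by (simp add: nn_integral_cmult_indicator)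
    also have "emeasure ?P E = emeasure M {\<omega>\<in>space M. \<forall>i\<in>{1..n}. ?Y i \<omega> \<in> B i}"
      using rv Em yp by (auto simp: emeasure_distr intro!: arg_cong[where f="emeasure M"])
    also have "\<dots> = (\<Prod>i=1..n. emeasure D (B i))" by (rule Suc.IH)
    finally show ?case by (simp add: mult.commute)
  qed
  have spD: "emeasure D UNIV = 1"
    using D.emeasure_space_1 sets_eq_imp_space_eq[OF setsD] by simp
  have keyJ: "emeasure M {\<omega>\<in>space M. \<forall>i\<in>J. ?Y i \<omega> \<in> B i} = (\<Prod>i\<in>J. emeasure D (B i))"
    if J: "finite J" "J \<subseteq> {1..}" and B: "\<And>i. i \<in> J \<Longrightarrow> B i \<in> sets borel" for J B
  proof -
    obtain n where "\<forall>x\<in>J. x \<le> n" using J(1) by (auto simp: finite_nat_set_iff_bounded_le)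
    then have n: "J \<subseteq> {1..n}" using J(2) by fastforce
    \<comment> \<open>Indices outside J receive the trivial set, of D-mass 1, so that J may be
      replaced by an initial segment.\<close>
    define C where "C i = (if i \<in> J then B i else UNIV)" for i
    have "{\<omega>\<in>space M. \<forall>i\<in>J. ?Y i \<omega> \<in> B i} = {\<omega>\<in>space M. \<forall>i\<in>{1..n}. ?Y i \<omega> \<in> C i}"
      using n by (auto simp: C_def)
    moreover have "(\<Prod>i=1..n. emeasure D (C i)) = (\<Prod>i\<in>J. emeasure D (B i))"
      using n by (intro prod.mono_neutral_cong_right) (auto simp: C_def spD)
    moreover have "C i \<in> sets borel" for i using B[of i] by (simp add: C_def)
    ultimately show ?thesis using key[of C n] by simp
  qed
  have one: "emeasure M (?Y i -` B \<inter> space M) = emeasure D B" if "i \<ge> 1" "B \<in> sets borel" for i B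
  proof -
    have "?Y i -` B \<inter> space M = {\<omega>\<in>space M. \<forall>j\<in>{i}. ?Y j \<omega> \<in> B}" by auto
    moreover have "emeasure M {\<omega>\<in>space M. \<forall>j\<in>{i}. ?Y j \<omega> \<in> B} = (\<Prod>j\<in>{i}. emeasure D B)"
      by (rule keyJ) (use that in auto)
    ultimately show ?thesis by simp
  qed
  show "i \<ge> 1 \<Longrightarrow> distr M borel (?Y i) = D"
    by (rule measure_eqI) (auto simp: setsD emeasure_distr Ym one)
  show "indep_vars (\<lambda>_. borel) ?Y {1..}"
    unfolding indep_vars_def2
  proof (intro conjI ballI indep_setsI)
    fix A J assume J: "J \<noteq> {}" "J \<subseteq> {1::nat..}" "finite J" and A: "\<forall>j\<in>J. A j \<in> {?Y j -` B \<inter> space M |B. B \<in> sets borel}"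
    then obtain B where B: "\<And>j. j \<in> J \<Longrightarrow> A j = ?Y j -` B j \<inter> space M \<and> B j \<in> sets borel"
      by (simp only: mem_Collect_eq) metis
    have "(\<Inter>j\<in>J. A j) = (\<Inter>j\<in>J. ?Y j -` B j \<inter> space M)"
      by (rule INF_cong[OF refl]) (use B in blast)
    also have "\<dots> = {\<omega>\<in>space M. \<forall>i\<in>J. ?Y i \<omega> \<in> B i}" using J(1) by auto
    finally have "emeasure M (\<Inter>j\<in>J. A j) = (\<Prod>i\<in>J. emeasure D (B i))"
      using keyJ[OF J(3,2), of B] B by simp
    also have "\<dots> = (\<Prod>i\<in>J. emeasure M (A i))"
    proof (rule prod.cong[OF refl])
      fix i assume i: "i \<in> J"
      show "emeasure D (B i) = emeasure M (A i)" using B[OF i] one[of i "B i"] J(2) i by auto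
    qed
    finally show "prob (\<Inter>j\<in>J. A j) = (\<Prod>j\<in>J. prob (A j))"
      by (simp add: emeasure_eq_measure prod_ennreal prod_nonneg)
  next
    fix i :: nat assume "i \<in> {1..}"
    then have "?Y i \<in> borel_measurable M" by (intro Ym) simp
    then show "{?Y i -` A \<inter> space M |A. A \<in> sets borel} \<subseteq> events" "?Y i \<in> borel_measurable M"
      by (auto intro: measurable_sets)
  qed
qed

section \<open>Gaussian vectors\<close>

abbreviation std_gauss :: "real measure" where
  "std_gauss \<equiv> density lborel (\<lambda>x. ennreal (std_normal_density x))"

definition gauss :: "nat \<Rightarrow> (nat \<Rightarrow> real) measure" where
  "gauss N = PiM {..<N} (\<lambda>_. std_gauss)"

lemma prob_space_std_gauss: "prob_space std_gauss"
  by (rule prob_space_normal_density) simp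

lemma prob_space_gauss: "prob_space (gauss N)"
  unfolding gauss_def by (intro prob_space_PiM prob_space_std_gauss)

lemma sets_gauss [measurable_cong]: "sets (gauss N) = sets (PiM {..<N} (\<lambda>_. borel))"
  unfolding gauss_def by (intro sets_PiM_cong) auto

text \<open>Apply ln y \<le> y to y = sqrt x for large x and to y = x powr (-1/8) for small x. For
  the square of a Gaussian variable x, the power -1/4 becomes |x| powr (-1/2), which is integrable
  at 0.\<close>

lemma ln_sq_le:
  fixes x :: real assumes "x > 0"
  shows "(ln x)\<^sup>2 \<le> 4 * x + 64 * x powr (-1/4)"
proof (cases "x \<ge> 1")
  case True
  have "ln x = 2 * ln (sqrt x)" using assms by (simp add: ln_sqrt)
  also have "\<dots> \<le> 2 * sqrt x" using ln_less_self[of "sqrt x"] assms by (simp add: less_imp_le)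
  finally have "ln x \<le> 2 * sqrt x" .
  moreover have "0 \<le> ln x" using True by simp
  ultimately have "(ln x)\<^sup>2 \<le> (2 * sqrt x)\<^sup>2" by (intro power_mono)
  also have "\<dots> = 4 * x" using assms by simp
  finally show ?thesis using powr_ge_zero[of x "-1/4"] by linarith
next
  case False
  have "- ln x = 8 * ln (x powr (-1/8))" using assms by (simp add: ln_powr)
  also have "\<dots> \<le> 8 * x powr (-1/8)" using ln_less_self[of "x powr (-1/8)"] assms by (simp add: less_imp_le)
  finally have "- ln x \<le> 8 * x powr (-1/8)" .
  moreover have "0 \<le> - ln x" using False assms by simp
  ultimately have "(- ln x)\<^sup>2 \<le> (8 * x powr (-1/8))\<^sup>2" by (intro power_mono)
  also have "\<dots> = 64 * x powr (-1/4)"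
    using assms by (simp add: power_mult_distrib power2_eq_square powr_add[symmetric])
  finally show ?thesis using assms by simp
qed

lemma nn_integral_gauss_sq: "(\<integral>\<^sup>+x. ennreal (x\<^sup>2) \<partial>std_gauss) = 1"
proof -
  have "(\<integral>\<^sup>+x. ennreal (x\<^sup>2) \<partial>std_gauss) = (\<integral>\<^sup>+x. ennreal (std_normal_density x * x ^ (2 * 1)) \<partial>lborel)"
    by (subst nn_integral_density) (auto simp: ennreal_mult'[symmetric] intro!: nn_integral_cong)
  also have "\<dots> = ennreal (fact (2 * 1) / (2^1 * fact 1))"
    using std_normal_moment_even[of 1] by (subst nn_integral_eq_integral) (auto simp: has_bochner_integral_iff)
  finally show ?thesis by simp
qed

text \<open>324 = 4 * 1 + 64 * (1 + 4): the second moment and the mass are 1, and |x| powr (-1/2)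
  has Lebesgue integral 4 over [-1, 1], while the normal density is at most 1.\<close>

lemma nn_integral_gauss_ln_sq: "(\<integral>\<^sup>+x. ennreal ((ln (x\<^sup>2))\<^sup>2) \<partial>std_gauss) \<le> 324"
proof -
  have le: "std_normal_density x \<le> 1" for x :: real
  proof -
    have "1 \<le> sqrt (2 * pi)" using pi_gt3 by simp
    then have "1 / sqrt (2 * pi) * exp (- x\<^sup>2 / 2) \<le> 1 * 1" by (intro mult_mono) auto
    then show ?thesis by (simp add: std_normal_density_def)
  qed
  have "((\<lambda>x. x powr (-1/2)) has_integral (1 powr (-1/2+1) / (-1/2+1))) {0..1::real}"
    by (rule has_integral_powr_from_0) auto
  then have i1: "((\<lambda>x. \<bar>x\<bar> powr (-1/2)) has_integral 2) {0..1::real}"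
    by (subst has_integral_cong[of _ _ "\<lambda>x. x powr (-1/2)"]) auto
  then have i2: "((\<lambda>x. \<bar>x\<bar> powr (-1/2)) has_integral 2) {-1..0::real}"
    using has_integral_reflect_real[of "\<lambda>x. \<bar>x\<bar> powr (-1/2)" 2 1 0] by simp
  have i3: "((\<lambda>x. \<bar>x\<bar> powr (-1/2)) has_integral 4) {-1..1::real}"
    using has_integral_combine[OF _ _ i2 i1] by simp
  have i4: "(\<integral>\<^sup>+x\<in>{-1..1}. ennreal (\<bar>x\<bar> powr (-1/2)) \<partial>lborel) = 4"
    using nn_integral_has_integral_lebesgue[OF _ i3]
    by (simp add: nn_integral_completion ennreal_indicator[symmetric] mult.commute ennreal_mult'[symmetric])
  have pt: "ennreal ((ln (x\<^sup>2))\<^sup>2) \<le> 4 * ennreal (x\<^sup>2) + 64 * (1 + ennreal (\<bar>x\<bar> powr (-1/2)) * indicator {-1..1} x)" for x :: real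
  proof (cases "x = 0")
    case False
    then have "(ln (x\<^sup>2))\<^sup>2 \<le> 4 * x\<^sup>2 + 64 * (x\<^sup>2) powr (-1/4)" by (intro ln_sq_le) simp
    also have "(x\<^sup>2) powr (-1/4) = \<bar>x\<bar> powr (-1/2)"
      using False powr_powr[of "\<bar>x\<bar>" 2 "-1/4"] by (simp add: powr_numeral)
    also have "\<bar>x\<bar> powr (-1/2) \<le> 1 + \<bar>x\<bar> powr (-1/2) * indicator {-1..1} x"
    proof (cases "x \<in> {-1..1}")
      case False
      then have "\<bar>x\<bar> \<ge> 1" by auto
      then have "\<bar>x\<bar> powr (-1/2) \<le> \<bar>x\<bar> powr 0" by (intro powr_mono) auto
      then show ?thesis using False \<open>x \<noteq> 0\<close> by simp
    qed simp
    finally have "(ln (x\<^sup>2))\<^sup>2 \<le> 4 * x\<^sup>2 + 64 * (1 + \<bar>x\<bar> powr (-1/2) * indicator {-1..1} x)" by simp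
    then have "ennreal ((ln (x\<^sup>2))\<^sup>2) \<le> ennreal (4 * x\<^sup>2 + 64 * (1 + \<bar>x\<bar> powr (-1/2) * indicator {-1..1} x))"
      by (rule ennreal_leI)
    also have "\<dots> = 4 * ennreal (x\<^sup>2) + 64 * (1 + ennreal (\<bar>x\<bar> powr (-1/2)) * indicator {-1..1} x)"
      by (simp add: ennreal_plus ennreal_mult ennreal_indicator)
    finally show ?thesis .
  qed simp
  have "(\<integral>\<^sup>+x. ennreal ((ln (x\<^sup>2))\<^sup>2) \<partial>std_gauss) \<le>
     (\<integral>\<^sup>+x. 4 * ennreal (x\<^sup>2) + 64 * (1 + ennreal (\<bar>x\<bar> powr (-1/2)) * indicator {-1..1} x) \<partial>std_gauss)"
    by (rule nn_integral_mono) (rule pt)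
  also have "\<dots> = 4 * (\<integral>\<^sup>+x. ennreal (x\<^sup>2) \<partial>std_gauss) + 64 * ((\<integral>\<^sup>+x. 1 \<partial>std_gauss) +
       (\<integral>\<^sup>+x. ennreal (\<bar>x\<bar> powr (-1/2)) * indicator {-1..1} x \<partial>std_gauss))"
    by (subst nn_integral_add, simp, simp, subst nn_integral_cmult, simp, subst nn_integral_cmult, simp,
        subst nn_integral_add) auto
  also have "(\<integral>\<^sup>+x. 1 \<partial>std_gauss) = 1"
    using prob_space.emeasure_space_1[OF prob_space_std_gauss] by simp
  also have "(\<integral>\<^sup>+x. ennreal (\<bar>x\<bar> powr (-1/2)) * indicator {-1..1} x \<partial>std_gauss) \<le>
     (\<integral>\<^sup>+x\<in>{-1..1}. ennreal (\<bar>x\<bar> powr (-1/2)) \<partial>lborel)"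
  proof (subst nn_integral_density)
    show "(\<integral>\<^sup>+ x. ennreal (std_normal_density x) * (ennreal (\<bar>x\<bar> powr (- 1 / 2)) * indicator {- 1..1} x) \<partial>lborel)
      \<le> (\<integral>\<^sup>+x\<in>{-1..1}. ennreal (\<bar>x\<bar> powr (-1/2)) \<partial>lborel)"
    proof (rule nn_integral_mono)
      fix x :: real
      have "ennreal (std_normal_density x) \<le> 1" using le[of x] by simp
      then have "ennreal (std_normal_density x) * (ennreal (\<bar>x\<bar> powr (- 1 / 2)) * indicator {- 1..1} x)
        \<le> 1 * (ennreal (\<bar>x\<bar> powr (- 1 / 2)) * indicator {- 1..1} x)" by (intro mult_right_mono) auto
      then show "ennreal (std_normal_density x) * (ennreal (\<bar>x\<bar> powr (- 1 / 2)) * indicator {- 1..1} x)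
        \<le> ennreal (\<bar>x\<bar> powr (- 1 / 2)) * indicator {- 1..1} x" by simp
    qed
  qed auto
  also note i4
  also note nn_integral_gauss_sq
  finally show ?thesis by (simp add: mult_left_mono add_left_mono)
qed

text \<open>Multiplying the standard density by exp (t x^2) gives s times the centred normal density
  of standard deviation s = 1 / sqrt (1 - 2 t).\<close>

lemma nn_integral_gauss_exp_sq:
  assumes "t < 1/2"
  shows "(\<integral>\<^sup>+x. ennreal (exp (t * x\<^sup>2)) \<partial>std_gauss) = ennreal (1 / sqrt (1 - 2 * t))"
proof -
  define s where "s = 1 / sqrt (1 - 2 * t)"
  have s: "s > 0" "1 / s\<^sup>2 = 1 - 2 * t" using assms by (auto simp: s_def power_divide)
  have eq: "std_normal_density x * exp (t * x\<^sup>2) = s * normal_density 0 s x" for x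
  proof -
    have "- x\<^sup>2 / 2 + t * x\<^sup>2 = - (x\<^sup>2 / 2 * (1 / s\<^sup>2))" unfolding s(2) by (simp add: field_simps)
    also have "\<dots> = - x\<^sup>2 / (2 * s\<^sup>2)" by simp
    finally have "exp (- x\<^sup>2 / 2) * exp (t * x\<^sup>2) = exp (- x\<^sup>2 / (2 * s\<^sup>2))" by (simp add: exp_add[symmetric])
    moreover have "s * (1 / sqrt (2 * pi * s\<^sup>2)) = 1 / sqrt (2 * pi)" using s(1) by (simp add: real_sqrt_mult)
    moreover have "s * normal_density 0 s x = s * (1 / sqrt (2 * pi * s\<^sup>2)) * exp (- x\<^sup>2 / (2 * s\<^sup>2))"
      by (simp add: normal_density_def)
    moreover have "std_normal_density x * exp (t * x\<^sup>2) = 1 / sqrt (2 * pi) * (exp (- x\<^sup>2 / 2) * exp (t * x\<^sup>2))"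
      by (simp add: std_normal_density_def)
    ultimately show ?thesis by simp
  qed
  have "(\<integral>\<^sup>+x. ennreal (exp (t * x\<^sup>2)) \<partial>std_gauss) = (\<integral>\<^sup>+x. ennreal (s * normal_density 0 s x) \<partial>lborel)"
    by (subst nn_integral_density) (auto simp: ennreal_mult'[symmetric] eq[symmetric] intro!: nn_integral_cong)
  also have "\<dots> = ennreal s * (\<integral>\<^sup>+x. ennreal (normal_density 0 s x) \<partial>lborel)"
    using s(1) by (subst nn_integral_cmult[symmetric]) (auto simp: ennreal_mult')
  also have "(\<integral>\<^sup>+x. ennreal (normal_density 0 s x) \<partial>lborel) = 1"
    using s(1) by (subst nn_integral_eq_integral) auto
  finally show ?thesis by (simp add: s_def)
qed

lemma nn_integral_gauss_exp_sqn:
  assumes "t < 1/2"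
  shows "(\<integral>\<^sup>+g. ennreal (exp (t * sqn N g)) \<partial>gauss N) = ennreal ((1 / sqrt (1 - 2 * t)) ^ N)"
proof -
  interpret product_sigma_finite "\<lambda>_::nat. std_gauss"
    by (rule product_sigma_finite.intro) (simp add: prob_space_imp_sigma_finite prob_space_std_gauss)
  have "(\<integral>\<^sup>+g. ennreal (exp (t * sqn N g)) \<partial>gauss N) =
      (\<integral>\<^sup>+g. (\<Prod>k<N. ennreal (exp (t * (g k)\<^sup>2))) \<partial>PiM {..<N} (\<lambda>_. std_gauss))"
    unfolding gauss_def sqn_def
    by (intro nn_integral_cong) (simp add: prod_ennreal sum_distrib_left exp_sum)
  also have "\<dots> = (\<Prod>k<N. \<integral>\<^sup>+x. ennreal (exp (t * x\<^sup>2)) \<partial>std_gauss)"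
    by (rule product_nn_integral_prod) auto
  also have "\<dots> = ennreal ((1 / sqrt (1 - 2 * t)) ^ N)"
    using assms by (simp add: nn_integral_gauss_exp_sq ennreal_power)
  finally show ?thesis .
qed

text \<open>One term of the exponential series at y / 4 gives y^k \<le> k! 4^k exp (y / 4), and the
  exponential moment at t = 1/4 is sqrt 2 per coordinate. The factorial is kept because
  \<open>gauss_image_power_ge\<close> produces the same one and the two will cancel.\<close>

lemma nn_integral_gauss_sqn_power:
  "(\<integral>\<^sup>+g. ennreal (sqn N g ^ k) \<partial>gauss N) \<le> ennreal (fact k * 4 ^ k * sqrt 2 ^ N)"
proof -
  have pt: "y ^ k \<le> fact k * 4 ^ k * exp (1/4 * y)" if "y \<ge> 0" for y :: real
  proof -
    have "(y/4) ^ k / fact k \<le> exp (y/4)"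
    proof -
      have "(\<lambda>n. (y/4)^n /\<^sub>R fact n) sums exp (y/4)" by (rule exp_converges)
      moreover have "0 \<le> (y/4)^n /\<^sub>R fact n" for n using that by simp
      ultimately have "(\<Sum>n\<in>{k}. (y/4)^n /\<^sub>R fact n) \<le> exp (y/4)"
        using sum_le_suminf[of "\<lambda>n. (y/4)^n /\<^sub>R fact n" "{k}"] by (simp add: sums_iff)
      then have "inverse (fact k) * (y/4)^k \<le> exp (y/4)" by simp
      then show ?thesis by (metis divide_inverse mult.commute)
    qed
    then have "(fact k * 4 ^ k) * ((y/4) ^ k / fact k) \<le> (fact k * 4 ^ k) * exp (y/4)"
      by (intro mult_left_mono) auto
    then show ?thesis by (simp add: power_divide)
  qed
  have "(\<integral>\<^sup>+g. ennreal (sqn N g ^ k) \<partial>gauss N) \<le>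
     (\<integral>\<^sup>+g. ennreal (fact k * 4 ^ k) * ennreal (exp (1/4 * sqn N g)) \<partial>gauss N)"
  proof (rule nn_integral_mono)
    fix g :: "nat \<Rightarrow> real"
    show "ennreal (sqn N g ^ k) \<le> ennreal (fact k * 4 ^ k) * ennreal (exp (1/4 * sqn N g))"
      using ennreal_leI[OF pt[OF sqn_nonneg[of N g]]] by (subst ennreal_mult'[symmetric]) simp_all
  qed
  also have "\<dots> = ennreal (fact k * 4 ^ k) * (\<integral>\<^sup>+g. ennreal (exp (1/4 * sqn N g)) \<partial>gauss N)"
  proof (rule nn_integral_cmult)
    show "(\<lambda>g. ennreal (exp (1/4 * sqn N g))) \<in> borel_measurable (gauss N)"
      unfolding sqn_def by measurable
  qed
  also have "\<dots> = ennreal (fact k * 4 ^ k) * ennreal ((1 / sqrt (1 - 2 * (1/4))) ^ N)"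
    by (subst nn_integral_gauss_exp_sqn) auto
  also have "\<dots> = ennreal (fact k * 4 ^ k) * ennreal (sqrt 2 ^ N)"
    by (simp add: real_sqrt_divide)
  also have "\<dots> = ennreal (fact k * 4 ^ k * sqrt 2 ^ N)"
    by (rule ennreal_mult'[symmetric]) simp
  finally show ?thesis by this
qed

text \<open>A sum of independent centred normal variables is normal with added variances. Zero
  coefficients are dropped first, since they would give a degenerate normal law.\<close>

lemma gauss_linear_form:
  assumes "sqn N a > 0"
  shows "distr (gauss N) borel (\<lambda>g. (\<Sum>k<N. a k * g k) / sqrt (sqn N a)) = std_gauss"
proof -
  interpret prob_space "gauss N" by (rule prob_space_gauss)
  define J where "J = {k. k < N \<and> a k \<noteq> 0}"
  have J: "finite J" "J \<subseteq> {..<N}" by (auto simp: J_def)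
  have sJ: "(\<Sum>k\<in>J. (a k)\<^sup>2) = sqn N a"
    unfolding sqn_def by (rule sum.mono_neutral_left) (auto simp: J_def)
  have Jne: "J \<noteq> {}" using assms sJ by auto
  have "indep_vars (\<lambda>_. std_gauss) (\<lambda>k g. g k) {..<N}"
  proof (cases "N = 0")
    case False
    have d: "distr (gauss N) std_gauss (\<lambda>g. g k) = std_gauss" if "k < N" for k
      unfolding gauss_def by (rule distr_PiM_component) (use that in \<open>auto simp: prob_space_std_gauss\<close>)
    have r: "(\<lambda>g. g k) \<in> measurable (gauss N) std_gauss" if "k < N" for k
      unfolding gauss_def by (rule measurable_component_singleton) (use that in auto)
    have "distr (gauss N) (PiM {..<N} (\<lambda>_. std_gauss)) (\<lambda>x. \<lambda>i\<in>{..<N}. x i) = PiM {..<N} (\<lambda>i. distr (gauss N) std_gauss (\<lambda>g. g i))"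
    proof -
      have "distr (gauss N) (PiM {..<N} (\<lambda>_. std_gauss)) (\<lambda>x. \<lambda>i\<in>{..<N}. x i) = distr (gauss N) (gauss N) (\<lambda>x. x)"
        by (rule distr_cong) (auto simp: gauss_def space_PiM PiE_def extensional_restrict)
      also have "\<dots> = gauss N" by simp
      also have "\<dots> = PiM {..<N} (\<lambda>i. distr (gauss N) std_gauss (\<lambda>g. g i))"
        by (subst gauss_def, rule PiM_cong[OF refl]) (simp only: d lessThan_iff)
      finally show ?thesis .
    qed
    moreover have "{..<N} \<noteq> {}" using False by auto
    ultimately show ?thesis by (subst indep_vars_iff_distr_eq_PiM') (simp_all only: r lessThan_iff not_False_eq_True)
  qed (use assms in \<open>simp add: sqn_def\<close>)
  then have "indep_vars (\<lambda>_. std_gauss) (\<lambda>k g. g k) J" by (rule indep_vars_subset) (use J in auto)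
  then have ind: "indep_vars (\<lambda>_. borel) (\<lambda>k g. a k * g k) J"
    by (rule indep_vars_compose2) auto
  have norm: "distributed (gauss N) lborel (\<lambda>g. a k * g k) (normal_density 0 \<bar>a k\<bar>)" if "k \<in> J" for k
  proof -
    have "distributed (gauss N) lborel (\<lambda>g. g k) (normal_density 0 1)"
      unfolding distributed_def
    proof (intro conjI)
      have "distr (gauss N) lborel (\<lambda>g. g k) = distr (gauss N) std_gauss (\<lambda>g. g k)" by (rule distr_cong) auto
      also have "\<dots> = std_gauss"
        unfolding gauss_def by (rule distr_PiM_component) (use that in \<open>auto simp: prob_space_std_gauss J_def\<close>)
      finally show "distr (gauss N) lborel (\<lambda>g. g k) = density lborel (\<lambda>x. ennreal (normal_density 0 1 x))" .
      show "(\<lambda>g. g k) \<in> measurable (gauss N) lborel" using that by (auto simp: J_def)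
    qed auto
    from normal_density_affine[OF this, of "a k" 0] that show ?thesis by (simp add: J_def)
  qed
  have "distributed (gauss N) lborel (\<lambda>g. \<Sum>k\<in>J. a k * g k) (normal_density (\<Sum>k\<in>J. 0) (sqrt (\<Sum>k\<in>J. \<bar>a k\<bar>\<^sup>2)))"
    by (rule sum_indep_normal[OF J(1) Jne ind _ norm]) (auto simp: J_def)
  then have "distributed (gauss N) lborel (\<lambda>g. \<Sum>k\<in>J. a k * g k) (normal_density 0 (sqrt (sqn N a)))"
    by (simp add: sJ)
  then have "distributed (gauss N) lborel (\<lambda>g. ((\<Sum>k\<in>J. a k * g k) - 0) / sqrt (sqn N a)) std_normal_density"
    using normal_standard_normal_convert[of "sqrt (sqn N a)"] assms by simp
  moreover have "(\<Sum>k\<in>J. a k * g k) = (\<Sum>k<N. a k * g k)" for g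
    by (rule sum.mono_neutral_left) (auto simp: J_def)
  ultimately have "distr (gauss N) lborel (\<lambda>g. (\<Sum>k<N. a k * g k) / sqrt (sqn N a)) = std_gauss"
    by (simp add: distributed_def)
  then show ?thesis by (simp add: distr_cong[OF refl sets_lborel[symmetric] refl])
qed

text \<open>The function (ln x)^2 is not convex for large x, so there are two regimes for the
  weighted mean Q. Above 1 use ln Q \<le> 2 sqrt Q. Below 1 concavity gives m \<le> ln Q \<le> 0 for
  the mean m of the logarithms, hence (ln Q)^2 \<le> m^2, which the mean of the squares
  dominates.\<close>

lemma ln_weighted_sum_sq_le:
  fixes p x :: "'i \<Rightarrow> real"
  assumes J: "finite J" and p: "\<And>j. j \<in> J \<Longrightarrow> 0 \<le> p j" "sum p J = 1" and x: "\<And>j. j \<in> J \<Longrightarrow> 0 < x j"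
  shows "0 < (\<Sum>j\<in>J. p j * x j)"
    and "(ln (\<Sum>j\<in>J. p j * x j))\<^sup>2 \<le> (\<Sum>j\<in>J. p j * (ln (x j))\<^sup>2) + 4 * (\<Sum>j\<in>J. p j * x j)"
proof -
  define Q where "Q = (\<Sum>j\<in>J. p j * x j)"
  obtain i where i: "i \<in> J" "p i \<noteq> 0" using p(2) by (metis sum.neutral zero_neq_one)
  then have "p i > 0" using p(1)[OF i(1)] by simp
  have Q0: "Q > 0" unfolding Q_def
  proof (rule sum_pos2[OF J i(1)])
    show "0 < p i * x i" using \<open>p i > 0\<close> x[OF i(1)] by simp
    show "0 \<le> p j * x j" if "j \<in> J" for j using p(1)[OF that] x[OF that] by simp
  qed
  then show "0 < (\<Sum>j\<in>J. p j * x j)" by (simp add: Q_def)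
  have nn: "0 \<le> (\<Sum>j\<in>J. p j * (ln (x j))\<^sup>2)"
    by (rule sum_nonneg) (simp add: p(1))
  show "(ln (\<Sum>j\<in>J. p j * x j))\<^sup>2 \<le> (\<Sum>j\<in>J. p j * (ln (x j))\<^sup>2) + 4 * (\<Sum>j\<in>J. p j * x j)"
  proof (cases "Q \<ge> 1")
    case True
    have "ln Q = 2 * ln (sqrt Q)" using Q0 by (simp add: ln_sqrt)
    also have "\<dots> \<le> 2 * sqrt Q" using ln_less_self[of "sqrt Q"] Q0 by (simp add: less_imp_le)
    finally have "(ln Q)\<^sup>2 \<le> (2 * sqrt Q)\<^sup>2" using True by (intro power_mono) auto
    also have "\<dots> = 4 * Q" using Q0 by (simp add: power_mult_distrib)
    finally show ?thesis using nn by (simp add: Q_def)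
  next
    case False
    define m where "m = (\<Sum>j\<in>J. p j * ln (x j))"
    have "m - ln Q = (\<Sum>j\<in>J. p j * (ln (x j) - ln Q))"
      by (simp add: m_def right_diff_distrib sum_subtractf sum_distrib_right[symmetric] p(2))
    \<comment> \<open>Jensen's inequality for ln, obtained from ln y \<le> y - 1 at y = x j /
      Q.\<close>
    also have "\<dots> \<le> (\<Sum>j\<in>J. p j * (x j / Q - 1))"
    proof (rule sum_mono)
      fix j assume j: "j \<in> J"
      have "ln (x j) - ln Q = ln (x j / Q)" using x[OF j] Q0 by (simp add: ln_div)
      also have "\<dots> \<le> x j / Q - 1" using x[OF j] Q0 by (intro ln_le_minus_one) simp
      finally show "p j * (ln (x j) - ln Q) \<le> p j * (x j / Q - 1)" using p(1)[OF j] by (intro mult_left_mono)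
    qed
    also have "\<dots> = Q / Q - 1"
      unfolding right_diff_distrib sum_subtractf times_divide_eq_right sum_divide_distrib[symmetric]
      by (simp add: p(2) Q_def[symmetric])
    also have "\<dots> = 0" using Q0 by simp
    finally have mQ: "m \<le> ln Q" by simp
    have lQ: "ln Q \<le> 0" using False Q0 by simp
    have "0 \<le> (\<Sum>j\<in>J. p j * (ln (x j) - m)\<^sup>2)" by (rule sum_nonneg) (simp add: p(1))
    also have "\<dots> = (\<Sum>j\<in>J. p j * (ln (x j))\<^sup>2 - 2 * m * (p j * ln (x j)) + m\<^sup>2 * p j)"
      by (rule sum.cong) (auto simp: power2_diff algebra_simps)
    also have "\<dots> = (\<Sum>j\<in>J. p j * (ln (x j))\<^sup>2) - m\<^sup>2"
      unfolding sum.distrib sum_subtractf sum_distrib_left[symmetric] p(2) m_def[symmetric]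
      by (simp add: power2_eq_square)
    finally have "m\<^sup>2 \<le> (\<Sum>j\<in>J. p j * (ln (x j))\<^sup>2)" by simp
    moreover have "(- ln Q)\<^sup>2 \<le> (- m)\<^sup>2" using mQ lQ by (intro power_mono) auto
    ultimately show ?thesis using Q0 by (simp add: Q_def)
  qed
qed

lemma AE_std_gauss_nonzero: "AE x in std_gauss. x \<noteq> 0"
  by (subst AE_density) (auto intro: AE_mp[OF AE_lborel_singleton[of 0]])

text \<open>328 = 324 + 4, from the mean of (ln (x^2))^2 and four times the mean of x^2. Only the
  law of each single h j enters, so the correlated coordinates of an image A g are covered.\<close>

lemma weighted_gauss_squares:
  fixes h :: "'i \<Rightarrow> 'a \<Rightarrow> real"
  assumes J: "finite J" and p: "\<And>j. j \<in> J \<Longrightarrow> 0 \<le> p j" "sum p J = 1"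
    and h: "\<And>j. j \<in> J \<Longrightarrow> h j \<in> borel_measurable M" "\<And>j. j \<in> J \<Longrightarrow> distr M borel (h j) = std_gauss"
  shows "AE \<omega> in M. 0 < (\<Sum>j\<in>J. p j * (h j \<omega>)\<^sup>2)"
    and "(\<integral>\<^sup>+\<omega>. ennreal ((ln (\<Sum>j\<in>J. p j * (h j \<omega>)\<^sup>2))\<^sup>2) \<partial>M) \<le> 328"
proof -
  have "AE \<omega> in M. h j \<omega> \<noteq> 0" if "j \<in> J" for j
    using AE_std_gauss_nonzero unfolding h(2)[OF that, symmetric]
    by (subst (asm) AE_distr_iff) (simp_all add: h(1) that)
  then have ae: "AE \<omega> in M. \<forall>j\<in>J. h j \<omega> \<noteq> 0" using J by (simp add: AE_finite_all)
  have pt: "0 < (\<Sum>j\<in>J. p j * (h j \<omega>)\<^sup>2) \<and> (ln (\<Sum>j\<in>J. p j * (h j \<omega>)\<^sup>2))\<^sup>2 \<le>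
     (\<Sum>j\<in>J. p j * (ln ((h j \<omega>)\<^sup>2))\<^sup>2) + 4 * (\<Sum>j\<in>J. p j * (h j \<omega>)\<^sup>2)" if "\<forall>j\<in>J. h j \<omega> \<noteq> 0" for \<omega>
    using that by (intro conjI ln_weighted_sum_sq_le J p) auto
  from ae show "AE \<omega> in M. 0 < (\<Sum>j\<in>J. p j * (h j \<omega>)\<^sup>2)" by eventually_elim (use pt in blast)
  have tr: "(\<integral>\<^sup>+\<omega>. F (h j \<omega>) \<partial>M) = (\<integral>\<^sup>+x. F x \<partial>std_gauss)"
    if "j \<in> J" "F \<in> borel_measurable borel" for j and F :: "real \<Rightarrow> ennreal"
    unfolding h(2)[OF that(1), symmetric] by (rule nn_integral_distr[symmetric]) (use that h in auto)
  have "(\<integral>\<^sup>+\<omega>. ennreal ((ln (\<Sum>j\<in>J. p j * (h j \<omega>)\<^sup>2))\<^sup>2) \<partial>M) \<le>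
    (\<integral>\<^sup>+\<omega>. (\<Sum>j\<in>J. ennreal (p j) * (ennreal ((ln ((h j \<omega>)\<^sup>2))\<^sup>2) + 4 * ennreal ((h j \<omega>)\<^sup>2))) \<partial>M)"
  proof (rule nn_integral_mono_AE, use ae in eventually_elim)
    fix \<omega> assume "\<forall>j\<in>J. h j \<omega> \<noteq> 0"
    from pt[OF this] have "(ln (\<Sum>j\<in>J. p j * (h j \<omega>)\<^sup>2))\<^sup>2 \<le> (\<Sum>j\<in>J. p j * ((ln ((h j \<omega>)\<^sup>2))\<^sup>2 + 4 * (h j \<omega>)\<^sup>2))"
      by (simp add: distrib_left sum.distrib sum_distrib_left mult_ac)
    then have "ennreal ((ln (\<Sum>j\<in>J. p j * (h j \<omega>)\<^sup>2))\<^sup>2) \<le> ennreal (\<Sum>j\<in>J. p j * ((ln ((h j \<omega>)\<^sup>2))\<^sup>2 + 4 * (h j \<omega>)\<^sup>2))"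
      by (rule ennreal_leI)
    also have "\<dots> = (\<Sum>j\<in>J. ennreal (p j * ((ln ((h j \<omega>)\<^sup>2))\<^sup>2 + 4 * (h j \<omega>)\<^sup>2)))"
      by (rule sum_ennreal[symmetric]) (simp add: p(1))
    also have "\<dots> = (\<Sum>j\<in>J. ennreal (p j) * (ennreal ((ln ((h j \<omega>)\<^sup>2))\<^sup>2) + 4 * ennreal ((h j \<omega>)\<^sup>2)))"
      by (rule sum.cong) (simp_all add: ennreal_mult p(1))
    finally show "ennreal ((ln (\<Sum>j\<in>J. p j * (h j \<omega>)\<^sup>2))\<^sup>2) \<le>
      (\<Sum>j\<in>J. ennreal (p j) * (ennreal ((ln ((h j \<omega>)\<^sup>2))\<^sup>2) + 4 * ennreal ((h j \<omega>)\<^sup>2)))" .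
  qed
  also have "\<dots> = (\<Sum>j\<in>J. \<integral>\<^sup>+\<omega>. ennreal (p j) * (ennreal ((ln ((h j \<omega>)\<^sup>2))\<^sup>2) + 4 * ennreal ((h j \<omega>)\<^sup>2)) \<partial>M)"
  proof (rule nn_integral_sum)
    fix j assume "j \<in> J"
    note [measurable] = h(1)[OF this]
    show "(\<lambda>\<omega>. ennreal (p j) * (ennreal ((ln ((h j \<omega>)\<^sup>2))\<^sup>2) + 4 * ennreal ((h j \<omega>)\<^sup>2))) \<in> borel_measurable M"
      by measurable
  qed
  also have "\<dots> \<le> (\<Sum>j\<in>J. ennreal (p j) * 328)"
  proof (rule sum_mono)
    fix j assume j: "j \<in> J"
    have "(\<integral>\<^sup>+\<omega>. ennreal (p j) * (ennreal ((ln ((h j \<omega>)\<^sup>2))\<^sup>2) + 4 * ennreal ((h j \<omega>)\<^sup>2)) \<partial>M) =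
      (\<integral>\<^sup>+x. ennreal (p j) * (ennreal ((ln (x\<^sup>2))\<^sup>2) + 4 * ennreal (x\<^sup>2)) \<partial>std_gauss)"
      by (rule tr[OF j]) measurable
    also have "\<dots> = ennreal (p j) * ((\<integral>\<^sup>+x. ennreal ((ln (x\<^sup>2))\<^sup>2) \<partial>std_gauss) + 4 * (\<integral>\<^sup>+x. ennreal (x\<^sup>2) \<partial>std_gauss))"
      by (subst nn_integral_cmult, simp, subst nn_integral_add, simp, simp, subst nn_integral_cmult) auto
    also have "\<dots> \<le> ennreal (p j) * (324 + 4 * 1)"
      by (intro mult_left_mono add_mono nn_integral_gauss_ln_sq) (auto simp: nn_integral_gauss_sq)
    finally show "(\<integral>\<^sup>+\<omega>. ennreal (p j) * (ennreal ((ln ((h j \<omega>)\<^sup>2))\<^sup>2) + 4 * ennreal ((h j \<omega>)\<^sup>2)) \<partial>M) \<le> ennreal (p j) * 328"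
      by simp
  qed
  also have "\<dots> = (\<Sum>j\<in>J. ennreal (p j)) * 328" by (simp only: sum_distrib_right)
  also have "(\<Sum>j\<in>J. ennreal (p j)) = ennreal (sum p J)" by (rule sum_ennreal) (rule p(1))
  finally show "(\<integral>\<^sup>+\<omega>. ennreal ((ln (\<Sum>j\<in>J. p j * (h j \<omega>)\<^sup>2))\<^sup>2) \<partial>M) \<le> 328" by (simp add: p(2))
qed

lemma gauss_linear_form_measurable:
  "(\<lambda>g. (\<Sum>k<N. a k * g k) / c) \<in> borel_measurable (gauss N)"
proof -
  have "(\<lambda>g. g k) \<in> borel_measurable (gauss N)" if "k < N" for k
    using that by (subst measurable_cong_sets[OF sets_gauss refl]) (rule measurable_component_singleton, simp)
  then show ?thesis
    by (intro borel_measurable_divide borel_measurable_sum borel_measurable_times borel_measurable_const) (simp only: lessThan_iff)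
qed

text \<open>A row of A divided by its length pairs with g to a standard normal variable. So |A g|^2
  / frob is a convex combination of Gaussian squares, weighted by relative row sizes, and the bound
  does not depend on A. Zero rows cannot be normalised and are left out of J.\<close>

lemma gauss_image_ln_sq:
  assumes A: "frob N A > 0"
  shows "AE g in gauss N. 0 < sqn N (mulv N A g)"
    and "(\<integral>\<^sup>+g. ennreal ((ln (sqn N (mulv N A g) / frob N A))\<^sup>2) \<partial>gauss N) \<le> 328"
proof -
  define r where "r j = sqn N (\<lambda>k. A $$ (j,k))" for j
  define J where "J = {j. j < N \<and> r j > 0}"
  define p where "p j = r j / frob N A" for j
  define h where "h j = (\<lambda>g. (\<Sum>k<N. A $$ (j,k) * g k) / sqrt (r j))" for j
  have fr: "frob N A = (\<Sum>j<N. r j)" by (simp add: frob_def r_def sqn_def)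
  have r0: "r j \<ge> 0" for j by (simp add: r_def)
  have J: "finite J" by (simp add: J_def)
  have "(\<Sum>j\<in>J. r j) = frob N A" unfolding fr
    by (rule sum.mono_neutral_left) (use r0 in \<open>auto simp: J_def less_le\<close>)
  then have p1: "sum p J = 1" using A by (simp add: p_def sum_divide_distrib[symmetric])
  have eq: "sqn N (mulv N A g) / frob N A = (\<Sum>j\<in>J. p j * (h j g)\<^sup>2)" for g
  proof -
    have z: "mulv N A g j = 0" if "j < N" "j \<notin> J" for j
    proof -
      have "r j = 0" using that r0[of j] by (simp add: J_def)
      then have "A $$ (j,k) = 0" if "k < N" for k
        using that unfolding r_def sqn_def by (simp add: sum_nonneg_eq_0_iff)
      then show ?thesis by (simp add: mulv_def)
    qed
    have "sqn N (mulv N A g) = (\<Sum>j\<in>J. (mulv N A g j)\<^sup>2)"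
      unfolding sqn_def by (rule sum.mono_neutral_right) (use z in \<open>auto simp: J_def\<close>)
    also have "\<dots> = (\<Sum>j\<in>J. r j * (h j g)\<^sup>2)"
      by (rule sum.cong) (auto simp: h_def mulv_def power_divide J_def)
    finally show ?thesis by (simp add: p_def sum_divide_distrib)
  qed
  have d: "distr (gauss N) borel (h j) = std_gauss" if "j \<in> J" for j
    unfolding h_def r_def by (rule gauss_linear_form) (use that in \<open>simp add: J_def r_def\<close>)
  have p0: "0 \<le> p j" for j using r0[of j] A by (simp add: p_def)
  have hm: "h j \<in> borel_measurable (gauss N)" for j unfolding h_def by (rule gauss_linear_form_measurable)
  have "AE g in gauss N. 0 < (\<Sum>j\<in>J. p j * (h j g)\<^sup>2)"
    by (rule weighted_gauss_squares[OF J p0 p1 hm d])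
  then show "AE g in gauss N. 0 < sqn N (mulv N A g)"
    unfolding eq[symmetric] using A by (simp add: zero_less_divide_iff)
  show "(\<integral>\<^sup>+g. ennreal ((ln (sqn N (mulv N A g) / frob N A))\<^sup>2) \<partial>gauss N) \<le> 328"
    unfolding eq by (rule weighted_gauss_squares[OF J p0 p1 hm d])
qed

section \<open>Comparing Gaussian moments with the operator norm\<close>

lemma sum_mult_sq_le: "(\<Sum>k<N. a k * b k)\<^sup>2 \<le> sqn N a * sqn N b" for N :: nat and a b :: "nat \<Rightarrow> real"
  unfolding sqn_def by (rule Cauchy_Schwarz_ineq_sum)

text \<open>The right-hand side is the double factorial (2k - 1)!!, the 2k-th moment of a standard
  normal variable.\<close>

lemma fact_le_double_fact: "fact k \<le> (fact (2 * k) / (2 ^ k * fact k) :: real)"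
proof -
  have "fact k * (2 ^ k * fact k) \<le> (fact (2 * k) :: real)"
  proof (induction k)
    case (Suc k)
    have "fact (Suc k) * (2 ^ Suc k * fact (Suc k)) = ((2 * real k + 2) * (real k + 1)) * (fact k * (2 ^ k * fact k))"
      by (simp add: algebra_simps)
    also have "\<dots> \<le> ((2 * real k + 2) * (2 * real k + 1)) * fact (2 * k)"
      using Suc by (intro mult_mono) auto
    also have "\<dots> = fact (2 * Suc k)" by (simp add: algebra_simps)
    finally show ?case .
  qed simp
  then show ?thesis by (simp add: pos_le_divide_eq)
qed

text \<open>Pairing \<open>B g\<close> with the unit vector along \<open>B u\<close> reduces to a one-dimensional Gaussian.\<close>

lemma gauss_image_power_ge:
  assumes u: "sqn N u = 1"
  shows "ennreal (fact k * sqn N (mulv N B u) ^ k) \<le> (\<integral>\<^sup>+g. ennreal (sqn N (mulv N B g) ^ k) \<partial>gauss N)"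
proof (cases "sqn N (mulv N B u) = 0")
  case True
  interpret prob_space "gauss N" by (rule prob_space_gauss)
  show ?thesis using True by (cases k) (simp_all add: emeasure_space_1)
next
  case False
  define s where "s = sqn N (mulv N B u)"
  have s: "s > 0" using False sqn_nonneg[of N "mulv N B u"] unfolding s_def by linarith
  define b where "b j = mulv N B u j / sqrt s" for j
  define a where "a l = (\<Sum>j<N. b j * B $$ (j,l))" for l
  have b1: "sqn N b = 1" using s sqn_scale[of N "1 / sqrt s" "mulv N B u"]
    by (simp add: b_def[abs_def] s_def power_divide)
  have dual: "(\<Sum>j<N. b j * mulv N B g j) = (\<Sum>l<N. a l * g l)" for g
  proof -
    have "(\<Sum>j<N. b j * mulv N B g j) = (\<Sum>j<N. \<Sum>l<N. b j * B $$ (j,l) * g l)"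
      by (simp add: mulv_def sum_distrib_left mult.assoc)
    also have "\<dots> = (\<Sum>l<N. \<Sum>j<N. b j * B $$ (j,l) * g l)" by (rule sum.swap)
    finally show ?thesis by (simp add: a_def sum_distrib_right)
  qed
  \<comment> \<open>Here \<open>a\<close> is B^T b. Testing it against u gives <a, u> = <b, B u> =
    sqrt s with |u| = 1, so the linear form has variance at least s.\<close>
  have "(\<Sum>l<N. a l * u l) = (\<Sum>j<N. (mulv N B u j)\<^sup>2) / sqrt s"
    unfolding dual[symmetric] by (simp add: b_def sum_divide_distrib power2_eq_square)
  also have "\<dots> = sqrt s" using s by (simp add: s_def sqn_def[symmetric] real_div_sqrt)
  finally have "s = (\<Sum>l<N. a l * u l)\<^sup>2" using s by simp
  also have "\<dots> \<le> sqn N a" using sum_mult_sq_le[of a u N] u by simp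
  finally have sa: "s \<le> sqn N a" .
  have pt: "(sqn N a * ((\<Sum>l<N. a l * g l) / sqrt (sqn N a))\<^sup>2) ^ k \<le> sqn N (mulv N B g) ^ k" for g
  proof (rule power_mono)
    have "sqn N a * ((\<Sum>l<N. a l * g l) / sqrt (sqn N a))\<^sup>2 = (\<Sum>j<N. b j * mulv N B g j)\<^sup>2"
      using s sa by (simp add: power_divide dual)
    also have "\<dots> \<le> sqn N (mulv N B g)" using sum_mult_sq_le[of b "mulv N B g" N] b1 by simp
    finally show "sqn N a * ((\<Sum>l<N. a l * g l) / sqrt (sqn N a))\<^sup>2 \<le> sqn N (mulv N B g)" .
  qed simp
  have "fact k * s ^ k \<le> (fact (2 * k) / (2 ^ k * fact k)) * sqn N a ^ k"
    using sa s by (intro mult_mono fact_le_double_fact power_mono) auto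
  then have "ennreal (fact k * s ^ k) \<le> ennreal (sqn N a ^ k * (fact (2 * k) / (2 ^ k * fact k)))"
    by (intro ennreal_leI) (simp add: mult.commute)
  also have "\<dots> = ennreal (sqn N a ^ k) * (\<integral>\<^sup>+x. ennreal (std_normal_density x * x ^ (2 * k)) \<partial>lborel)"
    using std_normal_moment_even[of k]
    by (subst nn_integral_eq_integral) (auto simp: has_bochner_integral_iff ennreal_mult'[symmetric])
  also have "(\<integral>\<^sup>+x. ennreal (std_normal_density x * x ^ (2 * k)) \<partial>lborel) = (\<integral>\<^sup>+x. ennreal (x ^ (2 * k)) \<partial>std_gauss)"
    by (subst nn_integral_density) (auto simp: ennreal_mult'[symmetric] intro!: nn_integral_cong)
  also have "\<dots> = (\<integral>\<^sup>+g. ennreal (((\<Sum>l<N. a l * g l) / sqrt (sqn N a)) ^ (2 * k)) \<partial>gauss N)"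
    using s sa by (subst gauss_linear_form[of N a, symmetric])
      (auto intro!: nn_integral_distr gauss_linear_form_measurable)
  also have "ennreal (sqn N a ^ k) * \<dots> = (\<integral>\<^sup>+g. ennreal (sqn N a ^ k) * ennreal (((\<Sum>l<N. a l * g l) / sqrt (sqn N a)) ^ (2 * k)) \<partial>gauss N)"
    by (rule nn_integral_cmult[symmetric])
      (intro measurable_compose[OF _ measurable_ennreal] borel_measurable_power gauss_linear_form_measurable)
  also have "\<dots> \<le> (\<integral>\<^sup>+g. ennreal (sqn N (mulv N B g) ^ k) \<partial>gauss N)"
  proof (rule nn_integral_mono)
    fix g
    show "ennreal (sqn N a ^ k) * ennreal (((\<Sum>l<N. a l * g l) / sqrt (sqn N a)) ^ (2 * k)) \<le> ennreal (sqn N (mulv N B g) ^ k)"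
      using ennreal_leI[OF pt[of g]] by (subst ennreal_mult[symmetric]) (simp_all add: power_mult_distrib power_mult)
  qed
  finally show ?thesis by (simp add: s_def)
qed

section \<open>Moments over random signs\<close>

text \<open>A sign vector is coded by the set of its positive coordinates, so the average over
  uniform random signs is the sum over \<open>Pow {..<N}\<close> divided by 2^N.\<close>

definition sgnv :: "nat set \<Rightarrow> nat \<Rightarrow> real" where
  "sgnv T i = (if i \<in> T then 1 else -1)"

definition flip :: "nat \<Rightarrow> nat set \<Rightarrow> nat set" where
  "flip i T = (if i \<in> T then T - {i} else insert i T)"

lemma flip_flip [simp]: "flip i (flip i T) = T"
  by (auto simp: flip_def)

lemma mem_flip: "j \<in> flip i T \<longleftrightarrow> (if j = i then j \<notin> T else j \<in> T)"
  unfolding flip_def by (cases "i \<in> T") auto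

lemma sgnv_flip: "sgnv (flip i T) j = (if j = i then - sgnv T j else sgnv T j)"
  by (simp add: sgnv_def mem_flip)

lemma sgnv_sq [simp]: "sgnv T i * sgnv T i = 1" "(sgnv T i)\<^sup>2 = 1"
  by (auto simp: sgnv_def)

lemma sqn_sgnv [simp]: "sqn N (sgnv T) = real N"
  by (simp add: sqn_def)

lemma sum_flip:
  assumes "i < N"
  shows "(\<Sum>T\<in>Pow {..<N}. f (flip i T)) = (\<Sum>T\<in>Pow {..<N}. f T)"
proof (rule sum.reindex_bij_witness[of _ "flip i" "flip i"])
  show "flip i T \<in> Pow {..<N}" if "T \<in> Pow {..<N}" for T
    using that assms by (cases "i \<in> T") (auto simp: flip_def)
  then show "flip i T \<in> Pow {..<N}" if "T \<in> Pow {..<N}" for T using that by blast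
qed simp_all

text \<open>Factor x^(k+1) - y^(k+1) as (x - y) S. The terms i and k - i of S together are at most
  x^k + y^k, because powers of x and y are ordered alike. The squared difference that remains is
  explicit for a sign flip.\<close>

lemma power_diff_mult_le:
  fixes x y :: real
  assumes "x \<ge> 0" "y \<ge> 0"
  shows "(x - y) * (x ^ Suc k - y ^ Suc k) \<le> (real (Suc k) / 2) * (x - y)\<^sup>2 * (x ^ k + y ^ k)"
proof -
  define S where "S = (\<Sum>i<Suc k. x ^ i * y ^ (k - i))"
  have S2: "S = (\<Sum>i<Suc k. x ^ (k - i) * y ^ i)"
    unfolding S_def by (rule sum.reindex_bij_witness[of _ "\<lambda>i. k - i" "\<lambda>i. k - i"]) auto
  have "2 * S = (\<Sum>i<Suc k. x ^ i * y ^ (k - i) + x ^ (k - i) * y ^ i)"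
    using S2 by (simp add: S_def sum.distrib)
  also have "\<dots> \<le> (\<Sum>i<Suc k. x ^ k + y ^ k)"
  proof (rule sum_mono)
    fix i assume i: "i \<in> {..<Suc k}"
    have "0 \<le> (x ^ i - y ^ i) * (x ^ (k - i) - y ^ (k - i))"
    proof (cases "x \<le> y")
      case True
      then show ?thesis using assms by (intro mult_nonpos_nonpos) (auto intro: power_mono)
    next
      case False
      then show ?thesis using assms by (intro mult_nonneg_nonneg) (auto intro: power_mono)
    qed
    also have "\<dots> = x ^ (i + (k - i)) + y ^ (i + (k - i)) - (x ^ i * y ^ (k - i) + x ^ (k - i) * y ^ i)"
      by (simp add: algebra_simps power_add del: add_diff_inverse_nat le_add_diff_inverse le_add_diff_inverse2)
    also have "i + (k - i) = k" using i by simp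
    finally show "x ^ i * y ^ (k - i) + x ^ (k - i) * y ^ i \<le> x ^ k + y ^ k" by simp
  qed
  also have "\<dots> = real (Suc k) * (x ^ k + y ^ k)" by simp
  finally have "S \<le> real (Suc k) / 2 * (x ^ k + y ^ k)" by simp
  then have "(x - y)\<^sup>2 * S \<le> (x - y)\<^sup>2 * (real (Suc k) / 2 * (x ^ k + y ^ k))"
    by (intro mult_left_mono) auto
  moreover have "x ^ Suc k - y ^ Suc k = (x - y) * S"
    using power_diff_sumr2[of x "Suc k" y] by (simp add: S_def mult.commute)
  ultimately show ?thesis by (simp add: power2_eq_square mult_ac)
qed

text \<open>\<open>L\<close> bounds the largest squared singular value. It will be b * frob / N, so
  that a term k L is of relative order k / N compared with the mean frob.\<close>

locale bounded_matrix =
  fixes N :: nat and X :: "real Matrix.mat" and L :: real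
  assumes bound: "\<And>w. sqn N (mulv N X w) \<le> L * sqn N w" and L0: "L \<ge> 0"
begin

definition gram :: "nat \<Rightarrow> nat \<Rightarrow> real" where
  "gram i j = (\<Sum>l<N. X $$ (l,i) * X $$ (l,j))"

definition Q :: "nat set \<Rightarrow> real" where
  "Q T = sqn N (mulv N X (sgnv T))"

text \<open>Leaving out the diagonal term makes this free of the sign at i, hence invariant under
  the flip at i.\<close>

definition off :: "nat \<Rightarrow> nat set \<Rightarrow> real" where
  "off i T = (\<Sum>j\<in>{..<N}-{i}. gram i j * sgnv T j)"

lemma Q_nonneg: "Q T \<ge> 0" by (simp add: Q_def)

lemma gram_sym: "gram i j = gram j i" by (simp add: gram_def mult.commute)

lemma gram_apply: "(\<Sum>j<N. gram i j * w j) = (\<Sum>l<N. X $$ (l,i) * mulv N X w l)"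
proof -
  have "(\<Sum>j<N. gram i j * w j) = (\<Sum>j<N. \<Sum>l<N. X $$ (l,i) * X $$ (l,j) * w j)"
    by (simp add: gram_def sum_distrib_right)
  also have "\<dots> = (\<Sum>l<N. \<Sum>j<N. X $$ (l,i) * X $$ (l,j) * w j)" by (rule sum.swap)
  finally show ?thesis by (simp add: mulv_def sum_distrib_left mult.assoc)
qed

lemma gram_form: "(\<Sum>i<N. v i * (\<Sum>j<N. gram i j * w j)) = (\<Sum>l<N. mulv N X v l * mulv N X w l)"
proof -
  have "(\<Sum>i<N. v i * (\<Sum>j<N. gram i j * w j)) = (\<Sum>i<N. \<Sum>l<N. X $$ (l,i) * v i * mulv N X w l)"
    unfolding gram_apply by (simp add: sum_distrib_left mult_ac)
  also have "\<dots> = (\<Sum>l<N. \<Sum>i<N. X $$ (l,i) * v i * mulv N X w l)" by (rule sum.swap)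
  finally show ?thesis by (simp add: mulv_def sum_distrib_right)
qed

lemma Q_eq: "Q T = (\<Sum>i<N. sgnv T i * (\<Sum>j<N. gram i j * sgnv T j))"
  unfolding gram_form Q_def sqn_def by (simp add: power2_eq_square)

text \<open>For the Gram matrix G, |G w|^2 = <X G w, X w>. Cauchy-Schwarz and \<open>bound\<close>
  at the vector G w then give the estimate directly, without passing to the transpose of X.\<close>

lemma gram_sqn: "sqn N (\<lambda>i. \<Sum>j<N. gram i j * w j) \<le> L * sqn N (mulv N X w)"
proof -
  define z where "z i = (\<Sum>j<N. gram i j * w j)" for i
  have "sqn N z = (\<Sum>l<N. mulv N X z l * mulv N X w l)"
    unfolding gram_form[symmetric] by (simp add: sqn_def z_def power2_eq_square)
  then have "(sqn N z)\<^sup>2 \<le> sqn N (mulv N X z) * sqn N (mulv N X w)"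
    unfolding sqn_def[of N "mulv N X z"] sqn_def[of N "mulv N X w"] by (simp add: Cauchy_Schwarz_ineq_sum)
  also have "\<dots> \<le> (L * sqn N z) * sqn N (mulv N X w)" by (intro mult_right_mono bound) simp
  finally have *: "sqn N z * sqn N z \<le> (L * sqn N (mulv N X w)) * sqn N z" by (simp add: power2_eq_square mult_ac)
  have "sqn N z \<le> L * sqn N (mulv N X w)"
  proof (cases "sqn N z = 0")
    case True
    then show ?thesis using L0 by simp
  next
    case False
    then have "sqn N z > 0" using sqn_nonneg[of N z] by linarith
    then show ?thesis using * by (simp add: mult_le_cancel_right)
  qed
  then show ?thesis by (simp add: z_def[abs_def])
qed

lemma gram_diag: "i < N \<Longrightarrow> gram i i \<le> L" "0 \<le> gram i i" "(\<Sum>i<N. gram i i) = frob N X"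
proof -
  show "0 \<le> gram i i" by (simp add: gram_def sum_nonneg)
  show "(\<Sum>i<N. gram i i) = frob N X"
    unfolding gram_def frob_def by (subst sum.swap) (simp add: power2_eq_square)
  assume i: "i < N"
  define w where "w k = (if k = i then 1 else 0 :: real)" for k
  have "mulv N X w l = X $$ (l,i)" for l
    unfolding mulv_def w_def using i by (simp add: if_distrib[of "\<lambda>x. _ * x"] cong: if_cong)
  then have "gram i i = sqn N (mulv N X w)" by (simp add: gram_def sqn_def power2_eq_square)
  also have "\<dots> \<le> L * sqn N w" by (rule bound)
  also have "sqn N w = (\<Sum>k<N. if k = i then 1 else 0)" unfolding sqn_def w_def by (rule sum.cong) auto
  also have "\<dots> = 1" using i by simp
  finally show "gram i i \<le> L" by simp
qed

lemma row_split: "i < N \<Longrightarrow> (\<Sum>j<N. gram i j * sgnv T j) = gram i i * sgnv T i + off i T"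
  unfolding off_def by (subst sum.remove[of _ i]) auto

lemma off_flip: "off i (flip i T) = off i T"
  unfolding off_def by (rule sum.cong) (auto simp: sgnv_flip)

text \<open>In the quadratic form only the cross terms of coordinate i change sign, and they occur
  twice, in row i and in column i; \<open>R\<close> collects the terms that avoid i.\<close>

lemma Q_flip:
  assumes i: "i < N"
  shows "Q T - Q (flip i T) = 4 * (sgnv T i * off i T)"
proof -
  define R where "R T = (\<Sum>k\<in>{..<N}-{i}. sgnv T k * (\<Sum>j\<in>{..<N}-{i}. gram k j * sgnv T j))" for T
  have Rf: "R (flip i T) = R T"
    unfolding R_def by (rule sum.cong) (auto intro!: sum.cong simp: sgnv_flip)
  have QR: "Q T = gram i i + 2 * (sgnv T i * off i T) + R T" for T
  proof -
    have "Q T = sgnv T i * (gram i i * sgnv T i + off i T) +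
       (\<Sum>k\<in>{..<N}-{i}. sgnv T k * (\<Sum>j<N. gram k j * sgnv T j))"
      unfolding Q_eq using i by (subst sum.remove[of _ i]) (auto simp: row_split)
    also have "(\<Sum>k\<in>{..<N}-{i}. sgnv T k * (\<Sum>j<N. gram k j * sgnv T j)) =
       (\<Sum>k\<in>{..<N}-{i}. sgnv T k * (gram k i * sgnv T i + (\<Sum>j\<in>{..<N}-{i}. gram k j * sgnv T j)))"
      using i by (intro sum.cong) (auto simp: sum.remove[of _ i])
    also have "\<dots> = sgnv T i * off i T + R T"
      unfolding R_def off_def distrib_left sum.distrib sum_distrib_left
      by (intro arg_cong2[where f="(+)"] sum.cong) (simp_all add: gram_sym mult_ac)
    finally show ?thesis by (simp add: algebra_simps)
  qed
  show ?thesis using QR[of T] QR[of "flip i T"] Rf off_flip[of i T] sgnv_flip[of i T i] by simp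
qed

lemma sum_off_zero:
  assumes i: "i < N"
  shows "(\<Sum>T\<in>Pow {..<N}. sgnv T i * off i T) = 0"
proof -
  have "(\<Sum>T\<in>Pow {..<N}. sgnv T i * off i T) = (\<Sum>T\<in>Pow {..<N}. sgnv (flip i T) i * off i (flip i T))"
    by (rule sum_flip[OF i, symmetric])
  also have "\<dots> = - (\<Sum>T\<in>Pow {..<N}. sgnv T i * off i T)"
    by (simp add: sgnv_flip off_flip sum_negf)
  finally show ?thesis by simp
qed

text \<open>
  A sign flip turns the left-hand side into differences of \<open>Q T ^ Suc k\<close>, which are estimated by
  convexity of the power.
\<close>

lemma sum_off_le:
  assumes i: "i < N"
  shows "(\<Sum>T\<in>Pow {..<N}. sgnv T i * off i T * Q T ^ Suc k) \<le>
    2 * real (Suc k) * (\<Sum>T\<in>Pow {..<N}. (off i T)\<^sup>2 * Q T ^ k)"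
proof -
  let ?P = "Pow {..<N}"
  let ?d = "\<lambda>T. sgnv T i * off i T"
  have "(\<Sum>T\<in>?P. ?d T * Q T ^ Suc k) = (\<Sum>T\<in>?P. ?d (flip i T) * Q (flip i T) ^ Suc k)"
    by (rule sum_flip[OF i, symmetric])
  also have "\<dots> = - (\<Sum>T\<in>?P. ?d T * Q (flip i T) ^ Suc k)"
    by (simp add: sgnv_flip off_flip sum_negf del: power_Suc)
  finally have "2 * (\<Sum>T\<in>?P. ?d T * Q T ^ Suc k) =
      (\<Sum>T\<in>?P. ?d T * Q T ^ Suc k) - (\<Sum>T\<in>?P. ?d T * Q (flip i T) ^ Suc k)" by simp
  also have "\<dots> = (\<Sum>T\<in>?P. ?d T * (Q T ^ Suc k - Q (flip i T) ^ Suc k))"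
    by (simp add: right_diff_distrib sum_subtractf del: power_Suc)
  also have "\<dots> \<le> (\<Sum>T\<in>?P. 2 * real (Suc k) * ((off i T)\<^sup>2 * Q T ^ k + (off i (flip i T))\<^sup>2 * Q (flip i T) ^ k))"
  proof (rule sum_mono)
    fix T
    have d2: "(?d T)\<^sup>2 = (off i T)\<^sup>2" by (simp add: power_mult_distrib)
    have "(Q T - Q (flip i T)) * (Q T ^ Suc k - Q (flip i T) ^ Suc k) \<le>
       (real (Suc k) / 2) * (Q T - Q (flip i T))\<^sup>2 * (Q T ^ k + Q (flip i T) ^ k)"
      by (intro power_diff_mult_le Q_nonneg)
    then have "4 * (?d T * (Q T ^ Suc k - Q (flip i T) ^ Suc k)) \<le>
       (real (Suc k) / 2) * (16 * (off i T)\<^sup>2) * (Q T ^ k + Q (flip i T) ^ k)"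
      unfolding Q_flip[OF i] by (simp only: power_mult_distrib d2) (simp only: mult.assoc, simp)
    then show "?d T * (Q T ^ Suc k - Q (flip i T) ^ Suc k) \<le>
      2 * real (Suc k) * ((off i T)\<^sup>2 * Q T ^ k + (off i (flip i T))\<^sup>2 * Q (flip i T) ^ k)"
      unfolding off_flip by (simp add: algebra_simps)
  qed
  also have "\<dots> = 2 * real (Suc k) * ((\<Sum>T\<in>?P. (off i T)\<^sup>2 * Q T ^ k) + (\<Sum>T\<in>?P. (off i (flip i T))\<^sup>2 * Q (flip i T) ^ k))"
    by (simp only: sum_distrib_left sum.distrib[symmetric])
  also have "(\<Sum>T\<in>?P. (off i (flip i T))\<^sup>2 * Q (flip i T) ^ k) = (\<Sum>T\<in>?P. (off i T)\<^sup>2 * Q T ^ k)"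
    by (rule sum_flip[OF i])
  finally show ?thesis by simp
qed

text \<open>The diagonal terms carry squared signs and add up to the trace. The remaining sum
  averages to 0, so frob is the mean of Q over the signs.\<close>

lemma Q_diag: "Q T = frob N X + (\<Sum>i<N. sgnv T i * off i T)"
proof -
  have "Q T = (\<Sum>i<N. gram i i + sgnv T i * off i T)"
    unfolding Q_eq
  proof (rule sum.cong[OF refl])
    fix i assume "i \<in> {..<N}"
    then have "(\<Sum>j<N. gram i j * sgnv T j) = gram i i * sgnv T i + off i T" by (intro row_split) simp
    then have "sgnv T i * (\<Sum>j<N. gram i j * sgnv T j) = gram i i * (sgnv T i * sgnv T i) + sgnv T i * off i T"
      by (simp only: distrib_left mult_ac)
    then show "sgnv T i * (\<Sum>j<N. gram i j * sgnv T j) = gram i i + sgnv T i * off i T" by simp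
  qed
  then show ?thesis by (simp add: sum.distrib gram_diag(3))
qed

lemma sum_Q: "(\<Sum>T\<in>Pow {..<N}. Q T) = 2 ^ N * frob N X"
proof -
  have "(\<Sum>T\<in>Pow {..<N}. Q T) = (\<Sum>T\<in>Pow {..<N}. frob N X) + (\<Sum>T\<in>Pow {..<N}. \<Sum>i<N. sgnv T i * off i T)"
    unfolding Q_diag by (rule sum.distrib)
  also have "(\<Sum>T\<in>Pow {..<N}. \<Sum>i<N. sgnv T i * off i T) = (\<Sum>i<N. \<Sum>T\<in>Pow {..<N}. sgnv T i * off i T)"
    by (rule sum.swap)
  also have "\<dots> = 0" by (rule sum.neutral) (use sum_off_zero in blast)
  finally show ?thesis by (simp add: card_Pow)
qed

text \<open>\<open>off\<close> is a full coordinate of the Gram image minus a diagonal term. The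
  squares of the former are summed by \<open>gram_sqn\<close>, those of the latter by gram i i \<le>
  L and the trace.\<close>

lemma sum_off_sq: "(\<Sum>i<N. (off i T)\<^sup>2) \<le> 2 * L * Q T + 2 * L * frob N X"
proof -
  have "(\<Sum>i<N. (off i T)\<^sup>2) \<le> (\<Sum>i<N. 2 * (\<Sum>j<N. gram i j * sgnv T j)\<^sup>2 + 2 * (L * gram i i))"
  proof (rule sum_mono)
    fix i assume "i \<in> {..<N}"
    then have i: "i < N" by simp
    let ?z = "\<Sum>j<N. gram i j * sgnv T j"
    have "off i T = ?z - gram i i * sgnv T i" using row_split[OF i] by simp
    then have "(off i T)\<^sup>2 = (?z - gram i i * sgnv T i)\<^sup>2" by simp
    also have "\<dots> \<le> 2 * ?z\<^sup>2 + 2 * (gram i i * sgnv T i)\<^sup>2"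
      using zero_le_power2[of "?z + gram i i * sgnv T i"] by (simp add: power2_sum power2_diff)
    also have "(gram i i * sgnv T i)\<^sup>2 = gram i i * gram i i" by (simp add: power_mult_distrib power2_eq_square)
    also have "gram i i * gram i i \<le> L * gram i i" using gram_diag(1)[OF i] gram_diag(2)[of i] by (intro mult_right_mono)
    finally show "(off i T)\<^sup>2 \<le> 2 * ?z\<^sup>2 + 2 * (L * gram i i)" by simp
  qed
  also have "\<dots> = 2 * sqn N (\<lambda>i. \<Sum>j<N. gram i j * sgnv T j) + 2 * (L * frob N X)"
    by (simp add: sum.distrib sum_distrib_left[symmetric] sqn_def gram_diag(3))
  also have "\<dots> \<le> 2 * (L * Q T) + 2 * (L * frob N X)"
    unfolding Q_def by (intro add_right_mono mult_left_mono gram_sqn) simp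
  finally show ?thesis by simp
qed

text \<open>Since frob is the mean of Q, summing (Q - frob) (Q^k - frob^k) \<ge> 0 over the signs
  leaves exactly this correlation inequality.\<close>

lemma frob_mult_sum_Q_power: "frob N X * (\<Sum>T\<in>Pow {..<N}. Q T ^ k) \<le> (\<Sum>T\<in>Pow {..<N}. Q T ^ Suc k)"
proof -
  let ?F = "frob N X"
  have "0 = (\<Sum>T\<in>Pow {..<N}. (Q T - ?F) * ?F ^ k)"
    unfolding sum_distrib_right[symmetric] sum_subtractf sum_Q by (simp add: card_Pow)
  also have "\<dots> \<le> (\<Sum>T\<in>Pow {..<N}. (Q T - ?F) * Q T ^ k)"
  proof (rule sum_mono)
    fix T
    have "0 \<le> (Q T - ?F) * (Q T ^ k - ?F ^ k)"
    proof (cases "Q T \<le> ?F")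
      case True
      then show ?thesis using Q_nonneg by (intro mult_nonpos_nonpos) (auto intro: power_mono)
    next
      case False
      then show ?thesis by (intro mult_nonneg_nonneg) (auto intro: power_mono)
    qed
    then show "(Q T - ?F) * ?F ^ k \<le> (Q T - ?F) * Q T ^ k" by (simp add: right_diff_distrib)
  qed
  finally show ?thesis by (simp add: left_diff_distrib sum_subtractf sum_distrib_left)
qed

text \<open>Write one factor Q as frob plus the off-diagonal sum. The flip estimate bounds the
  latter by 2 k times the sum of off^2 Q^(k-1); \<open>sum_off_sq\<close> replaces off^2 by 2 L (Q +
  frob), and \<open>frob_mult_sum_Q_power\<close> absorbs frob into Q. Thus 8 = 2 * (2 + 2).\<close>

lemma sum_Q_power_Suc:
  "(\<Sum>T\<in>Pow {..<N}. Q T ^ Suc k) \<le> (frob N X + 8 * real k * L) * (\<Sum>T\<in>Pow {..<N}. Q T ^ k)"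
proof (cases k)
  case 0
  then show ?thesis using sum_Q by (simp add: card_Pow)
next
  case (Suc m)
  let ?P = "Pow {..<N}" and ?F = "frob N X"
  let ?S = "\<lambda>k. (\<Sum>T\<in>?P. Q T ^ k)"
  have "?S (Suc k) = (\<Sum>T\<in>?P. ?F * Q T ^ k + (\<Sum>i<N. sgnv T i * off i T * Q T ^ k))"
  proof (rule sum.cong[OF refl])
    fix T
    have "Q T ^ Suc k = (?F + (\<Sum>i<N. sgnv T i * off i T)) * Q T ^ k" using Q_diag[of T] by simp
    then show "Q T ^ Suc k = ?F * Q T ^ k + (\<Sum>i<N. sgnv T i * off i T * Q T ^ k)"
      by (simp only: distrib_right sum_distrib_right)
  qed
  also have "\<dots> = ?F * ?S k + (\<Sum>T\<in>?P. \<Sum>i<N. sgnv T i * off i T * Q T ^ k)"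
    by (simp only: sum.distrib sum_distrib_left)
  finally have 1: "?S (Suc k) = ?F * ?S k + (\<Sum>T\<in>?P. \<Sum>i<N. sgnv T i * off i T * Q T ^ k)" .
  have "(\<Sum>T\<in>?P. \<Sum>i<N. sgnv T i * off i T * Q T ^ k) = (\<Sum>i<N. \<Sum>T\<in>?P. sgnv T i * off i T * Q T ^ k)"
    by (rule sum.swap)
  also have "\<dots> \<le> (\<Sum>i<N. 2 * real k * (\<Sum>T\<in>?P. (off i T)\<^sup>2 * Q T ^ m))"
    unfolding Suc by (rule sum_mono) (rule sum_off_le, simp)
  also have "\<dots> = 2 * real k * (\<Sum>T\<in>?P. \<Sum>i<N. (off i T)\<^sup>2 * Q T ^ m)"
    unfolding sum_distrib_left[symmetric] by (subst sum.swap) simp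
  also have "\<dots> \<le> 2 * real k * (\<Sum>T\<in>?P. (2 * L * Q T + 2 * L * ?F) * Q T ^ m)"
    unfolding sum_distrib_right[symmetric]
    by (intro mult_left_mono sum_mono mult_right_mono sum_off_sq) (auto simp: Q_nonneg)
  finally have 2: "(\<Sum>T\<in>?P. \<Sum>i<N. sgnv T i * off i T * Q T ^ k) \<le>
    2 * real k * (\<Sum>T\<in>?P. (2 * L * Q T + 2 * L * ?F) * Q T ^ m)" .
  have "(\<Sum>T\<in>?P. (2 * L * Q T + 2 * L * ?F) * Q T ^ m) = 2 * L * ?S k + 2 * L * (?F * ?S m)"
    unfolding Suc sum_distrib_left sum.distrib[symmetric] by (rule sum.cong) (simp_all add: algebra_simps)
  also have "\<dots> \<le> 2 * L * ?S k + 2 * L * ?S k"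
    using frob_mult_sum_Q_power[of m] L0 unfolding Suc by (intro add_left_mono mult_left_mono) auto
  finally have "(\<Sum>T\<in>?P. (2 * L * Q T + 2 * L * ?F) * Q T ^ m) \<le> 4 * L * ?S k" by simp
  then have "2 * real k * (\<Sum>T\<in>?P. (2 * L * Q T + 2 * L * ?F) * Q T ^ m) \<le> 2 * real k * (4 * L * ?S k)"
    by (intro mult_left_mono) auto
  with 1 2 have "?S (Suc k) \<le> ?F * ?S k + 2 * real k * (4 * L * ?S k)" by linarith
  then show ?thesis by (simp add: algebra_simps)
qed

lemma sum_Q_power_le:
  "(\<Sum>T\<in>Pow {..<N}. Q T ^ k) \<le> 2 ^ N * (frob N X + 8 * real k * L) ^ k"
proof -
  have "(\<Sum>T\<in>Pow {..<N}. Q T ^ j) \<le> 2 ^ N * (frob N X + 8 * real k * L) ^ j" if "j \<le> k" for j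
    using that
  proof (induction j)
    case (Suc j)
    have "(\<Sum>T\<in>Pow {..<N}. Q T ^ Suc j) \<le> (frob N X + 8 * real j * L) * (\<Sum>T\<in>Pow {..<N}. Q T ^ j)"
      by (rule sum_Q_power_Suc)
    also have "\<dots> \<le> (frob N X + 8 * real k * L) * (2 ^ N * (frob N X + 8 * real k * L) ^ j)"
      using Suc L0 by (intro mult_mono add_mono mult_right_mono) (auto simp: sum_nonneg Q_nonneg)
    finally show ?case by (simp add: mult_ac)
  qed (simp add: card_Pow)
  then show ?thesis by simp
qed

end

section \<open>The operator norm and i.i.d. sums\<close>

lemma euclid_norm_eq: "v \<in> carrier_vec N \<Longrightarrow> euclid_norm v = sqrt (sqn N (($) v))"
  by (simp add: euclid_norm_def sqn_eq_scalar_prod)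

lemma euclid_norm_mult_mat_vec:
  "A \<in> carrier_mat N N \<Longrightarrow> v \<in> carrier_vec N \<Longrightarrow> euclid_norm (A *\<^sub>v v) = sqrt (sqn N (mulv N A (($) v)))"
  by (simp add: euclid_norm_def sqn_mulv_eq_scalar_prod)

lemma sqn_mulv_le_frob: "sqn N (mulv N A f) \<le> frob N A * sqn N f"
proof -
  have "sqn N (mulv N A f) \<le> (\<Sum>j<N. (\<Sum>k<N. (A $$ (j,k))\<^sup>2) * sqn N f)"
    unfolding sqn_def[of N "mulv N A f"] mulv_def
  proof (rule sum_mono)
    fix j
    show "(\<Sum>k<N. A $$ (j, k) * f k)\<^sup>2 \<le> (\<Sum>k<N. (A $$ (j,k))\<^sup>2) * sqn N f"
      using sum_mult_sq_le[of "\<lambda>k. A $$ (j,k)" f N] by (simp add: sqn_def)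
  qed
  then show ?thesis by (simp add: frob_def sum_distrib_right)
qed

lemma op_norm_sq_ge:
  assumes A: "A \<in> carrier_mat N N" and f: "sqn N f = 1"
  shows "sqn N (mulv N A f) \<le> (op_norm A)\<^sup>2" and "op_norm A \<ge> 0"
proof -
  let ?V = "{v \<in> carrier_vec (dim_col A). euclid_norm v \<le> 1}"
  have dim: "dim_col A = N" using A by simp
  \<comment> \<open>The supremum is one of real numbers, so boundedness is needed before a member
    can be compared with it; the Frobenius norm supplies it.\<close>
  have bdd: "bdd_above ((\<lambda>v. euclid_norm (A *\<^sub>v v)) ` ?V)"
  proof (rule bdd_aboveI2)
    fix v assume v: "v \<in> ?V"
    then have vc: "v \<in> carrier_vec N" and "sqrt (sqn N (($) v)) \<le> 1" using dim by (auto simp: euclid_norm_eq)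
    then have "sqn N (($) v) \<le> 1" by simp
    then have "frob N A * sqn N (($) v) \<le> frob N A * 1" by (intro mult_left_mono) auto
    then have "sqn N (mulv N A (($) v)) \<le> frob N A" using sqn_mulv_le_frob[of N A "($) v"] by simp
    then show "euclid_norm (A *\<^sub>v v) \<le> sqrt (frob N A)"
      using A vc by (simp add: euclid_norm_mult_mat_vec)
  qed
  define u where "u = Matrix.vec N f"
  have u: "u \<in> carrier_vec N" by (simp add: u_def)
  have "sqn N (($) u) = sqn N f" "mulv N A (($) u) = mulv N A f"
    by (rule sqn_cong, simp add: u_def) (rule mulv_cong, simp add: u_def)
  then have "u \<in> ?V" and nu: "euclid_norm (A *\<^sub>v u) = sqrt (sqn N (mulv N A f))"
    using u f dim A by (auto simp: euclid_norm_eq euclid_norm_mult_mat_vec)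
  then have le: "sqrt (sqn N (mulv N A f)) \<le> op_norm A"
    unfolding op_norm_def nu[symmetric] by (intro cSUP_upper bdd)
  then show "0 \<le> op_norm A" using real_sqrt_ge_zero[OF sqn_nonneg[of N "mulv N A f"]] by linarith
  have "(sqrt (sqn N (mulv N A f)))\<^sup>2 \<le> (op_norm A)\<^sup>2" by (rule power_mono[OF le]) simp
  then show "sqn N (mulv N A f) \<le> (op_norm A)\<^sup>2" by simp
qed

lemma op_norm_sq_le:
  assumes A: "A \<in> carrier_mat N N" and c: "c \<ge> 0" and N: "N \<ge> 1"
    and le: "\<And>f. sqn N f = 1 \<Longrightarrow> sqn N (mulv N A f) \<le> c"
  shows "(op_norm A)\<^sup>2 \<le> c"
proof -
  let ?V = "{v \<in> carrier_vec (dim_col A). euclid_norm v \<le> 1}"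
  have dim: "dim_col A = N" using A by simp
  have "op_norm A \<le> sqrt c" unfolding op_norm_def
  proof (rule cSUP_least)
    have "0\<^sub>v N \<in> ?V" using dim by (simp add: euclid_norm_def)
    then show "?V \<noteq> {}" by blast
    fix v assume v: "v \<in> ?V"
    then have vc: "v \<in> carrier_vec N" and "sqrt (sqn N (($) v)) \<le> 1" using dim by (auto simp: euclid_norm_eq)
    then have v1: "sqn N (($) v) \<le> 1" by simp
    have "sqn N (mulv N A (($) v)) \<le> c"
    proof (cases "sqn N (($) v) = 0")
      case True
      then show ?thesis using sqn_mulv_le_frob[of N A "($) v"] c by simp
    next
      case False
      define r where "r = sqn N (($) v)"
      have r: "r > 0" "r \<le> 1" using False v1 sqn_nonneg[of N "($) v"] unfolding r_def by linarith+
      have "sqn N (\<lambda>k. 1 / sqrt r * v $ k) = 1" unfolding sqn_scale using r by (simp add: r_def power_divide)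
      from le[OF this] have "sqn N (mulv N A (($) v)) / r \<le> c"
        unfolding sqn_mulv_scale using r by (simp add: power_divide)
      then have "sqn N (mulv N A (($) v)) \<le> c * r" using r by (simp add: pos_divide_le_eq)
      also have "\<dots> \<le> c * 1" using c r by (intro mult_left_mono) auto
      finally show ?thesis by simp
    qed
    then show "euclid_norm (A *\<^sub>v v) \<le> sqrt c" using A vc by (simp add: euclid_norm_mult_mat_vec)
  qed
  moreover have "op_norm A \<ge> 0"
  proof (rule op_norm_sq_ge(2)[OF A])
    have "(\<Sum>k<N. (if k = 0 then 1 else 0 :: real)) = 1" using N by simp
    then show "sqn N (\<lambda>k. if k = 0 then 1 else 0) = 1" by (simp add: sqn_def if_distrib[of "\<lambda>x. x\<^sup>2"] cong: if_cong)
  qed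
  ultimately have "(op_norm A)\<^sup>2 \<le> (sqrt c)\<^sup>2" by (intro power_mono)
  then show ?thesis using c by simp
qed

text \<open>A unit vector stretched beyond c would by itself push the Gaussian moment above
  \<open>fact k * c ^ k\<close>; the factorials cancel and k-th roots can be taken.\<close>

lemma op_norm_sq_le_gauss:
  assumes A: "A \<in> carrier_mat N N" and c: "c \<ge> 0" and N: "N \<ge> 1" and k: "k \<ge> 1"
    and le: "(\<integral>\<^sup>+g. ennreal (sqn N (mulv N A g) ^ k) \<partial>gauss N) \<le> ennreal (fact k * c ^ k)"
  shows "(op_norm A)\<^sup>2 \<le> c"
proof (rule op_norm_sq_le[OF A c N])
  fix f assume "sqn N f = 1"
  from order_trans[OF gauss_image_power_ge[OF this] le]
  have "fact k * sqn N (mulv N A f) ^ k \<le> fact k * c ^ k" using c by (simp add: ennreal_le_iff)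
  then have "sqn N (mulv N A f) ^ k \<le> c ^ k" by simp
  moreover obtain m where "k = Suc m" using k by (cases k) auto
  ultimately show "sqn N (mulv N A f) \<le> c" using c by (auto intro: power_le_imp_le_base)
qed

section \<open>Second moments and deviations of i.i.d. sums\<close>

lemma (in prob_space) iid_sum_centered:
  fixes Y :: "nat \<Rightarrow> 'a \<Rightarrow> real"
  assumes ind: "indep_vars (\<lambda>_. borel) Y {1..}"
    and i0: "\<And>i. i \<ge> 1 \<Longrightarrow> integrable M (Y i)" "\<And>i. i \<ge> 1 \<Longrightarrow> expectation (Y i) = 0"
    and i2: "\<And>i. i \<ge> 1 \<Longrightarrow> integrable M (\<lambda>\<omega>. (Y i \<omega>)\<^sup>2)" "\<And>i. i \<ge> 1 \<Longrightarrow> expectation (\<lambda>\<omega>. (Y i \<omega>)\<^sup>2) = V"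
  shows "integrable M (\<lambda>\<omega>. \<Sum>i=1..n. Y i \<omega>) \<and> expectation (\<lambda>\<omega>. \<Sum>i=1..n. Y i \<omega>) = 0 \<and>
    integrable M (\<lambda>\<omega>. (\<Sum>i=1..n. Y i \<omega>)\<^sup>2) \<and> expectation (\<lambda>\<omega>. (\<Sum>i=1..n. Y i \<omega>)\<^sup>2) = real n * V"
proof (induction n)
  case (Suc n)
  let ?Z = "\<lambda>\<omega>. \<Sum>i=1..n. Y i \<omega>" and ?W = "Y (Suc n)"
  have W: "integrable M ?W" "expectation ?W = 0" "integrable M (\<lambda>\<omega>. (?W \<omega>)\<^sup>2)" "expectation (\<lambda>\<omega>. (?W \<omega>)\<^sup>2) = V"
    by (rule i0 i2, simp)+
  have iv: "indep_var borel ?W borel ?Z"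
    by (rule indep_vars_sum) (use indep_vars_subset[OF ind, of "insert (Suc n) {1..n}"] in auto)
  have WZ: "integrable M (\<lambda>\<omega>. ?W \<omega> * ?Z \<omega>)" "expectation (\<lambda>\<omega>. ?W \<omega> * ?Z \<omega>) = 0"
    using indep_var_integrable[OF iv W(1)] indep_var_lebesgue_integral[OF iv W(1)] Suc W(2) by auto
  have eq: "(\<Sum>i=1..Suc n. Y i \<omega>)\<^sup>2 = (?Z \<omega>)\<^sup>2 + 2 * (?W \<omega> * ?Z \<omega>) + (?W \<omega>)\<^sup>2" for \<omega>
    by (simp add: power2_sum)
  show ?case
    unfolding eq using Suc W WZ by (simp add: algebra_simps)
qed (simp add: prob_space)

lemma (in prob_space) iid_sum_deviation:
  fixes Y :: "nat \<Rightarrow> 'a \<Rightarrow> real"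
  assumes ind: "indep_vars (\<lambda>_. borel) Y {1..}"
    and Z: "integrable M Z" "integrable M (\<lambda>\<omega>. (Z \<omega>)\<^sup>2)"
    and law: "\<And>i. i \<ge> 1 \<Longrightarrow> distr M borel (Y i) = distr M borel Z"
    and n: "n \<ge> 1" and \<delta>: "\<delta> > 0"
  shows "{\<omega> \<in> space M. \<bar>(\<Sum>i=1..n. Y i \<omega>) - real n * expectation Z\<bar> \<ge> real n * \<delta>} \<in> events"
    and "prob {\<omega> \<in> space M. \<bar>(\<Sum>i=1..n. Y i \<omega>) - real n * expectation Z\<bar> \<ge> real n * \<delta>} \<le> variance Z / (real n * \<delta>\<^sup>2)"
proof -
  let ?m = "expectation Z"
  have Ym: "Y i \<in> borel_measurable M" if "i \<ge> 1" for i
    using ind that unfolding indep_vars_def by auto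
  have Zm: "Z \<in> borel_measurable M" using Z by auto
  have tr: "integrable M (\<lambda>\<omega>. F (Y i \<omega>)) \<longleftrightarrow> integrable M (\<lambda>\<omega>. F (Z \<omega>))"
    "expectation (\<lambda>\<omega>. F (Y i \<omega>)) = expectation (\<lambda>\<omega>. F (Z \<omega>))"
    if "i \<ge> 1" and F: "F \<in> borel_measurable borel" for F :: "real \<Rightarrow> real" and i
    using integrable_distr_eq[OF Ym[OF that(1)] F] integrable_distr_eq[OF Zm F]
      integral_distr[OF Ym[OF that(1)] F] integral_distr[OF Zm F] law[OF that(1)] by simp_all
  define W where "W i \<omega> = Y i \<omega> - ?m" for i \<omega>
  have c1: "integrable M (\<lambda>\<omega>. Z \<omega> - ?m)" "expectation (\<lambda>\<omega>. Z \<omega> - ?m) = 0"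
    using Z by (simp_all add: prob_space)
  have c2: "integrable M (\<lambda>\<omega>. (Z \<omega> - ?m)\<^sup>2)"
    using Z by (simp add: power2_diff)
  have indW: "indep_vars (\<lambda>_. borel) W {1..}"
    unfolding W_def by (rule indep_vars_compose2[OF ind]) auto
  have ctr: "integrable M (\<lambda>\<omega>. \<Sum>i=1..n. W i \<omega>) \<and> expectation (\<lambda>\<omega>. \<Sum>i=1..n. W i \<omega>) = 0 \<and>
    integrable M (\<lambda>\<omega>. (\<Sum>i=1..n. W i \<omega>)\<^sup>2) \<and> expectation (\<lambda>\<omega>. (\<Sum>i=1..n. W i \<omega>)\<^sup>2) = real n * variance Z"
  proof (rule iid_sum_centered[OF indW])
    fix i :: nat assume i: "i \<ge> 1"
    show "integrable M (W i)" "expectation (W i) = 0"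
      using tr[OF i, of "\<lambda>x. x - ?m"] c1 unfolding W_def by simp_all
    show "integrable M (\<lambda>\<omega>. (W i \<omega>)\<^sup>2)" "expectation (\<lambda>\<omega>. (W i \<omega>)\<^sup>2) = variance Z"
      using tr[OF i, of "\<lambda>x. (x - ?m)\<^sup>2"] c2 unfolding W_def by simp_all
  qed
  have sW: "(\<Sum>i=1..n. W i \<omega>) = (\<Sum>i=1..n. Y i \<omega>) - real n * ?m" for \<omega>
    by (simp add: W_def sum_subtractf)
  have Wm: "(\<lambda>\<omega>. \<Sum>i=1..n. W i \<omega>) \<in> borel_measurable M" using ctr by auto
  show "{\<omega> \<in> space M. \<bar>(\<Sum>i=1..n. Y i \<omega>) - real n * ?m\<bar> \<ge> real n * \<delta>} \<in> events"
    unfolding sW[symmetric] using Wm by measurable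
  have "prob {\<omega> \<in> space M. real n * \<delta> \<le> \<bar>(\<Sum>i=1..n. W i \<omega>) - expectation (\<lambda>\<omega>. \<Sum>i=1..n. W i \<omega>)\<bar>}
    \<le> variance (\<lambda>\<omega>. \<Sum>i=1..n. W i \<omega>) / (real n * \<delta>)\<^sup>2"
    by (rule Chebyshev_inequality) (use ctr Wm n \<delta> in auto)
  also have "variance (\<lambda>\<omega>. \<Sum>i=1..n. W i \<omega>) = real n * variance Z" using ctr by simp
  also have "real n * variance Z / (real n * \<delta>)\<^sup>2 = variance Z / (real n * \<delta>\<^sup>2)"
    using n by (simp add: power2_eq_square)
  finally show "prob {\<omega> \<in> space M. \<bar>(\<Sum>i=1..n. Y i \<omega>) - real n * ?m\<bar> \<ge> real n * \<delta>} \<le> variance Z / (real n * \<delta>\<^sup>2)"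
    using ctr unfolding sW by simp
qed

section \<open>Products of isotropic matrices\<close>

definition unitf :: "nat \<Rightarrow> nat \<Rightarrow> real" where
  "unitf j k = (if k = j then 1 else 0)"

lemma sqn_unitf: "j < N \<Longrightarrow> sqn N (unitf j) = 1"
proof -
  have "sqn N (unitf j) = (\<Sum>k<N. if k = j then 1 else 0)"
    unfolding sqn_def by (rule sum.cong) (auto simp: unitf_def)
  then show "j < N \<Longrightarrow> sqn N (unitf j) = 1" by simp
qed

lemma mulv_unitf: "j < N \<Longrightarrow> mulv N A (unitf j) l = A $$ (l,j)"
  unfolding mulv_def unitf_def by (simp add: if_distrib[of "\<lambda>x. _ * x"] cong: if_cong)

lemma frob_eq_sum_unitf: "frob N A = (\<Sum>j<N. sqn N (mulv N A (unitf j)))"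
proof -
  have "(\<Sum>j<N. sqn N (mulv N A (unitf j))) = (\<Sum>j<N. \<Sum>l<N. (A $$ (l,j))\<^sup>2)"
    by (rule sum.cong) (simp_all add: sqn_def mulv_unitf)
  also have "\<dots> = frob N A" unfolding frob_def by (rule sum.swap)
  finally show ?thesis by simp
qed

lemma sqn_mulv_zero: "sqn N g = 0 \<Longrightarrow> sqn N (mulv N A g) = 0"
  using sqn_mulv_le_frob[of N A g] sqn_nonneg[of N "mulv N A g"] by simp

lemma power2_add_le: "(a + b)\<^sup>2 \<le> 2 * a\<^sup>2 + 2 * b\<^sup>2" for a b :: real
  using zero_le_power2[of "a - b"] by (simp add: power2_sum power2_diff)

text \<open>S will be frob / N for bounded singular values and the constant \<sigma>^2 for Gaussian
  entries. Positivity and integrability are added only in \<open>isotropic_product\<close>, because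
  in the singular value case they are derived with the averaging lemmas of this smaller
  locale.\<close>

locale isotropic_matrices = prob_space M for M :: "'a measure" +
  fixes N :: nat and X :: "nat \<Rightarrow> 'a \<Rightarrow> real Matrix.mat" and S :: "real Matrix.mat \<Rightarrow> real"
  assumes N1: "N \<ge> 1"
    and ind: "indep_vars (\<lambda>_. borel_mat N) X {1..}"
    and ident: "\<And>i. i \<ge> 1 \<Longrightarrow> distr M (borel_mat N) (X i) = distr M (borel_mat N) (X 1)"
    and inv: "rotationally_invariant M N (X 1)"
    and S_meas [measurable]: "S \<in> borel_measurable (borel_mat N)"
    and S_nonneg: "\<And>A. 0 \<le> S A"
    and S_inv: "\<And>A U. A \<in> carrier_mat N N \<Longrightarrow> U \<in> carrier_mat N N \<Longrightarrow> transpose_mat U = U \<Longrightarrow>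
      U * U = 1\<^sub>m N \<Longrightarrow> S (U * A * U) = S A"
begin

text \<open>By isotropy any unit vector would do. With the first basis vector, q is the squared norm
  of the first column, and z is the stretch with the overall size S of the matrix removed.\<close>

definition q :: "'a \<Rightarrow> real" where "q \<omega> = sqn N (mulv N (X 1 \<omega>) (unitf 0))"
definition s :: "'a \<Rightarrow> real" where "s \<omega> = S (X 1 \<omega>)"
definition z :: "'a \<Rightarrow> real" where "z \<omega> = q \<omega> / s \<omega>"

abbreviation prd :: "nat \<Rightarrow> 'a \<Rightarrow> real Matrix.mat" where
  "prd n \<omega> \<equiv> mat_prod N (\<lambda>i. X i \<omega>) n"

lemma X_meas: "i \<ge> 1 \<Longrightarrow> X i \<in> measurable M (borel_mat N)"
  using ind unfolding indep_vars_def by auto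

lemma X_carrier: "i \<ge> 1 \<Longrightarrow> \<omega> \<in> space M \<Longrightarrow> X i \<omega> \<in> carrier_mat N N"
  using measurable_space[OF X_meas] by simp

lemma prd_carrier: "\<omega> \<in> space M \<Longrightarrow> prd n \<omega> \<in> carrier_mat N N"
  by (rule sqn_mulv_mat_prod(1)[OF _ sqn_unitf[of 0]]) (use X_carrier N1 in auto)

lemma s_meas [measurable]: "s \<in> borel_measurable M"
  unfolding s_def by (rule measurable_compose[OF X_meas S_meas]) simp

lemma q_meas [measurable]: "q \<in> borel_measurable M"
  unfolding q_def by (rule measurable_compose[OF X_meas measurable_sqn_mulv]) simp

lemma z_meas [measurable]: "z \<in> borel_measurable M"
  unfolding z_def by measurable

lemma law:
  fixes G :: "real \<times> real \<Rightarrow> real"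
  assumes G: "G \<in> borel_measurable borel" and i: "i \<ge> 1" and h: "sqn N h = 1"
  shows "distr M borel (\<lambda>\<omega>. G (sqn N (mulv N (X i \<omega>) h), S (X i \<omega>))) = distr M borel (\<lambda>\<omega>. G (q \<omega>, s \<omega>))"
proof -
  let ?G = "\<lambda>A. G (sqn N (mulv N A h), S A)"
  have Gm: "?G \<in> borel_measurable (borel_mat N)"
    by (rule measurable_compose[OF borel_measurable_Pair[OF measurable_sqn_mulv S_meas] G])
  have "distr M borel (\<lambda>\<omega>. ?G (X i \<omega>)) = distr (distr M (borel_mat N) (X i)) borel ?G"
    using distr_distr[OF Gm X_meas[OF i]] by (simp add: comp_def)
  also have "\<dots> = distr M borel (\<lambda>\<omega>. ?G (X 1 \<omega>))"
    unfolding ident[OF i] using distr_distr[OF Gm X_meas[OF order_refl]] by (simp add: comp_def)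
  also have "\<dots> = distr M borel (\<lambda>\<omega>. G (q \<omega>, s \<omega>))"
    unfolding q_def s_def
  proof (rule rotationally_invariant_unit_law[OF X_meas[OF order_refl] inv N1 S_meas _ G h])
    show "sqn N (unitf 0) = 1" using N1 by (intro sqn_unitf) simp
  qed (rule S_inv)
  finally show ?thesis .
qed

lemma steps:
  fixes G :: "real \<times> real \<Rightarrow> real"
  assumes G: "G \<in> borel_measurable borel" and f: "sqn N f = 1"
  shows "indep_vars (\<lambda>_. borel) (\<lambda>i \<omega>. step_stat N G S f (\<lambda>i. X i \<omega>) i) {1..}"
    and "i \<ge> 1 \<Longrightarrow> distr M borel (\<lambda>\<omega>. step_stat N G S f (\<lambda>i. X i \<omega>) i) = distr M borel (\<lambda>\<omega>. G (q \<omega>, s \<omega>))"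
  by (rule step_stat_iid[OF ind G S_meas f law[OF G]]; simp)+

lemma step_meas:
  fixes G :: "real \<times> real \<Rightarrow> real"
  assumes "G \<in> borel_measurable borel" "sqn N f = 1" "i \<ge> 1"
  shows "(\<lambda>\<omega>. step_stat N G S f (\<lambda>i. X i \<omega>) i) \<in> borel_measurable M"
  using steps(1)[OF assms(1,2)] assms(3) unfolding indep_vars_def by auto

lemma AE_step:
  fixes G :: "real \<times> real \<Rightarrow> real"
  assumes G: "G \<in> borel_measurable borel" and f: "sqn N f = 1" and i: "i \<ge> 1"
    and P: "Measurable.pred borel P" and ae: "AE \<omega> in M. P (G (q \<omega>, s \<omega>))"
  shows "AE \<omega> in M. P (step_stat N G S f (\<lambda>i. X i \<omega>) i)"
proof -
  have m: "(\<lambda>\<omega>. G (q \<omega>, s \<omega>)) \<in> borel_measurable M"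
    by (rule measurable_compose[OF borel_measurable_Pair[OF q_meas s_meas] G])
  have P': "{x \<in> space borel. P x} \<in> sets borel" using P by measurable
  have "AE x in distr M borel (\<lambda>\<omega>. G (q \<omega>, s \<omega>)). P x"
    using ae AE_distr_iff[OF m P'] by simp
  then show ?thesis
    unfolding steps(2)[OF G f i, symmetric] by (subst (asm) AE_distr_iff[OF step_meas[OF G f i] P'])
qed

end

locale isotropic_product = isotropic_matrices +
  assumes S_pos: "AE \<omega> in M. 0 < S (X 1 \<omega>)"
    and q_pos: "AE \<omega> in M. 0 < sqn N (mulv N (X 1 \<omega>) (unitf 0))"
    and ln_S: "integrable M (\<lambda>\<omega>. ln (S (X 1 \<omega>)))" "integrable M (\<lambda>\<omega>. (ln (S (X 1 \<omega>)))\<^sup>2)"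
    and ln_Z: "integrable M (\<lambda>\<omega>. (ln (sqn N (mulv N (X 1 \<omega>) (unitf 0)) / S (X 1 \<omega>)))\<^sup>2)"
begin

lemma AE_qs: "AE \<omega> in M. 0 < q \<omega> \<and> 0 < s \<omega>"
  using q_pos S_pos by eventually_elim (simp add: q_def s_def)

lemma ln_q_eq: "AE \<omega> in M. ln (q \<omega>) = ln (s \<omega>) + ln (z \<omega>)"
  using AE_qs by eventually_elim (simp add: z_def ln_div)

lemma integrable_ln:
  "integrable M (\<lambda>\<omega>. ln (s \<omega>))" "integrable M (\<lambda>\<omega>. (ln (s \<omega>))\<^sup>2)"
  "integrable M (\<lambda>\<omega>. ln (z \<omega>))" "integrable M (\<lambda>\<omega>. (ln (z \<omega>))\<^sup>2)"
  "integrable M (\<lambda>\<omega>. ln (q \<omega>))" "integrable M (\<lambda>\<omega>. (ln (q \<omega>))\<^sup>2)"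
proof -
  show 1: "integrable M (\<lambda>\<omega>. ln (s \<omega>))" and 2: "integrable M (\<lambda>\<omega>. (ln (s \<omega>))\<^sup>2)"
    using ln_S by (simp_all add: s_def)
  show 4: "integrable M (\<lambda>\<omega>. (ln (z \<omega>))\<^sup>2)" using ln_Z by (simp add: z_def q_def s_def)
  then show 3: "integrable M (\<lambda>\<omega>. ln (z \<omega>))" by (rule square_integrable_imp_integrable[rotated]) measurable
  have "integrable M (\<lambda>\<omega>. ln (s \<omega>) + ln (z \<omega>))" using 1 3 by simp
  then show "integrable M (\<lambda>\<omega>. ln (q \<omega>))"
  proof (rule integrable_cong_AE_imp)
    show "AE \<omega> in M. ln (s \<omega>) + ln (z \<omega>) = ln (q \<omega>)" using ln_q_eq by eventually_elim simp
  qed measurable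
  have "integrable M (\<lambda>\<omega>. 2 * (ln (s \<omega>))\<^sup>2 + 2 * (ln (z \<omega>))\<^sup>2)" using 2 4 by simp
  then show "integrable M (\<lambda>\<omega>. (ln (q \<omega>))\<^sup>2)"
  proof (rule Bochner_Integration.integrable_bound)
    show "AE \<omega> in M. norm ((ln (q \<omega>))\<^sup>2) \<le> norm (2 * (ln (s \<omega>))\<^sup>2 + 2 * (ln (z \<omega>))\<^sup>2)"
      using ln_q_eq
    proof eventually_elim
      case (elim \<omega>)
      then show ?case using power2_add_le[of "ln (s \<omega>)" "ln (z \<omega>)"] by simp
    qed
  qed measurable
qed

text \<open>All estimates use squared norms, so \<open>\<mu>\<close> is twice the growth rate in the
  theorem.\<close>

definition \<mu> :: real where "\<mu> = expectation (\<lambda>\<omega>. ln (q \<omega>))"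

lemma mu_eq: "\<mu> = expectation (\<lambda>\<omega>. ln (s \<omega>)) + expectation (\<lambda>\<omega>. ln (z \<omega>))"
proof -
  have "\<mu> = expectation (\<lambda>\<omega>. ln (s \<omega>) + ln (z \<omega>))"
    unfolding \<mu>_def by (rule integral_cong_AE) (use ln_q_eq in auto)
  then show ?thesis using integrable_ln by simp
qed

text \<open>Almost surely ln q = ln s + ln z, where s and z may be dependent; the elementary bound
  for the square of a sum costs the factors 2.\<close>

lemma variance_ln_q:
  "variance (\<lambda>\<omega>. ln (q \<omega>)) \<le> 2 * variance (\<lambda>\<omega>. ln (s \<omega>)) + 2 * expectation (\<lambda>\<omega>. (ln (z \<omega>))\<^sup>2)"
proof -
  let ?a = "expectation (\<lambda>\<omega>. ln (s \<omega>))" and ?b = "expectation (\<lambda>\<omega>. ln (z \<omega>))"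
  have iz: "integrable M (\<lambda>\<omega>. (ln (z \<omega>) - ?b)\<^sup>2)" and is2: "integrable M (\<lambda>\<omega>. (ln (s \<omega>) - ?a)\<^sup>2)"
    using integrable_ln by (simp_all add: power2_diff)
  have iq: "integrable M (\<lambda>\<omega>. (ln (q \<omega>) - \<mu>)\<^sup>2)" using integrable_ln by (simp add: power2_diff)
  have "variance (\<lambda>\<omega>. ln (q \<omega>)) = expectation (\<lambda>\<omega>. (ln (q \<omega>) - \<mu>)\<^sup>2)" by (simp add: \<mu>_def)
  also have "\<dots> \<le> expectation (\<lambda>\<omega>. 2 * (ln (s \<omega>) - ?a)\<^sup>2 + 2 * (ln (z \<omega>) - ?b)\<^sup>2)"
  proof (rule integral_mono_AE[OF iq])
    show "AE \<omega> in M. (ln (q \<omega>) - \<mu>)\<^sup>2 \<le> 2 * (ln (s \<omega>) - ?a)\<^sup>2 + 2 * (ln (z \<omega>) - ?b)\<^sup>2"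
      using ln_q_eq
    proof eventually_elim
      case (elim \<omega>)
      have "ln (q \<omega>) - \<mu> = (ln (s \<omega>) - ?a) + (ln (z \<omega>) - ?b)" using elim mu_eq by simp
      then show ?case using power2_add_le[of "ln (s \<omega>) - ?a" "ln (z \<omega>) - ?b"] by simp
    qed
  qed (use iz is2 in simp)
  also have "\<dots> = 2 * variance (\<lambda>\<omega>. ln (s \<omega>)) + 2 * variance (\<lambda>\<omega>. ln (z \<omega>))"
    using iz is2 by simp
  also have "variance (\<lambda>\<omega>. ln (z \<omega>)) \<le> expectation (\<lambda>\<omega>. (ln (z \<omega>))\<^sup>2)"
    using variance_eq[OF integrable_ln(3,4)] by simp
  finally show ?thesis by simp
qed

text \<open>The logarithm of \<open>|P f|\<^sup>2\<close> is an i.i.d. sum, because each step is isotropic given the past.\<close>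

lemma vector_growth:
  assumes f: "sqn N f = 1" and n: "n \<ge> 1" and \<delta>: "\<delta> > 0"
  shows "\<exists>B\<in>events. prob B \<le> variance (\<lambda>\<omega>. ln (q \<omega>)) / (real n * \<delta>\<^sup>2) \<and>
    (\<forall>\<omega>\<in>space M - B. 0 < sqn N (mulv N (prd n \<omega>) f) \<and>
      \<bar>ln (sqn N (mulv N (prd n \<omega>) f)) - real n * \<mu>\<bar> < real n * \<delta>)"
proof -
  have Gm: "(\<lambda>x. ln (fst x)) \<in> borel_measurable (borel :: (real \<times> real) measure)"
    and Fm: "fst \<in> borel_measurable (borel :: (real \<times> real) measure)"
    unfolding borel_prod[symmetric] by measurable
  let ?y = "\<lambda>\<omega> i. step_stat N fst S f (\<lambda>i. X i \<omega>) i"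
  let ?Y = "\<lambda>i \<omega>. step_stat N (\<lambda>x. ln (fst x)) S f (\<lambda>i. X i \<omega>) i"
  let ?C = "{\<omega> \<in> space M. \<bar>(\<Sum>i=1..n. ?Y i \<omega>) - real n * \<mu>\<bar> \<ge> real n * \<delta>}"
  \<comment> \<open>Off a null set no step vanishes. A vanishing step would break the passage from
    the product to the sum of logarithms, because ln 0 = 0.\<close>
  have "\<forall>i\<in>{1..n}. AE \<omega> in M. 0 < ?y \<omega> i"
    by (intro ballI AE_step[OF Fm f]) (use AE_qs in auto)
  then have "AE \<omega> in M. \<forall>i\<in>{1..n}. 0 < ?y \<omega> i" by (simp add: AE_finite_all)
  then obtain E where E: "{\<omega> \<in> space M. \<not> (\<forall>i\<in>{1..n}. 0 < ?y \<omega> i)} \<subseteq> E" "E \<in> events" "emeasure M E = 0"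
    by (rule AE_E)
  have Enull: "E \<in> null_sets M" using E(2,3) by (rule null_setsI[rotated])
  have l: "distr M borel (?Y i) = distr M borel (\<lambda>\<omega>. ln (q \<omega>))" if "i \<ge> 1" for i
    using steps(2)[OF Gm f that] by (simp only: fst_conv)
  have C: "?C \<in> events" "prob ?C \<le> variance (\<lambda>\<omega>. ln (q \<omega>)) / (real n * \<delta>\<^sup>2)"
    unfolding \<mu>_def by (rule iid_sum_deviation[OF steps(1)[OF Gm f] integrable_ln(5,6) _ n \<delta>], erule l)+
  show ?thesis
  proof (intro bexI[of _ "?C \<union> E"] conjI ballI)
    show "prob (?C \<union> E) \<le> variance (\<lambda>\<omega>. ln (q \<omega>)) / (real n * \<delta>\<^sup>2)"
      using C(2) by (simp only: measure_Un_null_set[OF C(1) Enull])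
    fix \<omega> assume \<omega>: "\<omega> \<in> space M - (?C \<union> E)"
    then have pos: "\<And>i. i \<in> {1..n} \<Longrightarrow> 0 < ?y \<omega> i" using E(1) by blast
    have eq: "sqn N (mulv N (prd n \<omega>) f) = (\<Prod>i=1..n. ?y \<omega> i)"
      using sqn_mulv_mat_prod(2)[of "\<lambda>i. X i \<omega>" N f n] X_carrier \<omega> f by (simp add: step_stat_def)
    show "0 < sqn N (mulv N (prd n \<omega>) f)" unfolding eq by (rule prod_pos) (rule pos)
    have "ln (sqn N (mulv N (prd n \<omega>) f)) = (\<Sum>i=1..n. ln (?y \<omega> i))"
      unfolding eq by (rule ln_prod) (use pos in force)+
    then show "\<bar>ln (sqn N (mulv N (prd n \<omega>) f)) - real n * \<mu>\<bar> < real n * \<delta>"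
      using \<omega> by (simp add: step_stat_def not_le)
  qed (use C E in auto)
qed

lemma op_norm_lower:
  assumes n: "n \<ge> 1" and \<delta>: "\<delta> > 0"
  shows "\<exists>B\<in>events. prob B \<le> variance (\<lambda>\<omega>. ln (q \<omega>)) / (real n * \<delta>\<^sup>2) \<and>
    (\<forall>\<omega>\<in>space M - B. 0 < op_norm (prd n \<omega>) \<and> ln ((op_norm (prd n \<omega>))\<^sup>2) > real n * (\<mu> - \<delta>))"
proof -
  have f: "sqn N (unitf 0) = 1" using N1 by (intro sqn_unitf) simp
  obtain B where B: "B \<in> events" "prob B \<le> variance (\<lambda>\<omega>. ln (q \<omega>)) / (real n * \<delta>\<^sup>2)"
    and g: "\<And>\<omega>. \<omega> \<in> space M - B \<Longrightarrow> 0 < sqn N (mulv N (prd n \<omega>) (unitf 0)) \<and>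
      \<bar>ln (sqn N (mulv N (prd n \<omega>) (unitf 0))) - real n * \<mu>\<bar> < real n * \<delta>"
    using vector_growth[OF f n \<delta>] by blast
  show ?thesis
  proof (intro bexI[of _ B] conjI ballI)
    fix \<omega> assume \<omega>: "\<omega> \<in> space M - B"
    let ?r = "sqn N (mulv N (prd n \<omega>) (unitf 0))"
    have c: "prd n \<omega> \<in> carrier_mat N N" using \<omega> prd_carrier by simp
    have le: "?r \<le> (op_norm (prd n \<omega>))\<^sup>2" and "0 \<le> op_norm (prd n \<omega>)" using op_norm_sq_ge[OF c f] by auto
    moreover have r: "?r > 0" using g[OF \<omega>] by simp
    ultimately have "op_norm (prd n \<omega>) \<noteq> 0" by auto
    then show "0 < op_norm (prd n \<omega>)" using \<open>0 \<le> op_norm (prd n \<omega>)\<close> by simp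
    have "ln ?r \<le> ln ((op_norm (prd n \<omega>))\<^sup>2)" using le r by (intro ln_mono) auto
    moreover have "ln ?r > real n * \<mu> - real n * \<delta>" using g[OF \<omega>] by (simp add: abs_less_iff)
    ultimately show "ln ((op_norm (prd n \<omega>))\<^sup>2) > real n * (\<mu> - \<delta>)" by (simp add: right_diff_distrib)
  qed (use B in auto)
qed

text \<open>The columns are the images of the basis vectors, and the Frobenius norm dominates the
  operator norm. The dimension is paid for twice, in the union bound and in the norm, so this serves
  bounded N.\<close>

lemma op_norm_upper_small:
  assumes n: "n \<ge> 1" and \<delta>: "\<delta> > 0"
  shows "\<exists>B\<in>events. prob B \<le> real N * (variance (\<lambda>\<omega>. ln (q \<omega>)) / (real n * \<delta>\<^sup>2)) \<and>
    (\<forall>\<omega>\<in>space M - B. (op_norm (prd n \<omega>))\<^sup>2 \<le> real N * exp (real n * (\<mu> + \<delta>)))"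
proof -
  let ?K = "variance (\<lambda>\<omega>. ln (q \<omega>)) / (real n * \<delta>\<^sup>2)"
  have "\<forall>j\<in>{..<N}. \<exists>B. B \<in> events \<and> prob B \<le> ?K \<and>
    (\<forall>\<omega>\<in>space M - B. sqn N (mulv N (prd n \<omega>) (unitf j)) \<le> exp (real n * (\<mu> + \<delta>)))"
  proof
    fix j assume "j \<in> {..<N}"
    then have f: "sqn N (unitf j) = 1" by (intro sqn_unitf) simp
    obtain B where B: "B \<in> events" "prob B \<le> ?K"
      and g: "\<And>\<omega>. \<omega> \<in> space M - B \<Longrightarrow> 0 < sqn N (mulv N (prd n \<omega>) (unitf j)) \<and>
        \<bar>ln (sqn N (mulv N (prd n \<omega>) (unitf j))) - real n * \<mu>\<bar> < real n * \<delta>"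
      using vector_growth[OF f n \<delta>] by blast
    show "\<exists>B. B \<in> events \<and> prob B \<le> ?K \<and>
      (\<forall>\<omega>\<in>space M - B. sqn N (mulv N (prd n \<omega>) (unitf j)) \<le> exp (real n * (\<mu> + \<delta>)))"
    proof (intro exI[of _ B] conjI ballI B)
      fix \<omega> assume \<omega>: "\<omega> \<in> space M - B"
      let ?r = "sqn N (mulv N (prd n \<omega>) (unitf j))"
      have "ln ?r < real n * \<mu> + real n * \<delta>" using g[OF \<omega>] by (simp add: abs_less_iff)
      then have "exp (ln ?r) \<le> exp (real n * (\<mu> + \<delta>))" by (simp add: distrib_left)
      then show "?r \<le> exp (real n * (\<mu> + \<delta>))" using g[OF \<omega>] by simp
    qed
  qed
  then obtain B where B: "\<And>j. j < N \<Longrightarrow> B j \<in> events \<and> prob (B j) \<le> ?K \<and>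
    (\<forall>\<omega>\<in>space M - B j. sqn N (mulv N (prd n \<omega>) (unitf j)) \<le> exp (real n * (\<mu> + \<delta>)))"
    unfolding bchoice_iff lessThan_iff by blast
  show ?thesis
  proof (intro bexI[of _ "\<Union>j<N. B j"] conjI ballI)
    have "prob (\<Union>j<N. B j) \<le> (\<Sum>j<N. prob (B j))"
      by (rule finite_measure_subadditive_finite) (use B in blast)+
    also have "\<dots> \<le> (\<Sum>j<N. ?K)" by (rule sum_mono) (use B in blast)
    finally show "prob (\<Union>j<N. B j) \<le> real N * ?K" by simp
    fix \<omega> assume \<omega>: "\<omega> \<in> space M - (\<Union>j<N. B j)"
    have c: "prd n \<omega> \<in> carrier_mat N N" using \<omega> prd_carrier by simp
    have "(op_norm (prd n \<omega>))\<^sup>2 \<le> frob N (prd n \<omega>)"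
    proof (rule op_norm_sq_le[OF c frob_nonneg N1])
      fix f assume "sqn N f = 1"
      then show "sqn N (mulv N (prd n \<omega>) f) \<le> frob N (prd n \<omega>)" using sqn_mulv_le_frob[of N "prd n \<omega>" f] by simp
    qed
    also have "\<dots> \<le> (\<Sum>j<N. exp (real n * (\<mu> + \<delta>)))"
      unfolding frob_eq_sum_unitf by (rule sum_mono) (use B \<omega> in blast)
    finally show "(op_norm (prd n \<omega>))\<^sup>2 \<le> real N * exp (real n * (\<mu> + \<delta>))" by simp
  next
    show "(\<Union>j<N. B j) \<in> events" by (rule sets.finite_UN) (use B in blast)+
  qed
qed

end

section \<open>The upper bound in large dimension\<close>

lemma measurable_entry_gauss: "k < N \<Longrightarrow> (\<lambda>g. g k) \<in> borel_measurable (gauss N)"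
  using gauss_linear_form_measurable[of "unitf k" N 1] 
  by (simp add: unitf_def if_distrib[of "\<lambda>x. x * _"] cong: if_cong)

context isotropic_product
begin

lemma prd_meas: "(\<lambda>\<omega>. prd n \<omega>) \<in> measurable M (borel_mat N)"
  by (rule measurable_mat_prod) (simp add: X_meas)

lemma S_X_meas [measurable]: "i \<ge> 1 \<Longrightarrow> (\<lambda>\<omega>. S (X i \<omega>)) \<in> borel_measurable M"
  by (rule measurable_compose[OF X_meas S_meas])

text \<open>For fixed g the ratio is |g|^(2k) times a product of step statistics (fst / snd)^k.
  These are independent and distributed as z^k, so the expectation factorises.\<close>

lemma power_expectation:
  assumes r: "sqn N g > 0"
  shows "(\<integral>\<^sup>+\<omega>. ennreal (sqn N (mulv N (prd n \<omega>) g) ^ k / (\<Prod>i=1..n. S (X i \<omega>)) ^ k) \<partial>M) =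
    ennreal (sqn N g ^ k) * (\<integral>\<^sup>+\<omega>. ennreal (z \<omega> ^ k) \<partial>M) ^ n"
proof -
  define f where "f l = 1 / sqrt (sqn N g) * g l" for l
  have f: "sqn N f = 1" unfolding f_def[abs_def] sqn_scale using r by (simp add: power_divide)
  have gf: "g = (\<lambda>l. sqrt (sqn N g) * f l)" using r by (simp add: f_def)
  let ?G = "\<lambda>x :: real \<times> real. (fst x / snd x) ^ k"
  have Gm: "?G \<in> borel_measurable borel" unfolding borel_prod[symmetric] by measurable
  let ?Y = "\<lambda>i \<omega>. step_stat N ?G S f (\<lambda>i. X i \<omega>) i"
  have Y0: "0 \<le> ?Y i \<omega>" for i \<omega> by (simp add: step_stat_def S_nonneg)
  have eq: "sqn N (mulv N (prd n \<omega>) g) ^ k / (\<Prod>i=1..n. S (X i \<omega>)) ^ k = sqn N g ^ k * (\<Prod>i=1..n. ?Y i \<omega>)"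
    if "\<omega> \<in> space M" for \<omega>
  proof -
    have "sqn N (mulv N (prd n \<omega>) g) = sqn N g * sqn N (mulv N (prd n \<omega>) f)"
      using r by (subst gf) (simp add: sqn_mulv_scale)
    also have "sqn N (mulv N (prd n \<omega>) f) = (\<Prod>i=1..n. sqn N (mulv N (X i \<omega>) (direction N f (prd (i - 1) \<omega>))))"
      by (rule sqn_mulv_mat_prod(2)[OF _ f]) (rule X_carrier, use that in simp_all)
    finally show ?thesis
      by (simp add: step_stat_def prod_dividef prod_power_distrib[symmetric] power_mult_distrib power_divide)
  qed
  have ind': "indep_vars (\<lambda>_. borel) (\<lambda>i \<omega>. ennreal (?Y i \<omega>)) {1..n}"
    by (rule indep_vars_compose2[OF indep_vars_subset[OF steps(1)[OF Gm f]]]) auto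
  have E: "(\<integral>\<^sup>+\<omega>. ennreal (?Y i \<omega>) \<partial>M) = (\<integral>\<^sup>+\<omega>. ennreal (z \<omega> ^ k) \<partial>M)" if i: "i \<ge> 1" for i
  proof -
    have m: "(\<lambda>\<omega>. ?G (q \<omega>, s \<omega>)) \<in> borel_measurable M"
      by (rule measurable_compose[OF borel_measurable_Pair[OF q_meas s_meas] Gm])
    have "(\<integral>\<^sup>+\<omega>. ennreal (?Y i \<omega>) \<partial>M) = (\<integral>\<^sup>+x. ennreal x \<partial>distr M borel (?Y i))"
      by (rule nn_integral_distr[symmetric]) (use step_meas[OF Gm f i] in auto)
    also have "\<dots> = (\<integral>\<^sup>+\<omega>. ennreal (?G (q \<omega>, s \<omega>)) \<partial>M)"
      unfolding steps(2)[OF Gm f i] by (rule nn_integral_distr) (use m in auto)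
    finally show ?thesis by (simp add: z_def)
  qed
  have "(\<integral>\<^sup>+\<omega>. ennreal (sqn N (mulv N (prd n \<omega>) g) ^ k / (\<Prod>i=1..n. S (X i \<omega>)) ^ k) \<partial>M) =
     (\<integral>\<^sup>+\<omega>. ennreal (sqn N g ^ k) * (\<Prod>i=1..n. ennreal (?Y i \<omega>)) \<partial>M)"
  proof (rule nn_integral_cong)
    fix \<omega> assume "\<omega> \<in> space M"
    show "ennreal (sqn N (mulv N (prd n \<omega>) g) ^ k / (\<Prod>i=1..n. S (X i \<omega>)) ^ k) =
      ennreal (sqn N g ^ k) * (\<Prod>i=1..n. ennreal (?Y i \<omega>))"
      unfolding eq[OF \<open>\<omega> \<in> space M\<close>] prod_ennreal[OF Y0] by (rule ennreal_mult') (simp add: prod_nonneg Y0)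
  qed
  also have "\<dots> = ennreal (sqn N g ^ k) * (\<integral>\<^sup>+\<omega>. (\<Prod>i=1..n. ennreal (?Y i \<omega>)) \<partial>M)"
  proof (rule nn_integral_cmult)
    show "(\<lambda>\<omega>. \<Prod>i=1..n. ennreal (?Y i \<omega>)) \<in> borel_measurable M"
    proof (rule borel_measurable_prod_ennreal)
      fix i assume "i \<in> {1..n}"
      then have "i \<ge> 1" by simp
      from step_meas[OF Gm f this] show "(\<lambda>\<omega>. ennreal (?Y i \<omega>)) \<in> borel_measurable M" by measurable
    qed
  qed
  also have "(\<integral>\<^sup>+\<omega>. (\<Prod>i=1..n. ennreal (?Y i \<omega>)) \<partial>M) = (\<Prod>i=1..n. \<integral>\<^sup>+\<omega>. ennreal (?Y i \<omega>) \<partial>M)"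
    by (rule indep_vars_nn_integral[OF _ ind']) auto
  also have "\<dots> = (\<Prod>i=1..n. \<integral>\<^sup>+\<omega>. ennreal (z \<omega> ^ k) \<partial>M)"
    by (rule prod.cong[OF refl], rule E) simp
  finally show ?thesis by simp
qed

text \<open>Of the 3 \<delta> in the exponent, 2 \<delta> come from Markov's inequality for the
  normalised product and \<delta> from Chebyshev's inequality for the sum of ln S.\<close>

lemma op_norm_upper_large:
  assumes n: "n \<ge> 1" and k: "k \<ge> 1" and \<delta>: "\<delta> > 0"
    and Zk: "(\<integral>\<^sup>+\<omega>. ennreal (z \<omega> ^ k) \<partial>M) \<le> ennreal (exp (real k * \<delta>))"
  shows "\<exists>B\<in>events. prob B \<le> 4 ^ k * sqrt 2 ^ N * exp (- (real n * real k * \<delta>)) +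
      variance (\<lambda>\<omega>. ln (s \<omega>)) / (real n * \<delta>\<^sup>2) \<and>
    (\<forall>\<omega>\<in>space M - B. (op_norm (prd n \<omega>))\<^sup>2 \<le> exp (real n * (expectation (\<lambda>\<omega>. ln (s \<omega>)) + 3 * \<delta>)))"
proof -
  interpret G: prob_space "gauss N" by (rule prob_space_gauss)
  interpret MG: pair_sigma_finite M "gauss N" ..
  let ?D = "\<lambda>\<omega>. \<Prod>i=1..n. S (X i \<omega>)"
  let ?R = "\<lambda>\<omega> g. ennreal (sqn N (mulv N (prd n \<omega>) g) ^ k / ?D \<omega> ^ k)"
  let ?T = "fact k * 4 ^ k * sqrt 2 ^ N :: real"
  \<comment> \<open>\<open>J\<close> averages over the Gaussian vector for a fixed sample of
    matrices. Its mean is bounded by exchanging the integrals, since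
    \<open>power_expectation\<close> applies to each fixed g.\<close>
  define J where "J \<omega> = (\<integral>\<^sup>+g. ?R \<omega> g \<partial>gauss N)" for \<omega>
  have Dm: "?D \<in> borel_measurable M" by (rule borel_measurable_prod) simp
  have Rm: "(\<lambda>(\<omega>, g). ?R \<omega> g) \<in> borel_measurable (M \<Otimes>\<^sub>M gauss N)"
  proof -
    have "(\<lambda>x. prd n (fst x) $$ (j, l)) \<in> borel_measurable (M \<Otimes>\<^sub>M gauss N)" if "j < N" "l < N" for j l
      by (rule measurable_compose[OF measurable_fst measurable_compose[OF prd_meas measurable_entry[OF that]]])
    moreover have "(\<lambda>x. snd x l) \<in> borel_measurable (M \<Otimes>\<^sub>M gauss N)" if "l < N" for l
      by (rule measurable_compose[OF measurable_snd measurable_entry_gauss[OF that]])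
    ultimately have "(\<lambda>x. sqn N (mulv N (prd n (fst x)) (snd x))) \<in> borel_measurable (M \<Otimes>\<^sub>M gauss N)"
      unfolding sqn_def mulv_def
      by (intro borel_measurable_sum borel_measurable_power borel_measurable_times) simp_all
    moreover have "(\<lambda>x. ?D (fst x)) \<in> borel_measurable (M \<Otimes>\<^sub>M gauss N)"
      by (rule measurable_compose[OF measurable_fst Dm])
    ultimately show ?thesis unfolding case_prod_beta' by measurable
  qed
  have Jm: "J \<in> borel_measurable M"
    unfolding J_def by (rule G.borel_measurable_nn_integral[OF Rm])
  have "(\<integral>\<^sup>+\<omega>. J \<omega> \<partial>M) = (\<integral>\<^sup>+g. (\<integral>\<^sup>+\<omega>. ?R \<omega> g \<partial>M) \<partial>gauss N)"
    unfolding J_def by (rule MG.Fubini'[OF Rm, symmetric])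
  also have "\<dots> \<le> (\<integral>\<^sup>+g. ennreal (sqn N g ^ k) * ennreal (exp (real k * \<delta>)) ^ n \<partial>gauss N)"
  proof (rule nn_integral_mono)
    fix g
    show "(\<integral>\<^sup>+\<omega>. ?R \<omega> g \<partial>M) \<le> ennreal (sqn N g ^ k) * ennreal (exp (real k * \<delta>)) ^ n"
    proof (cases "sqn N g > 0")
      case True
      show ?thesis unfolding power_expectation[OF True]
        by (intro mult_left_mono power_mono Zk) auto
    next
      case False
      then have "sqn N g = 0" using sqn_nonneg[of N g] by linarith
      then show ?thesis using k by (simp add: sqn_mulv_zero power_0_left)
    qed
  qed
  also have "\<dots> = (\<integral>\<^sup>+g. ennreal (sqn N g ^ k) \<partial>gauss N) * ennreal (exp (real k * \<delta>)) ^ n"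
  proof (rule nn_integral_multc)
    have "(\<lambda>g. sqn N g) \<in> borel_measurable (gauss N)"
      unfolding sqn_def by (intro borel_measurable_sum borel_measurable_power measurable_entry_gauss) simp
    then show "(\<lambda>g. ennreal (sqn N g ^ k)) \<in> borel_measurable (gauss N)" by measurable
  qed
  also have "\<dots> \<le> ennreal ?T * ennreal (exp (real k * \<delta>)) ^ n"
    by (intro mult_right_mono nn_integral_gauss_sqn_power) simp
  also have "\<dots> = ennreal (?T * exp (real n * real k * \<delta>))"
    by (simp add: ennreal_power ennreal_mult'[symmetric] exp_of_nat_mult[symmetric] mult.assoc)
  finally have EJ: "(\<integral>\<^sup>+\<omega>. J \<omega> \<partial>M) \<le> ennreal (?T * exp (real n * real k * \<delta>))" .
  \<comment> \<open>The level exceeds the bound for the mean of \<open>J\<close> by exp (n k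
    \<delta>), up to 4^k 2^(N/2), and carries the factorial that \<open>op_norm_sq_le_gauss\<close>
    needs.\<close>
  define c where "c = fact k * exp (2 * real n * real k * \<delta>)"
  have c: "c > 0" by (simp add: c_def)
  let ?B1 = "{\<omega> \<in> space M. 1 \<le> ennreal (1 / c) * J \<omega>}"
  have B1m: "?B1 \<in> events" using Jm by measurable
  have "emeasure M ?B1 \<le> ennreal (1 / c) * (\<integral>\<^sup>+\<omega>. J \<omega> * indicator (space M) \<omega> \<partial>M)"
    by (rule nn_integral_Markov_inequality) (use Jm in measurable)
  also have "(\<integral>\<^sup>+\<omega>. J \<omega> * indicator (space M) \<omega> \<partial>M) = (\<integral>\<^sup>+\<omega>. J \<omega> \<partial>M)"
    by (rule nn_integral_cong) simp
  also have "ennreal (1 / c) * (\<integral>\<^sup>+\<omega>. J \<omega> \<partial>M) \<le> ennreal (1 / c) * ennreal (?T * exp (real n * real k * \<delta>))"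
    by (intro mult_left_mono EJ) simp
  also have "\<dots> = ennreal (1 / c * (?T * exp (real n * real k * \<delta>)))"
    using c by (simp add: ennreal_mult'[symmetric])
  also have "1 / c * (?T * exp (real n * real k * \<delta>)) = 4 ^ k * sqrt 2 ^ N * exp (- (real n * real k * \<delta>))"
  proof -
    have "exp (2 * real n * real k * \<delta>) = exp (real n * real k * \<delta>) * exp (real n * real k * \<delta>)"
      by (simp add: exp_add[symmetric])
    then show ?thesis by (simp add: c_def exp_minus field_simps)
  qed
  finally have B1: "prob ?B1 \<le> 4 ^ k * sqrt 2 ^ N * exp (- (real n * real k * \<delta>))"
    by (simp add: emeasure_eq_measure)
  have f: "sqn N (unitf 0) = 1" using N1 by (intro sqn_unitf) simp
  have Gm: "(\<lambda>x. ln (snd x)) \<in> borel_measurable (borel :: (real \<times> real) measure)"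
    and Fm: "snd \<in> borel_measurable (borel :: (real \<times> real) measure)"
    unfolding borel_prod[symmetric] by measurable
  let ?B2 = "{\<omega> \<in> space M. \<bar>(\<Sum>i=1..n. ln (S (X i \<omega>))) - real n * expectation (\<lambda>\<omega>. ln (s \<omega>))\<bar> \<ge> real n * \<delta>}"
  have B2: "?B2 \<in> events" "prob ?B2 \<le> variance (\<lambda>\<omega>. ln (s \<omega>)) / (real n * \<delta>\<^sup>2)"
    using iid_sum_deviation[OF steps(1)[OF Gm f] integrable_ln(1,2) _ n \<delta>] steps(2)[OF Gm f]
    by (simp_all add: step_stat_def)
  have "AE \<omega> in M. 0 < S (X i \<omega>)" if "i \<ge> 1" for i
    using AE_step[OF Fm f that, of "\<lambda>x. 0 < x"] AE_qs by (simp add: step_stat_def)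
  then have "AE \<omega> in M. \<forall>i\<in>{1..n}. 0 < S (X i \<omega>)" by (simp add: AE_finite_all)
  then obtain E where E: "{\<omega> \<in> space M. \<not> (\<forall>i\<in>{1..n}. 0 < S (X i \<omega>))} \<subseteq> E" "E \<in> events" "emeasure M E = 0"
    by (rule AE_E)
  show ?thesis
  proof (intro bexI[of _ "(?B1 \<union> ?B2) \<union> E"] conjI ballI)
    have "prob ((?B1 \<union> ?B2) \<union> E) = prob (?B1 \<union> ?B2)"
      by (rule measure_Un_null_set[OF sets.Un[OF B1m B2(1)] null_setsI[OF E(3,2)]])
    also have "\<dots> \<le> prob ?B1 + prob ?B2" using B1m B2(1) by (rule measure_Un_le)
    finally show "prob ((?B1 \<union> ?B2) \<union> E) \<le> 4 ^ k * sqrt 2 ^ N * exp (- (real n * real k * \<delta>)) +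
      variance (\<lambda>\<omega>. ln (s \<omega>)) / (real n * \<delta>\<^sup>2)" using B1 B2(2) by linarith
    show "(?B1 \<union> ?B2) \<union> E \<in> events" using B1m B2(1) E(2) by (intro sets.Un)
    fix \<omega> assume \<omega>: "\<omega> \<in> space M - ((?B1 \<union> ?B2) \<union> E)"
    then have pos: "\<And>i. i \<in> {1..n} \<Longrightarrow> 0 < S (X i \<omega>)" using E(1) by blast
    have D: "?D \<omega> > 0" by (rule prod_pos) (rule pos)
    have carr: "prd n \<omega> \<in> carrier_mat N N" using \<omega> prd_carrier by simp
    have "ennreal (1 / c) * J \<omega> \<le> 1" using \<omega> by auto
    then have "ennreal c * (ennreal (1 / c) * J \<omega>) \<le> ennreal c * 1" by (intro mult_left_mono) auto
    moreover have "ennreal c * (ennreal (1 / c) * J \<omega>) = J \<omega>"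
      using c by (simp add: mult.assoc[symmetric] ennreal_mult'[symmetric])
    ultimately have Jc: "J \<omega> \<le> ennreal c" by simp
    \<comment> \<open>The normalisation is undone here: off E the product of the S is positive and
      can be multiplied back.\<close>
    have "(\<integral>\<^sup>+g. ennreal (sqn N (mulv N (prd n \<omega>) g) ^ k) \<partial>gauss N) =
      (\<integral>\<^sup>+g. ennreal (?D \<omega> ^ k) * ?R \<omega> g \<partial>gauss N)"
    proof (rule nn_integral_cong)
      fix g
      have "ennreal (?D \<omega> ^ k) * ?R \<omega> g = ennreal (?D \<omega> ^ k * (sqn N (mulv N (prd n \<omega>) g) ^ k / ?D \<omega> ^ k))"
        by (rule ennreal_mult[symmetric]) (use D in simp_all)
      then show "ennreal (sqn N (mulv N (prd n \<omega>) g) ^ k) = ennreal (?D \<omega> ^ k) * ?R \<omega> g"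
        using less_imp_neq[OF D] by (metis (no_types, lifting) nonzero_mult_div_cancel_left power_not_zero times_divide_eq_right)
    qed
    also have "\<dots> = ennreal (?D \<omega> ^ k) * J \<omega>"
      unfolding J_def using measurable_compose[OF measurable_Pair1'[of \<omega> M] Rm] \<omega>
      by (intro nn_integral_cmult) simp
    also have "\<dots> \<le> ennreal (?D \<omega> ^ k) * ennreal c" by (intro mult_left_mono Jc) simp
    also have "\<dots> = ennreal (fact k * (exp (2 * real n * \<delta>) * ?D \<omega>) ^ k)"
      using D by (simp add: ennreal_mult'[symmetric] c_def power_mult_distrib exp_of_nat_mult[symmetric] mult_ac)
    finally have "(op_norm (prd n \<omega>))\<^sup>2 \<le> exp (2 * real n * \<delta>) * ?D \<omega>"
      using D by (intro op_norm_sq_le_gauss[OF carr _ N1 k]) auto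
    also have "?D \<omega> = exp (\<Sum>i=1..n. ln (S (X i \<omega>)))"
      unfolding exp_sum[OF finite_atLeastAtMost] by (rule prod.cong) (use pos in simp_all)
    also have "(\<Sum>i=1..n. ln (S (X i \<omega>))) \<le> real n * expectation (\<lambda>\<omega>. ln (s \<omega>)) + real n * \<delta>"
      using \<omega> by auto
    finally have "(op_norm (prd n \<omega>))\<^sup>2 \<le> exp (2 * real n * \<delta>) * exp (real n * expectation (\<lambda>\<omega>. ln (s \<omega>)) + real n * \<delta>)"
      by simp
    also have "\<dots> = exp (real n * (expectation (\<lambda>\<omega>. ln (s \<omega>)) + 3 * \<delta>))"
      by (simp add: exp_add[symmetric] algebra_simps)
    finally show "(op_norm (prd n \<omega>))\<^sup>2 \<le> exp (real n * (expectation (\<lambda>\<omega>. ln (s \<omega>)) + 3 * \<delta>))" .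
  qed
qed

end

section \<open>Single unit vectors and the combined deviation bound\<close>

context isotropic_product
begin

lemma unit_vector_law:
  assumes h: "sqn N h = 1"
  shows "AE \<omega> in M. 0 < sqn N (mulv N (X 1 \<omega>) h)"
    and "integrable M (\<lambda>\<omega>. ln (sqn N (mulv N (X 1 \<omega>) h)))"
    and "expectation (\<lambda>\<omega>. ln (sqn N (mulv N (X 1 \<omega>) h))) = \<mu>"
proof -
  have Fm: "fst \<in> borel_measurable (borel :: (real \<times> real) measure)"
    unfolding borel_prod[symmetric] by measurable
  have m: "(\<lambda>\<omega>. sqn N (mulv N (X 1 \<omega>) h)) \<in> borel_measurable M"
    by (rule measurable_compose[OF X_meas measurable_sqn_mulv]) simp
  have d: "distr M borel (\<lambda>\<omega>. sqn N (mulv N (X 1 \<omega>) h)) = distr M borel q"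
    using law[OF Fm order_refl h] by simp
  have "AE \<omega> in M. 0 < q \<omega>" using AE_qs by eventually_elim simp
  then have "AE x in distr M borel q. 0 < x" by (subst AE_distr_iff) auto
  then show "AE \<omega> in M. 0 < sqn N (mulv N (X 1 \<omega>) h)"
    unfolding d[symmetric] by (subst (asm) AE_distr_iff) (use m in auto)
  show "integrable M (\<lambda>\<omega>. ln (sqn N (mulv N (X 1 \<omega>) h)))"
    using integrable_distr_eq[OF m borel_measurable_ln[OF measurable_ident]]
      integrable_distr_eq[OF q_meas borel_measurable_ln[OF measurable_ident]] integrable_ln(5) d by simp
  show "expectation (\<lambda>\<omega>. ln (sqn N (mulv N (X 1 \<omega>) h))) = \<mu>"
    using integral_distr[OF m borel_measurable_ln[OF measurable_ident]]
      integral_distr[OF q_meas borel_measurable_ln[OF measurable_ident]] d by (simp add: \<mu>_def)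
qed

lemma unit_vector_norm:
  assumes v: "v \<in> carrier_vec N" "euclid_norm v = 1"
  shows "log_mean_exists M (\<lambda>\<omega>. euclid_norm (X 1 \<omega> *\<^sub>v v))"
    and "expectation (\<lambda>\<omega>. ln (euclid_norm (X 1 \<omega> *\<^sub>v v))) = \<mu> / 2"
proof -
  have h: "sqn N (($) v) = 1" using v euclid_norm_eq[OF v(1)] by simp
  have e: "euclid_norm (X 1 \<omega> *\<^sub>v v) = sqrt (sqn N (mulv N (X 1 \<omega>) (($) v)))" if "\<omega> \<in> space M" for \<omega>
    by (rule euclid_norm_mult_mat_vec[OF X_carrier v(1)]) (use that in auto)
  have l: "AE \<omega> in M. 0 < euclid_norm (X 1 \<omega> *\<^sub>v v) \<and>
      ln (euclid_norm (X 1 \<omega> *\<^sub>v v)) = ln (sqn N (mulv N (X 1 \<omega>) (($) v))) / 2"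
    using unit_vector_law(1)[OF h] AE_space by eventually_elim (simp add: e ln_sqrt del: One_nat_def)
  have m: "(\<lambda>\<omega>. ln (euclid_norm (X 1 \<omega> *\<^sub>v v))) \<in> borel_measurable M"
  proof -
    have "(\<lambda>\<omega>. ln (sqrt (sqn N (mulv N (X 1 \<omega>) (($) v))))) \<in> borel_measurable M"
      by (intro borel_measurable_ln measurable_compose[OF _ borel_measurable_sqrt]
          measurable_compose[OF X_meas measurable_sqn_mulv]) simp
    then show ?thesis by (rule measurable_cong[THEN iffD1, rotated]) (simp add: e del: One_nat_def)
  qed
  have i: "integrable M (\<lambda>\<omega>. ln (sqn N (mulv N (X 1 \<omega>) (($) v))) / 2)" using unit_vector_law(2)[OF h] by simp
  have "integrable M (\<lambda>\<omega>. ln (euclid_norm (X 1 \<omega> *\<^sub>v v)))"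
    by (rule integrable_cong_AE_imp[OF i m]) (use l in \<open>eventually_elim, simp\<close>)
  moreover have "AE \<omega> in M. 0 < euclid_norm (X 1 \<omega> *\<^sub>v v)" using l by eventually_elim simp
  ultimately show "log_mean_exists M (\<lambda>\<omega>. euclid_norm (X 1 \<omega> *\<^sub>v v))" by (simp add: log_mean_exists_def)
  have "expectation (\<lambda>\<omega>. ln (euclid_norm (X 1 \<omega> *\<^sub>v v))) = expectation (\<lambda>\<omega>. ln (sqn N (mulv N (X 1 \<omega>) (($) v))) / 2)"
    by (rule integral_cong_AE[OF m]) (use i l in \<open>auto elim: eventually_mono\<close>)
  then show "expectation (\<lambda>\<omega>. ln (euclid_norm (X 1 \<omega> *\<^sub>v v))) = \<mu> / 2"
    using unit_vector_law(3)[OF h] by simp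
qed

text \<open>Halving logarithms of squared norms turns the bounds \<mu> - \<delta> and \<mu> + 4
  \<delta> into a distance of at most 2 \<delta> from \<mu> / 2, inside 4 \<delta>. The upper bound
  is a hypothesis because it has different proofs for small and for large N.\<close>

lemma deviation:
  assumes n: "n \<ge> 1" and \<delta>: "\<delta> > 0" and v: "v \<in> carrier_vec N" "euclid_norm v = 1"
    and upper: "\<exists>B\<in>events. prob B \<le> b \<and> (\<forall>\<omega>\<in>space M - B. (op_norm (prd n \<omega>))\<^sup>2 \<le> exp (real n * (\<mu> + 4 * \<delta>)))"
  shows "prob {\<omega> \<in> space M. \<bar>ln (op_norm (prd n \<omega>)) / real n
      - expectation (\<lambda>\<omega>. ln (euclid_norm (X 1 \<omega> *\<^sub>v v)))\<bar> \<ge> 4 * \<delta>}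
    \<le> variance (\<lambda>\<omega>. ln (q \<omega>)) / (real n * \<delta>\<^sup>2) + b"
proof -
  obtain A where A: "A \<in> events" "prob A \<le> variance (\<lambda>\<omega>. ln (q \<omega>)) / (real n * \<delta>\<^sup>2)"
    and low: "\<And>\<omega>. \<omega> \<in> space M - A \<Longrightarrow> 0 < op_norm (prd n \<omega>) \<and> ln ((op_norm (prd n \<omega>))\<^sup>2) > real n * (\<mu> - \<delta>)"
    using op_norm_lower[OF n \<delta>] by blast
  obtain B where B: "B \<in> events" "prob B \<le> b"
    and up: "\<And>\<omega>. \<omega> \<in> space M - B \<Longrightarrow> (op_norm (prd n \<omega>))\<^sup>2 \<le> exp (real n * (\<mu> + 4 * \<delta>))"
    using upper by blast
  let ?S = "{\<omega> \<in> space M. \<bar>ln (op_norm (prd n \<omega>)) / real n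
      - expectation (\<lambda>\<omega>. ln (euclid_norm (X 1 \<omega> *\<^sub>v v)))\<bar> \<ge> 4 * \<delta>}"
  have "?S \<subseteq> A \<union> B"
  proof
    fix \<omega> assume \<omega>: "\<omega> \<in> ?S"
    show "\<omega> \<in> A \<union> B"
    proof (rule ccontr)
      assume "\<omega> \<notin> A \<union> B"
      then have a: "\<omega> \<in> space M - A" and b: "\<omega> \<in> space M - B" using \<omega> by auto
      let ?o = "op_norm (prd n \<omega>)"
      have o: "?o > 0" using low[OF a] by simp
      have l2: "ln (?o\<^sup>2) = 2 * ln ?o" using o by (simp add: ln_realpow)
      have "ln (?o\<^sup>2) \<le> ln (exp (real n * (\<mu> + 4 * \<delta>)))" using up[OF b] o by (intro ln_mono) auto
      then have u: "2 * ln ?o \<le> real n * (\<mu> + 4 * \<delta>)" by (simp add: l2)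
      have l: "real n * (\<mu> - \<delta>) < 2 * ln ?o" using low[OF a] by (simp add: l2)
      have "ln ?o / real n \<le> (\<mu> + 4 * \<delta>) / 2" using u n by (simp add: field_simps)
      moreover have "ln ?o / real n > (\<mu> - \<delta>) / 2" using l n by (simp add: field_simps)
      ultimately have "\<bar>ln ?o / real n - \<mu> / 2\<bar> < 4 * \<delta>" using \<delta> by (simp add: abs_less_iff field_simps)
      then show False using \<omega> unfolding unit_vector_norm(2)[OF v] by simp
    qed
  qed
  then have "prob ?S \<le> prob (A \<union> B)" using A B by (intro finite_measure_mono) auto
  also have "\<dots> \<le> prob A + prob B" using A(1) B(1) by (rule measure_Un_le)
  finally show ?thesis using A B by linarith
qed

end

section \<open>Uniformity in the dimension\<close>

lemma eventually_divide_le: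
  fixes a e :: real
  assumes "e > 0"
  shows "eventually (\<lambda>n. a / real n \<le> e) sequentially"
proof -
  have "eventually (\<lambda>n. a / real n < e) sequentially"
    by (rule order_tendstoD(2)[OF lim_const_over_n assms])
  then show ?thesis by eventually_elim simp
qed

text \<open>This is the conclusion of the theorem, named so that both alternatives reduce to one
  criterion.\<close>

definition uniform_growth ::
    "(nat \<Rightarrow> 'a measure) \<Rightarrow> (nat \<Rightarrow> nat \<Rightarrow> 'a \<Rightarrow> real Matrix.mat) \<Rightarrow> bool" where
  "uniform_growth M X \<longleftrightarrow>
    (\<forall>N\<ge>1. \<forall>v\<in>carrier_vec N. euclid_norm v = 1 \<longrightarrow>
        log_mean_exists (M N) (\<lambda>\<omega>. euclid_norm (X N 1 \<omega> *\<^sub>v v))) \<and>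
     (\<forall>\<delta>>0. \<exists>n0. \<forall>n\<ge>n0. \<forall>N\<ge>1. \<forall>v\<in>carrier_vec N. euclid_norm v = 1 \<longrightarrow>
        measure (M N) {\<omega> \<in> space (M N).
          \<bar>ln (op_norm (mat_prod N (\<lambda>i. X N i \<omega>) n)) / real n
            - prob_space.expectation (M N) (\<lambda>\<omega>. ln (euclid_norm (X N 1 \<omega> *\<^sub>v v)))\<bar> \<ge> \<delta>} \<le> \<delta>)"

text \<open>Below N0 the column bound is used, from N0 on the k-th moment with k at least N / C. The
  latter bound is centred at the mean of ln s; since \<mu> is the sum of the means of ln s and ln z,
  the lower bound - \<delta> for the mean of ln z restores the centring at \<mu>.\<close>

lemma uniform_deviation:
  fixes M :: "nat \<Rightarrow> 'a measure" and X :: "nat \<Rightarrow> nat \<Rightarrow> 'a \<Rightarrow> real Matrix.mat" and S :: "nat \<Rightarrow> real Matrix.mat \<Rightarrow> real"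
  assumes iso: "\<And>N. N \<ge> 1 \<Longrightarrow> isotropic_product (M N) N (X N) (S N)"
    and K1: "\<And>N. N \<ge> 1 \<Longrightarrow> prob_space.expectation (M N)
      (\<lambda>\<omega>. (ln (sqn N (mulv N (X N 1 \<omega>) (unitf 0)) / S N (X N 1 \<omega>)))\<^sup>2) \<le> K1"
    and K2: "\<And>N. N \<ge> 1 \<Longrightarrow> prob_space.variance (M N) (\<lambda>\<omega>. ln (S N (X N 1 \<omega>))) \<le> K2"
    and large: "\<And>\<delta>. \<delta> > 0 \<Longrightarrow> \<exists>N0 C. \<forall>N\<ge>N0. N \<ge> 1 \<longrightarrow>
      prob_space.expectation (M N) (\<lambda>\<omega>. ln (sqn N (mulv N (X N 1 \<omega>) (unitf 0)) / S N (X N 1 \<omega>))) \<ge> - \<delta> \<and>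
      (\<exists>k\<ge>1. N \<le> C * k \<and>
        (\<integral>\<^sup>+\<omega>. ennreal ((sqn N (mulv N (X N 1 \<omega>) (unitf 0)) / S N (X N 1 \<omega>)) ^ k) \<partial>M N) \<le> ennreal (exp (real k * \<delta>)))"
  shows "uniform_growth M X"
  unfolding uniform_growth_def
proof (intro conjI allI ballI impI)
  fix N v assume "N \<ge> (1::nat)" "v \<in> carrier_vec N" "euclid_norm v = 1"
  then show "log_mean_exists (M N) (\<lambda>\<omega>. euclid_norm (X N 1 \<omega> *\<^sub>v v))"
    by (intro isotropic_product.unit_vector_norm(1)[OF iso])
next
  fix \<epsilon> :: real assume \<epsilon>: "\<epsilon> > 0"
  define \<delta> where "\<delta> = \<epsilon> / 4"
  have \<delta>: "\<delta> > 0" using \<epsilon> by (simp add: \<delta>_def)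
  obtain N0 C where L: "\<And>N. N \<ge> N0 \<Longrightarrow> N \<ge> 1 \<Longrightarrow>
      prob_space.expectation (M N) (\<lambda>\<omega>. ln (sqn N (mulv N (X N 1 \<omega>) (unitf 0)) / S N (X N 1 \<omega>))) \<ge> - \<delta> \<and>
      (\<exists>k\<ge>1. N \<le> C * k \<and>
        (\<integral>\<^sup>+\<omega>. ennreal ((sqn N (mulv N (X N 1 \<omega>) (unitf 0)) / S N (X N 1 \<omega>)) ^ k) \<partial>M N) \<le> ennreal (exp (real k * \<delta>)))"
    using large[OF \<delta>] by blast
  define K where "K = 2 * K2 + 2 * K1"
  \<comment> \<open>If N \<le> C k, then R^k dominates 4^k 2^(N/2).\<close>
  define R where "R = (4 * 2 ^ C :: real)"
  \<comment> \<open>These conditions on n involve N0, K, K2 and R but not N; this secures the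
    uniformity.\<close>
  have "eventually (\<lambda>n. n \<ge> 1 \<and> (K / \<delta>\<^sup>2) / real n \<le> \<delta> \<and> (real N0 * K / \<delta>\<^sup>2) / real n \<le> \<delta> \<and>
      ln (real N0 + 1) / real n \<le> \<delta> \<and> (R / \<delta>) / real n \<le> min 1 \<delta> \<and> (K2 / \<delta>\<^sup>2) / real n \<le> \<delta>) sequentially"
    using \<delta> by (intro eventually_conj eventually_ge_at_top eventually_divide_le) auto
  then obtain n0 where n0: "\<And>n. n \<ge> n0 \<Longrightarrow> n \<ge> 1 \<and> (K / \<delta>\<^sup>2) / real n \<le> \<delta> \<and> (real N0 * K / \<delta>\<^sup>2) / real n \<le> \<delta> \<and>
      ln (real N0 + 1) / real n \<le> \<delta> \<and> (R / \<delta>) / real n \<le> min 1 \<delta> \<and> (K2 / \<delta>\<^sup>2) / real n \<le> \<delta>"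
    unfolding eventually_sequentially by blast
  show "\<exists>n0. \<forall>n\<ge>n0. \<forall>N\<ge>1. \<forall>v\<in>carrier_vec N. euclid_norm v = 1 \<longrightarrow>
        measure (M N) {\<omega> \<in> space (M N).
          \<bar>ln (op_norm (mat_prod N (\<lambda>i. X N i \<omega>) n)) / real n
            - prob_space.expectation (M N) (\<lambda>\<omega>. ln (euclid_norm (X N 1 \<omega> *\<^sub>v v)))\<bar> \<ge> \<epsilon>} \<le> \<epsilon>"
  proof (intro exI[of _ n0] allI ballI impI)
    fix n N v assume nn: "n \<ge> n0" and N: "N \<ge> (1::nat)" and v: "v \<in> carrier_vec N" "euclid_norm v = 1"
    have n: "n \<ge> 1" "(K / \<delta>\<^sup>2) / real n \<le> \<delta>" "(real N0 * K / \<delta>\<^sup>2) / real n \<le> \<delta>"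
      "ln (real N0 + 1) / real n \<le> \<delta>" "(R / \<delta>) / real n \<le> 1" "(R / \<delta>) / real n \<le> \<delta>" "(K2 / \<delta>\<^sup>2) / real n \<le> \<delta>"
      using n0[OF nn] by simp_all
    interpret isotropic_product "M N" N "X N" "S N" by (rule iso[OF N])
    have vs: "variance (\<lambda>\<omega>. ln (s \<omega>)) \<le> K2" using K2[OF N] by (simp add: s_def)
    have ez: "expectation (\<lambda>\<omega>. (ln (z \<omega>))\<^sup>2) \<le> K1" using K1[OF N] by (simp add: z_def q_def s_def)
    have vq: "variance (\<lambda>\<omega>. ln (q \<omega>)) \<le> K" using variance_ln_q vs ez unfolding K_def by linarith
    have vq0: "0 \<le> variance (\<lambda>\<omega>. ln (q \<omega>))" by (rule variance_positive)
    have d0: "0 < real n * \<delta>\<^sup>2" using n(1) \<delta> by simp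
    have bq: "variance (\<lambda>\<omega>. ln (q \<omega>)) / (real n * \<delta>\<^sup>2) \<le> \<delta>"
    proof -
      have "variance (\<lambda>\<omega>. ln (q \<omega>)) / (real n * \<delta>\<^sup>2) \<le> K / (real n * \<delta>\<^sup>2)"
        using vq d0 by (intro divide_right_mono) auto
      also have "\<dots> = (K / \<delta>\<^sup>2) / real n" by simp
      finally show ?thesis using n(2) by simp
    qed
    have upper: "\<exists>B\<in>events. prob B \<le> 2 * \<delta> \<and> (\<forall>\<omega>\<in>space (M N) - B. (op_norm (prd n \<omega>))\<^sup>2 \<le> exp (real n * (\<mu> + 4 * \<delta>)))"
    proof (cases "N \<ge> N0")
      case False
      obtain B where B: "B \<in> events" "prob B \<le> real N * (variance (\<lambda>\<omega>. ln (q \<omega>)) / (real n * \<delta>\<^sup>2))"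
        "\<And>\<omega>. \<omega> \<in> space (M N) - B \<Longrightarrow> (op_norm (prd n \<omega>))\<^sup>2 \<le> real N * exp (real n * (\<mu> + \<delta>))"
        using op_norm_upper_small[OF n(1) \<delta>] by blast
      have "real N * (variance (\<lambda>\<omega>. ln (q \<omega>)) / (real n * \<delta>\<^sup>2)) \<le> real N0 * (K / (real n * \<delta>\<^sup>2))"
        using vq vq0 d0 False by (intro mult_mono divide_right_mono) auto
      also have "\<dots> = (real N0 * K / \<delta>\<^sup>2) / real n" by simp
      finally have "prob B \<le> 2 * \<delta>" using B(2) n(3) \<delta> by linarith
      moreover have "(op_norm (prd n \<omega>))\<^sup>2 \<le> exp (real n * (\<mu> + 4 * \<delta>))" if "\<omega> \<in> space (M N) - B" for \<omega>
      proof -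
        have "real N \<le> real N0 + 1" using False by simp
        also have "\<dots> = exp (ln (real N0 + 1))" by simp
        also have "ln (real N0 + 1) \<le> real n * \<delta>" using n(1,4) by (simp add: pos_divide_le_eq mult.commute)
        finally have "real N \<le> exp (real n * \<delta>)" by simp
        then have "real N * exp (real n * (\<mu> + \<delta>)) \<le> exp (real n * \<delta>) * exp (real n * (\<mu> + \<delta>))"
          by (intro mult_right_mono) auto
        also have "\<dots> = exp (real n * (\<mu> + 2 * \<delta>))" by (simp add: exp_add[symmetric] algebra_simps)
        also have "\<dots> \<le> exp (real n * (\<mu> + 4 * \<delta>))" using \<delta> by (simp add: mult_left_mono)
        finally show ?thesis using B(3)[OF that] by linarith
      qed
      ultimately show ?thesis using B(1) by blast
    next
      case True
      obtain k where k: "k \<ge> 1" "N \<le> C * k" and "(\<integral>\<^sup>+\<omega>. ennreal ((sqn N (mulv N (X N 1 \<omega>) (unitf 0)) / S N (X N 1 \<omega>)) ^ k) \<partial>M N) \<le> ennreal (exp (real k * \<delta>))"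
        using L[OF True N] by blast
      then have zk: "(\<integral>\<^sup>+\<omega>. ennreal (z \<omega> ^ k) \<partial>M N) \<le> ennreal (exp (real k * \<delta>))"
        by (simp add: z_def q_def s_def)
      have Ez: "expectation (\<lambda>\<omega>. ln (z \<omega>)) \<ge> - \<delta>" using L[OF True N] by (simp add: z_def q_def s_def)
      obtain B where B: "B \<in> events" "prob B \<le> 4 ^ k * sqrt 2 ^ N * exp (- (real n * real k * \<delta>)) +
          variance (\<lambda>\<omega>. ln (s \<omega>)) / (real n * \<delta>\<^sup>2)"
        "\<And>\<omega>. \<omega> \<in> space (M N) - B \<Longrightarrow> (op_norm (prd n \<omega>))\<^sup>2 \<le> exp (real n * (expectation (\<lambda>\<omega>. ln (s \<omega>)) + 3 * \<delta>))"
        using op_norm_upper_large[OF n(1) k(1) \<delta> zk] by blast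
      have "4 ^ k * sqrt 2 ^ N \<le> (4 ^ k * 2 ^ (C * k) :: real)"
      proof (rule mult_left_mono)
        have "sqrt 2 ^ N \<le> (2 ^ N :: real)" by (rule power_mono) (simp_all add: real_le_lsqrt)
        also have "\<dots> \<le> 2 ^ (C * k)" using k(2) by (intro power_increasing) auto
        finally show "sqrt 2 ^ N \<le> (2 ^ (C * k) :: real)" .
      qed simp
      also have "\<dots> = R ^ k" by (simp add: R_def power_mult_distrib power_mult)
      finally have "4 ^ k * sqrt 2 ^ N * exp (- (real n * real k * \<delta>)) \<le> R ^ k * exp (- (real n * real k * \<delta>))"
        by (intro mult_right_mono) auto
      also have "\<dots> = (R * exp (- (real n * \<delta>))) ^ k"
        by (simp add: power_mult_distrib exp_of_nat_mult[symmetric] mult_ac)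
      finally have "4 ^ k * sqrt 2 ^ N * exp (- (real n * real k * \<delta>)) \<le> (R * exp (- (real n * \<delta>))) ^ k" .
      moreover have Re: "R * exp (- (real n * \<delta>)) \<le> (R / \<delta>) / real n"
      proof -
        have "real n * \<delta> \<le> exp (real n * \<delta>)" using exp_ge_add_one_self[of "real n * \<delta>"] by linarith
        then have "R / exp (real n * \<delta>) \<le> R / (real n * \<delta>)"
          using n(1) \<delta> by (intro divide_left_mono) (auto simp: R_def)
        moreover have "R * exp (- (real n * \<delta>)) = R / exp (real n * \<delta>)" by (simp add: exp_minus field_simps)
        moreover have "R / (real n * \<delta>) = (R / \<delta>) / real n" by simp
        ultimately show ?thesis by linarith
      qed
      \<comment> \<open>Once the base is at most 1, its k-th power is at most the base itself, and
        the dependence on k, and with it on N, disappears.\<close>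
      moreover have "(R * exp (- (real n * \<delta>))) ^ k \<le> (R * exp (- (real n * \<delta>))) ^ 1"
        by (rule power_decreasing[OF k(1)]) (use Re n(5) in \<open>simp_all add: R_def\<close>)
      ultimately have "4 ^ k * sqrt 2 ^ N * exp (- (real n * real k * \<delta>)) \<le> \<delta>" using n(6) by simp
      moreover have "variance (\<lambda>\<omega>. ln (s \<omega>)) / (real n * \<delta>\<^sup>2) \<le> \<delta>"
      proof -
        have "variance (\<lambda>\<omega>. ln (s \<omega>)) / (real n * \<delta>\<^sup>2) \<le> K2 / (real n * \<delta>\<^sup>2)"
          using vs d0 by (intro divide_right_mono) auto
        also have "\<dots> = (K2 / \<delta>\<^sup>2) / real n" by simp
        finally show ?thesis using n(7) by simp
      qed
      ultimately have "prob B \<le> 2 * \<delta>" using B(2) by linarith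
      moreover have "(op_norm (prd n \<omega>))\<^sup>2 \<le> exp (real n * (\<mu> + 4 * \<delta>))" if "\<omega> \<in> space (M N) - B" for \<omega>
      proof -
        have "real n * (expectation (\<lambda>\<omega>. ln (s \<omega>)) + 3 * \<delta>) \<le> real n * (\<mu> + 4 * \<delta>)"
          using Ez mu_eq by (intro mult_left_mono) auto
        then show ?thesis using B(3)[OF that] by (meson exp_le_cancel_iff order_trans)
      qed
      ultimately show ?thesis using B(1) by blast
    qed
    have "4 * \<delta> = \<epsilon>" by (simp add: \<delta>_def)
    with deviation[OF n(1) \<delta> v upper] bq \<delta>
    show "measure (M N) {\<omega> \<in> space (M N).
          \<bar>ln (op_norm (mat_prod N (\<lambda>i. X N i \<omega>) n)) / real n
            - prob_space.expectation (M N) (\<lambda>\<omega>. ln (euclid_norm (X N 1 \<omega> *\<^sub>v v)))\<bar> \<ge> \<epsilon>} \<le> \<epsilon>" by simp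
  qed
qed

text \<open>For x \<ge> 1/2 this is ln x \<ge> 1 - 1/x, rewritten around 1. Near 0 no quadratic
  bounds ln x from below, so \<delta> (ln x)^2 is given away: completing the square yields ln x +
  \<delta> (ln x)^2 \<ge> - 1 / (4 \<delta>), and (x - 1)^2 \<ge> 1/4 there.\<close>

lemma ln_ge_quadratic:
  fixes x \<delta> :: real
  assumes x: "x > 0" and \<delta>: "\<delta> > 0"
  shows "ln x \<ge> (x - 1) - (2 + 1 / \<delta>) * (x - 1)\<^sup>2 - \<delta> * (ln x)\<^sup>2"
proof (cases "x \<ge> 1/2")
  case True
  have "ln (1 / x) \<le> 1 / x - 1" using ln_le_minus_one[of "1/x"] x by simp
  then have l: "ln x \<ge> 1 - 1 / x" using x by (simp add: ln_div)
  have "(1 - 1 / x) - (x - 1) = - ((x - 1)\<^sup>2 / x)"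
    using x by (simp add: field_simps power2_eq_square)
  moreover have "(x - 1)\<^sup>2 / x \<le> 2 * (x - 1)\<^sup>2"
  proof -
    have "1 / x \<le> 2" using True x by (simp add: field_simps)
    then have "(x - 1)\<^sup>2 * (1 / x) \<le> (x - 1)\<^sup>2 * 2" by (intro mult_left_mono) auto
    then show ?thesis by simp
  qed
  moreover have "0 \<le> 1 / \<delta> * (x - 1)\<^sup>2" "0 \<le> \<delta> * (ln x)\<^sup>2" using \<delta> by auto
  ultimately show ?thesis using l by (simp add: distrib_right)
next
  case False
  have "0 \<le> (\<delta> * ln x + 1 / 2)\<^sup>2 / \<delta>" using \<delta> by simp
  also have "\<dots> = \<delta> * (ln x)\<^sup>2 + ln x + 1 / \<delta> * (1 / 4)"
    using \<delta> by (simp add: field_simps power2_eq_square)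
  finally have "ln x \<ge> - \<delta> * (ln x)\<^sup>2 - 1 / \<delta> * (1 / 4)" by simp
  moreover have "1 / \<delta> * (1 / 4) \<le> 1 / \<delta> * (x - 1)\<^sup>2"
  proof (rule mult_left_mono)
    have "(1 / 2)\<^sup>2 \<le> (1 - x)\<^sup>2" using False by (intro power_mono) auto
    then show "1 / 4 \<le> (x - 1)\<^sup>2" by (simp add: power2_commute[of x 1] power_divide)
  qed (use \<delta> in simp)
  moreover have "x - 1 \<le> 0" using False by simp
  moreover have "0 \<le> 2 * (x - 1)\<^sup>2" by simp
  ultimately show ?thesis unfolding distrib_right by linarith
qed

text \<open>The linear term of the pointwise bound has mean 0 because Z has mean 1.\<close>

lemma (in prob_space) expectation_ln_ge:
  fixes Z :: "'a \<Rightarrow> real"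
  assumes pos: "AE \<omega> in M. 0 < Z \<omega>"
    and Z: "integrable M Z" "expectation Z = 1" "integrable M (\<lambda>\<omega>. (Z \<omega> - 1)\<^sup>2)"
    and l: "integrable M (\<lambda>\<omega>. ln (Z \<omega>))" "integrable M (\<lambda>\<omega>. (ln (Z \<omega>))\<^sup>2)" and \<delta>: "\<delta> > 0"
  shows "expectation (\<lambda>\<omega>. ln (Z \<omega>)) \<ge>
    - ((2 + 1 / \<delta>) * expectation (\<lambda>\<omega>. (Z \<omega> - 1)\<^sup>2)) - \<delta> * expectation (\<lambda>\<omega>. (ln (Z \<omega>))\<^sup>2)"
proof -
  let ?F = "\<lambda>\<omega>. (Z \<omega> - 1) - (2 + 1 / \<delta>) * (Z \<omega> - 1)\<^sup>2 - \<delta> * (ln (Z \<omega>))\<^sup>2"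
  have i: "integrable M ?F" using Z l by simp
  have "expectation ?F \<le> expectation (\<lambda>\<omega>. ln (Z \<omega>))"
  proof (rule integral_mono_AE[OF i l(1)])
    show "AE \<omega> in M. ?F \<omega> \<le> ln (Z \<omega>)" using pos by eventually_elim (rule ln_ge_quadratic[OF _ \<delta>])
  qed
  moreover have "expectation ?F = - ((2 + 1 / \<delta>) * expectation (\<lambda>\<omega>. (Z \<omega> - 1)\<^sup>2)) - \<delta> * expectation (\<lambda>\<omega>. (ln (Z \<omega>))\<^sup>2)"
    using Z l by (simp add: prob_space)
  ultimately show ?thesis by simp
qed

text \<open>Take k as the integer part of c N. Then k / N \<le> c \<le> \<delta> / K4 gives K4 k^2 /
  N \<le> k \<delta>, and c \<le> 1/4 keeps k in the range where the moment bound holds.\<close>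

lemma uniform_deviation_moments:
  fixes M :: "nat \<Rightarrow> 'a measure" and X :: "nat \<Rightarrow> nat \<Rightarrow> 'a \<Rightarrow> real Matrix.mat" and S :: "nat \<Rightarrow> real Matrix.mat \<Rightarrow> real"
  defines "Z \<equiv> \<lambda>N \<omega>. sqn N (mulv N (X N 1 \<omega>) (unitf 0)) / S N (X N 1 \<omega>)"
  assumes iso: "\<And>N. N \<ge> 1 \<Longrightarrow> isotropic_product (M N) N (X N) (S N)"
    and K1: "\<And>N. N \<ge> 1 \<Longrightarrow> prob_space.expectation (M N) (\<lambda>\<omega>. (ln (Z N \<omega>))\<^sup>2) \<le> K1"
    and K2: "\<And>N. N \<ge> 1 \<Longrightarrow> prob_space.variance (M N) (\<lambda>\<omega>. ln (S N (X N 1 \<omega>))) \<le> K2"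
    and Z1: "\<And>N. N \<ge> 1 \<Longrightarrow> integrable (M N) (Z N)" "\<And>N. N \<ge> 1 \<Longrightarrow> prob_space.expectation (M N) (Z N) = 1"
    and Z2: "\<And>N. N \<ge> 1 \<Longrightarrow> integrable (M N) (\<lambda>\<omega>. (Z N \<omega> - 1)\<^sup>2)"
    and K3: "\<And>N. N \<ge> 1 \<Longrightarrow> prob_space.expectation (M N) (\<lambda>\<omega>. (Z N \<omega> - 1)\<^sup>2) \<le> K3 / real N"
    and K4: "K4 > 0" "\<And>N k. N \<ge> 1 \<Longrightarrow> 4 * k \<le> N \<Longrightarrow>
      (\<integral>\<^sup>+\<omega>. ennreal (Z N \<omega> ^ k) \<partial>M N) \<le> ennreal (exp (K4 * (real k)\<^sup>2 / real N))"
  shows "uniform_growth M X"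
proof (rule uniform_deviation[OF iso K1[unfolded Z_def] K2])
  fix \<delta> :: real assume \<delta>: "\<delta> > 0"
  \<comment> \<open>With this weight the loss d E (ln Z)^2 is at most \<delta> / 2; for fixed d the
    other loss is of order 1 / N.\<close>
  define d where "d = \<delta> / (2 * (\<bar>K1\<bar> + 1))"
  have d: "d > 0" "d * \<bar>K1\<bar> \<le> \<delta> / 2" using \<delta> by (auto simp: d_def field_simps)
  define c where "c = min (\<delta> / K4) (1 / 4)"
  have c: "c > 0" "c \<le> 1 / 4" "K4 * c \<le> \<delta>" using \<delta> K4(1) by (auto simp: c_def min_def field_simps)
  have "eventually (\<lambda>N. (2 + 1 / d) * K3 / real N \<le> \<delta> / 2 \<and> (1 / c) / real N \<le> 1) sequentially"
    using \<delta> by (intro eventually_conj eventually_divide_le) auto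
  then obtain N0 where N0: "\<And>N. N \<ge> N0 \<Longrightarrow> (2 + 1 / d) * K3 / real N \<le> \<delta> / 2 \<and> (1 / c) / real N \<le> 1"
    unfolding eventually_sequentially by blast
  show "\<exists>N0 C. \<forall>N\<ge>N0. N \<ge> 1 \<longrightarrow>
      prob_space.expectation (M N) (\<lambda>\<omega>. ln (sqn N (mulv N (X N 1 \<omega>) (unitf 0)) / S N (X N 1 \<omega>))) \<ge> - \<delta> \<and>
      (\<exists>k\<ge>1. N \<le> C * k \<and>
        (\<integral>\<^sup>+\<omega>. ennreal ((sqn N (mulv N (X N 1 \<omega>) (unitf 0)) / S N (X N 1 \<omega>)) ^ k) \<partial>M N) \<le> ennreal (exp (real k * \<delta>)))"
  proof (rule exI[of _ N0], rule exI[of _ "nat \<lceil>2 / c\<rceil>"], intro allI impI conjI)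
    fix N assume N: "N \<ge> N0" "N \<ge> 1"
    interpret isotropic_product "M N" N "X N" "S N" by (rule iso[OF N(2)])
    have zZ: "z = Z N" by (simp add: fun_eq_iff z_def q_def s_def Z_def)
    have "AE \<omega> in M N. 0 < z \<omega>" using AE_qs by eventually_elim (simp add: z_def)
    then have "- ((2 + 1 / d) * expectation (\<lambda>\<omega>. (z \<omega> - 1)\<^sup>2)) - d * expectation (\<lambda>\<omega>. (ln (z \<omega>))\<^sup>2) \<le> expectation (\<lambda>\<omega>. ln (z \<omega>))"
      by (rule expectation_ln_ge) (use Z1[OF N(2)] Z2[OF N(2)] integrable_ln(3,4) d(1) zZ in simp_all)
    moreover have "(2 + 1 / d) * expectation (\<lambda>\<omega>. (z \<omega> - 1)\<^sup>2) \<le> (2 + 1 / d) * (K3 / real N)"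
      using K3[OF N(2)] d(1) zZ by (intro mult_left_mono) auto
    moreover have "(2 + 1 / d) * (K3 / real N) \<le> \<delta> / 2" using N0[OF N(1)] by simp
    moreover have "d * expectation (\<lambda>\<omega>. (ln (z \<omega>))\<^sup>2) \<le> d * \<bar>K1\<bar>"
      using K1[OF N(2)] d(1) zZ by (intro mult_left_mono) auto
    ultimately have "expectation (\<lambda>\<omega>. ln (z \<omega>)) \<ge> - \<delta>" using d(2) by linarith
    then show "expectation (\<lambda>\<omega>. ln (sqn N (mulv N (X N 1 \<omega>) (unitf 0)) / S N (X N 1 \<omega>))) \<ge> - \<delta>"
      by (simp add: z_def q_def s_def)
    define k where "k = nat \<lfloor>c * real N\<rfloor>"
    have x1: "c * real N \<ge> 1" using N0[OF N(1)] c(1) N(2) by (simp add: field_simps)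
    then have k1: "k \<ge> 1" unfolding k_def by (simp add: le_nat_iff le_floor_iff)
    have kr: "real k = of_int \<lfloor>c * real N\<rfloor>" unfolding k_def using x1 by simp
    have kle: "real k \<le> c * real N" unfolding kr by (rule of_int_floor_le)
    \<comment> \<open>As k \<ge> 1, rounding down loses at most a factor 2; this is the 2 in 2 /
      c.\<close>
    have "c * real N < real k + 1" unfolding kr by linarith
    then have "c * real N \<le> 2 * real k" using k1 by simp
    then have "real N \<le> 2 / c * real k" using c(1) by (simp add: field_simps)
    also have "\<dots> \<le> real (nat \<lceil>2 / c\<rceil>) * real k" using c(1) by (intro mult_right_mono) linarith+
    finally have NC: "N \<le> nat \<lceil>2 / c\<rceil> * k" by (metis of_nat_le_iff of_nat_mult)
    have "real (4 * k) \<le> 4 * (c * real N)" using kle by simp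
    also have "\<dots> \<le> 4 * (1 / 4 * real N)" using c(2) by (intro mult_left_mono mult_right_mono) auto
    finally have k4: "4 * k \<le> N" by simp
    have "(\<integral>\<^sup>+\<omega>. ennreal (Z N \<omega> ^ k) \<partial>M N) \<le> ennreal (exp (K4 * (real k)\<^sup>2 / real N))" by (rule K4(2)[OF N(2) k4])
    also have "\<dots> \<le> ennreal (exp (real k * \<delta>))"
    proof (intro ennreal_leI, subst exp_le_cancel_iff)
      have "K4 * (real k)\<^sup>2 / real N \<le> K4 * (real k * (c * real N)) / real N"
        using kle K4(1) by (intro divide_right_mono mult_left_mono) (auto simp: power2_eq_square intro: mult_left_mono)
      also have "\<dots> = real k * (K4 * c)" using N(2) by simp
      also have "\<dots> \<le> real k * \<delta>" using c(3) by (intro mult_left_mono) auto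
      finally show "K4 * (real k)\<^sup>2 / real N \<le> real k * \<delta>" .
    qed
    finally show "\<exists>k\<ge>1. N \<le> nat \<lceil>2 / c\<rceil> * k \<and>
        (\<integral>\<^sup>+\<omega>. ennreal ((sqn N (mulv N (X N 1 \<omega>) (unitf 0)) / S N (X N 1 \<omega>)) ^ k) \<partial>M N) \<le> ennreal (exp (real k * \<delta>))"
      using k1 NC unfolding Z_def by blast
  qed
qed

section \<open>The two alternatives\<close>

lemma sqn_mulv_one: "sqn N (mulv N (1\<^sub>m N) g) = sqn N g"
  by (rule sqn_cong) (rule mulv_one)

lemma frob_one: "frob N (1\<^sub>m N) = real N"
proof -
  have "frob N (1\<^sub>m N) = (\<Sum>i<N. \<Sum>j<N. if i = j then 1 else 0)"
    unfolding frob_def by (intro sum.cong) auto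
  then show ?thesis by simp
qed

lemma gauss_norm_facts:
  assumes "N \<ge> 1"
  shows "AE g in gauss N. 0 < sqn N g"
    and "(\<integral>\<^sup>+g. ennreal ((ln (sqn N g / real N))\<^sup>2) \<partial>gauss N) \<le> 328"
  using gauss_image_ln_sq[of N "1\<^sub>m N"] assms by (simp_all add: sqn_mulv_one frob_one)

text \<open>\<open>R\<close> k is 2^N times the k-th moment of Z over random signs for a fixed
  matrix. Division by frob^k leaves bounds in b, k and N only, which survive integration over the
  matrix.\<close>

lemma sign_moments:
  assumes f: "0 < frob N A" and b: "b \<ge> 0" and w: "\<forall>w. sqn N (mulv N A w) \<le> b * (frob N A / real N) * sqn N w"
  defines "R \<equiv> \<lambda>k. (\<Sum>T\<in>Pow {..<N}. sqn N (mulv N A (sgnv T)) ^ k) / frob N A ^ k"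
  shows "R k \<le> 2 ^ N * (1 + 8 * real k * b / real N) ^ k" and "R 1 = 2 ^ N"
    and "R 2 \<le> 2 ^ N * (1 + 8 * b / real N)"
proof -
  let ?F = "frob N A"
  interpret B: bounded_matrix N A "b * (?F / real N)"
    by unfold_locales (use w b f in auto)
  have R: "R j = (\<Sum>T\<in>Pow {..<N}. B.Q T ^ j) / ?F ^ j" for j by (simp add: R_def B.Q_def)
  have "(\<Sum>T\<in>Pow {..<N}. B.Q T ^ k) \<le> 2 ^ N * (?F + 8 * real k * (b * (?F / real N))) ^ k" by (rule B.sum_Q_power_le)
  also have "?F + 8 * real k * (b * (?F / real N)) = ?F * (1 + 8 * real k * b / real N)" by (simp add: distrib_left)
  finally show "R k \<le> 2 ^ N * (1 + 8 * real k * b / real N) ^ k"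
    using f by (simp add: R pos_divide_le_eq power_mult_distrib mult_ac)
  show "R 1 = 2 ^ N" using B.sum_Q f by (simp add: R)
  have "(\<Sum>T\<in>Pow {..<N}. B.Q T ^ Suc 1) \<le> (?F + 8 * real 1 * (b * (?F / real N))) * (\<Sum>T\<in>Pow {..<N}. B.Q T ^ 1)"
    by (rule B.sum_Q_power_Suc)
  also have "\<dots> = ?F\<^sup>2 * (2 ^ N * (1 + 8 * b / real N))" using B.sum_Q by (simp add: algebra_simps power2_eq_square)
  finally show "R 2 \<le> 2 ^ N * (1 + 8 * b / real N)"
    using f by (simp add: R pos_divide_le_eq numeral_2_eq_2 mult_ac)
qed

section \<open>Averaging over Gaussian directions and over signs\<close>

context isotropic_matrices
begin

lemma nn_integral_unit_eq:
  fixes G :: "real \<times> real \<Rightarrow> real"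
  assumes G: "G \<in> borel_measurable borel" and h: "sqn N h = 1"
  shows "(\<integral>\<^sup>+\<omega>. ennreal (G (sqn N (mulv N (X 1 \<omega>) h), S (X 1 \<omega>))) \<partial>M) = (\<integral>\<^sup>+\<omega>. ennreal (G (q \<omega>, s \<omega>)) \<partial>M)"
proof -
  have m1: "(\<lambda>\<omega>. G (sqn N (mulv N (X 1 \<omega>) h), S (X 1 \<omega>))) \<in> borel_measurable M"
    by (rule measurable_compose[OF X_meas[OF order_refl]
          measurable_compose[OF borel_measurable_Pair[OF measurable_sqn_mulv S_meas] G]])
  have m2: "(\<lambda>\<omega>. G (q \<omega>, s \<omega>)) \<in> borel_measurable M"
    by (rule measurable_compose[OF borel_measurable_Pair[OF q_meas s_meas] G])
  have "(\<integral>\<^sup>+\<omega>. ennreal (G (sqn N (mulv N (X 1 \<omega>) h), S (X 1 \<omega>))) \<partial>M) =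
    (\<integral>\<^sup>+x. ennreal x \<partial>distr M borel (\<lambda>\<omega>. G (sqn N (mulv N (X 1 \<omega>) h), S (X 1 \<omega>))))"
    by (rule nn_integral_distr[symmetric]) (use m1 in auto)
  also have "\<dots> = (\<integral>\<^sup>+\<omega>. ennreal (G (q \<omega>, s \<omega>)) \<partial>M)"
    unfolding law[OF G order_refl h] by (rule nn_integral_distr) (use m2 in auto)
  finally show ?thesis .
qed

text \<open>Almost every g has a unit direction g / |g|, and by isotropy each direction gives the
  same integral. After the exchange of integrals the matrix is fixed and the Gaussian vector carries
  the randomness.\<close>

lemma gauss_average:
  fixes G :: "real \<times> real \<Rightarrow> real"
  assumes G: "G \<in> borel_measurable borel"
  shows "(\<integral>\<^sup>+\<omega>. ennreal (G (q \<omega>, s \<omega>)) \<partial>M) =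
    (\<integral>\<^sup>+\<omega>. (\<integral>\<^sup>+g. ennreal (G (sqn N (mulv N (X 1 \<omega>) g) / sqn N g, S (X 1 \<omega>))) \<partial>gauss N) \<partial>M)"
proof -
  interpret G: prob_space "gauss N" by (rule prob_space_gauss)
  interpret MG: pair_sigma_finite M "gauss N" ..
  let ?R = "\<lambda>\<omega> g. ennreal (G (sqn N (mulv N (X 1 \<omega>) g) / sqn N g, S (X 1 \<omega>)))"
  have Rm: "(\<lambda>(\<omega>, g). ?R \<omega> g) \<in> borel_measurable (M \<Otimes>\<^sub>M gauss N)"
  proof -
    have X1: "(\<lambda>x. X 1 (fst x)) \<in> measurable (M \<Otimes>\<^sub>M gauss N) (borel_mat N)"
      by (rule measurable_compose[OF measurable_fst X_meas]) simp
    have e: "(\<lambda>x. X 1 (fst x) $$ (j, l)) \<in> borel_measurable (M \<Otimes>\<^sub>M gauss N)" if "j < N" "l < N" for j l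
      by (rule measurable_compose[OF X1 measurable_entry[OF that]])
    have g: "(\<lambda>x. snd x l) \<in> borel_measurable (M \<Otimes>\<^sub>M gauss N)" if "l < N" for l
      by (rule measurable_compose[OF measurable_snd measurable_entry_gauss[OF that]])
    have "(\<lambda>x. sqn N (mulv N (X 1 (fst x)) (snd x))) \<in> borel_measurable (M \<Otimes>\<^sub>M gauss N)"
      unfolding sqn_def mulv_def
      by (intro borel_measurable_sum borel_measurable_power borel_measurable_times e g) simp_all
    moreover have "(\<lambda>x. sqn N (snd x)) \<in> borel_measurable (M \<Otimes>\<^sub>M gauss N)"
      unfolding sqn_def by (intro borel_measurable_sum borel_measurable_power g) simp
    ultimately have "(\<lambda>x. G (sqn N (mulv N (X 1 (fst x)) (snd x)) / sqn N (snd x), S (X 1 (fst x)))) \<in> borel_measurable (M \<Otimes>\<^sub>M gauss N)"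
      by (intro measurable_compose[OF borel_measurable_Pair G] borel_measurable_divide measurable_compose[OF X1 S_meas])
    then show ?thesis unfolding case_prod_beta' by measurable
  qed
  have "(\<integral>\<^sup>+\<omega>. (\<integral>\<^sup>+g. ?R \<omega> g \<partial>gauss N) \<partial>M) = (\<integral>\<^sup>+g. (\<integral>\<^sup>+\<omega>. ?R \<omega> g \<partial>M) \<partial>gauss N)"
    by (rule MG.Fubini'[OF Rm, symmetric])
  also have "\<dots> = (\<integral>\<^sup>+g. (\<integral>\<^sup>+\<omega>. ennreal (G (q \<omega>, s \<omega>)) \<partial>M) \<partial>gauss N)"
  proof (rule nn_integral_cong_AE, use gauss_norm_facts(1)[OF N1] in eventually_elim)
    fix g assume r: "0 < sqn N g"
    have "sqn N (\<lambda>l. 1 / sqrt (sqn N g) * g l) = 1" unfolding sqn_scale using r by (simp add: power_divide)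
    from nn_integral_unit_eq[OF G this]
    show "(\<integral>\<^sup>+\<omega>. ?R \<omega> g \<partial>M) = (\<integral>\<^sup>+\<omega>. ennreal (G (q \<omega>, s \<omega>)) \<partial>M)"
      unfolding sqn_mulv_scale using r by (simp add: power_divide)
  qed
  also have "\<dots> = (\<integral>\<^sup>+\<omega>. ennreal (G (q \<omega>, s \<omega>)) \<partial>M)" by (simp add: G.emeasure_space_1)
  finally show ?thesis by simp
qed

text \<open>A nonzero matrix may annihilate the first basis vector, but it annihilates almost no
  Gaussian vector. Averaging the indicator of vanishing carries this back to the fixed
  direction.\<close>

lemma q_pos_frob:
  assumes fr: "AE \<omega> in M. 0 < frob N (X 1 \<omega>)"
  shows "AE \<omega> in M. 0 < q \<omega>"
proof -
  let ?G = "indicator {x. fst x \<le> 0} :: real \<times> real \<Rightarrow> real"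
  have Gm: "?G \<in> borel_measurable borel" unfolding borel_prod[symmetric] by measurable
  have "(\<integral>\<^sup>+\<omega>. (\<integral>\<^sup>+g. ennreal (?G (sqn N (mulv N (X 1 \<omega>) g) / sqn N g, S (X 1 \<omega>))) \<partial>gauss N) \<partial>M) = (\<integral>\<^sup>+\<omega>. 0 \<partial>M)"
  proof (rule nn_integral_cong_AE, use fr in eventually_elim)
    fix \<omega> assume f: "0 < frob N (X 1 \<omega>)"
    have "(\<integral>\<^sup>+g. ennreal (?G (sqn N (mulv N (X 1 \<omega>) g) / sqn N g, S (X 1 \<omega>))) \<partial>gauss N) = (\<integral>\<^sup>+g. 0 \<partial>gauss N)"
    proof (rule nn_integral_cong_AE, use gauss_norm_facts(1)[OF N1] gauss_image_ln_sq(1)[OF f] in eventually_elim)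
      fix g assume "0 < sqn N g" "0 < sqn N (mulv N (X 1 \<omega>) g)"
      then have "0 < sqn N (mulv N (X 1 \<omega>) g) / sqn N g" by simp
      then show "ennreal (?G (sqn N (mulv N (X 1 \<omega>) g) / sqn N g, S (X 1 \<omega>))) = 0" by (simp del: zero_less_divide_iff)
    qed
    then show "(\<integral>\<^sup>+g. ennreal (?G (sqn N (mulv N (X 1 \<omega>) g) / sqn N g, S (X 1 \<omega>))) \<partial>gauss N) = 0" by simp
  qed
  then have "(\<integral>\<^sup>+\<omega>. ennreal (?G (q \<omega>, s \<omega>)) \<partial>M) = 0" unfolding gauss_average[OF Gm] by simp
  moreover have "(\<lambda>\<omega>. ennreal (?G (q \<omega>, s \<omega>))) \<in> borel_measurable M"
    by (rule measurable_compose[OF measurable_compose[OF borel_measurable_Pair[OF q_meas s_meas] Gm] measurable_ennreal])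
  ultimately have "AE \<omega> in M. ennreal (?G (q \<omega>, s \<omega>)) = 0" by (subst (asm) nn_integral_0_iff_AE)
  then show ?thesis by eventually_elim (simp add: indicator_def split: if_splits)
qed

text \<open>In a Gaussian direction z is the quotient of |X g|^2 / frob by |g|^2 / N. For fixed X
  both logarithms have second moment at most 328, and 1312 = 2 * 328 + 2 * 328.\<close>

lemma ln_z_sq_frob:
  assumes fr: "AE \<omega> in M. 0 < frob N (X 1 \<omega>)" and S: "\<And>A. S A = frob N A / real N"
  shows "(\<integral>\<^sup>+\<omega>. ennreal ((ln (z \<omega>))\<^sup>2) \<partial>M) \<le> 1312"
proof -
  let ?G = "\<lambda>x :: real \<times> real. (ln (fst x / snd x))\<^sup>2"
  have Gm: "?G \<in> borel_measurable borel" unfolding borel_prod[symmetric] by measurable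
  have "(\<integral>\<^sup>+\<omega>. ennreal ((ln (z \<omega>))\<^sup>2) \<partial>M) = (\<integral>\<^sup>+\<omega>. ennreal (?G (q \<omega>, s \<omega>)) \<partial>M)" by (simp add: z_def)
  also have "\<dots> = (\<integral>\<^sup>+\<omega>. (\<integral>\<^sup>+g. ennreal (?G (sqn N (mulv N (X 1 \<omega>) g) / sqn N g, S (X 1 \<omega>))) \<partial>gauss N) \<partial>M)"
    by (rule gauss_average[OF Gm])
  also have "\<dots> \<le> (\<integral>\<^sup>+\<omega>. 1312 \<partial>M)"
  proof (rule nn_integral_mono_AE, use fr in eventually_elim)
    fix \<omega> assume f: "0 < frob N (X 1 \<omega>)"
    let ?a = "\<lambda>g. (ln (sqn N (mulv N (X 1 \<omega>) g) / frob N (X 1 \<omega>)))\<^sup>2" and ?b = "\<lambda>g. (ln (sqn N g / real N))\<^sup>2"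
    have mm: "(\<lambda>g. sqn N (mulv N B g)) \<in> borel_measurable (gauss N)" for B
      unfolding sqn_def mulv_def
      by (intro borel_measurable_sum borel_measurable_power borel_measurable_times measurable_entry_gauss) auto
    have mg: "(\<lambda>g. sqn N g) \<in> borel_measurable (gauss N)" using mm[of "1\<^sub>m N"] by (simp add: sqn_mulv_one)
    have am: "(\<lambda>g. ennreal (?a g)) \<in> borel_measurable (gauss N)" and bm: "(\<lambda>g. ennreal (?b g)) \<in> borel_measurable (gauss N)"
      using mm[of "X 1 \<omega>"] mg by measurable
    have "(\<integral>\<^sup>+g. ennreal (?G (sqn N (mulv N (X 1 \<omega>) g) / sqn N g, S (X 1 \<omega>))) \<partial>gauss N) \<le>
      (\<integral>\<^sup>+g. 2 * ennreal (?a g) + 2 * ennreal (?b g) \<partial>gauss N)"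
    proof (rule nn_integral_mono_AE, use gauss_norm_facts(1)[OF N1] gauss_image_ln_sq(1)[OF f] in eventually_elim)
      fix g assume g: "0 < sqn N g" "0 < sqn N (mulv N (X 1 \<omega>) g)"
      have "sqn N (mulv N (X 1 \<omega>) g) / sqn N g / S (X 1 \<omega>) =
        (sqn N (mulv N (X 1 \<omega>) g) / frob N (X 1 \<omega>)) / (sqn N g / real N)" by (simp add: S)
      then have "ln (sqn N (mulv N (X 1 \<omega>) g) / sqn N g / S (X 1 \<omega>)) =
        ln (sqn N (mulv N (X 1 \<omega>) g) / frob N (X 1 \<omega>)) - ln (sqn N g / real N)"
        using g f N1 by (simp only:) (subst ln_div, simp_all)
      moreover have "(x - y)\<^sup>2 \<le> 2 * x\<^sup>2 + 2 * y\<^sup>2" for x y :: real using power2_add_le[of x "- y"] by simp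
      ultimately have "?G (sqn N (mulv N (X 1 \<omega>) g) / sqn N g, S (X 1 \<omega>)) \<le> 2 * ?a g + 2 * ?b g" by simp
      then have "ennreal (?G (sqn N (mulv N (X 1 \<omega>) g) / sqn N g, S (X 1 \<omega>))) \<le> ennreal (2 * ?a g + 2 * ?b g)"
        by (rule ennreal_leI)
      also have "\<dots> = 2 * ennreal (?a g) + 2 * ennreal (?b g)" by (simp add: ennreal_plus ennreal_mult)
      finally show "ennreal (?G (sqn N (mulv N (X 1 \<omega>) g) / sqn N g, S (X 1 \<omega>))) \<le> 2 * ennreal (?a g) + 2 * ennreal (?b g)" .
    qed
    also have "\<dots> = 2 * (\<integral>\<^sup>+g. ennreal (?a g) \<partial>gauss N) + 2 * (\<integral>\<^sup>+g. ennreal (?b g) \<partial>gauss N)"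
      using am bm by (simp add: nn_integral_add nn_integral_cmult)
    also have "\<dots> \<le> 2 * 328 + 2 * 328"
      by (intro add_mono mult_left_mono gauss_image_ln_sq(2)[OF f] gauss_norm_facts(2)[OF N1]) auto
    finally show "(\<integral>\<^sup>+g. ennreal (?G (sqn N (mulv N (X 1 \<omega>) g) / sqn N g, S (X 1 \<omega>))) \<partial>gauss N) \<le> 1312" by simp
  qed
  finally show ?thesis by (simp add: emeasure_space_1)
qed

text \<open>Every sign vector divided by sqrt N is a unit vector, so z may be evaluated along it
  without changing its law; the resulting 1 / N cancels against the one in S.\<close>

lemma sign_average:
  assumes S: "\<And>A. S A = frob N A / real N"
  shows "ennreal (2 ^ N) * (\<integral>\<^sup>+\<omega>. ennreal (z \<omega> ^ k) \<partial>M) =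
    (\<integral>\<^sup>+\<omega>. ennreal ((\<Sum>T\<in>Pow {..<N}. sqn N (mulv N (X 1 \<omega>) (sgnv T)) ^ k) / frob N (X 1 \<omega>) ^ k) \<partial>M)"
proof -
  let ?G = "\<lambda>x :: real \<times> real. (fst x / snd x) ^ k"
  have Gm: "?G \<in> borel_measurable borel" unfolding borel_prod[symmetric] by measurable
  have T: "(\<integral>\<^sup>+\<omega>. ennreal ((sqn N (mulv N (X 1 \<omega>) (sgnv T)) / frob N (X 1 \<omega>)) ^ k) \<partial>M) = (\<integral>\<^sup>+\<omega>. ennreal (z \<omega> ^ k) \<partial>M)" for T
  proof -
    have h: "sqn N (\<lambda>l. 1 / sqrt (real N) * sgnv T l) = 1" unfolding sqn_scale using N1 by (simp add: power_divide)
    have "sqn N (mulv N (X 1 \<omega>) (\<lambda>l. 1 / sqrt (real N) * sgnv T l)) / S (X 1 \<omega>) =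
      sqn N (mulv N (X 1 \<omega>) (sgnv T)) / frob N (X 1 \<omega>)" for \<omega>
      unfolding sqn_mulv_scale S using N1 by (simp add: power_divide)
    then show ?thesis using nn_integral_unit_eq[OF Gm h] by (simp add: z_def)
  qed
  have m: "(\<lambda>\<omega>. ennreal ((sqn N (mulv N (X 1 \<omega>) (sgnv T)) / frob N (X 1 \<omega>)) ^ k)) \<in> borel_measurable M" for T
  proof -
    have "(\<lambda>\<omega>. sqn N (mulv N (X 1 \<omega>) (sgnv T))) \<in> borel_measurable M" "(\<lambda>\<omega>. frob N (X 1 \<omega>)) \<in> borel_measurable M"
      by (rule measurable_compose[OF X_meas[OF order_refl]], simp)+
    then show ?thesis by measurable
  qed
  have "ennreal (2 ^ N) * (\<integral>\<^sup>+\<omega>. ennreal (z \<omega> ^ k) \<partial>M) = (\<Sum>T\<in>Pow {..<N}. \<integral>\<^sup>+\<omega>. ennreal (z \<omega> ^ k) \<partial>M)"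
    by (simp add: card_Pow ennreal_power[symmetric])
  also have "\<dots> = (\<Sum>T\<in>Pow {..<N}. \<integral>\<^sup>+\<omega>. ennreal ((sqn N (mulv N (X 1 \<omega>) (sgnv T)) / frob N (X 1 \<omega>)) ^ k) \<partial>M)"
    by (simp only: T)
  also have "\<dots> = (\<integral>\<^sup>+\<omega>. (\<Sum>T\<in>Pow {..<N}. ennreal ((sqn N (mulv N (X 1 \<omega>) (sgnv T)) / frob N (X 1 \<omega>)) ^ k)) \<partial>M)"
    by (rule nn_integral_sum[symmetric]) (rule m)
  also have "\<dots> = (\<integral>\<^sup>+\<omega>. ennreal ((\<Sum>T\<in>Pow {..<N}. sqn N (mulv N (X 1 \<omega>) (sgnv T)) ^ k) / frob N (X 1 \<omega>) ^ k) \<partial>M)"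
    by (rule nn_integral_cong) (simp add: sum_ennreal power_divide sum_divide_distrib)
  finally show ?thesis .
qed

lemma z_moments_frob:
  assumes S: "\<And>A. S A = frob N A / real N" and fr: "AE \<omega> in M. 0 < frob N (X 1 \<omega>)" and b: "b \<ge> 0"
    and bd: "AE \<omega> in M. \<forall>w. sqn N (mulv N (X 1 \<omega>) w) \<le> b * (frob N (X 1 \<omega>) / real N) * sqn N w"
  shows "(\<integral>\<^sup>+\<omega>. ennreal (z \<omega> ^ k) \<partial>M) \<le> ennreal ((1 + 8 * real k * b / real N) ^ k)"
    and "(\<integral>\<^sup>+\<omega>. ennreal (z \<omega>) \<partial>M) = 1"
    and "(\<integral>\<^sup>+\<omega>. ennreal ((z \<omega>)\<^sup>2) \<partial>M) \<le> ennreal (1 + 8 * b / real N)"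
proof -
  let ?S = "\<lambda>\<omega> k. (\<Sum>T\<in>Pow {..<N}. sqn N (mulv N (X 1 \<omega>) (sgnv T)) ^ k) / frob N (X 1 \<omega>) ^ k"
  have pt: "?S \<omega> k \<le> 2 ^ N * (1 + 8 * real k * b / real N) ^ k \<and> ?S \<omega> 1 = 2 ^ N \<and> ?S \<omega> 2 \<le> 2 ^ N * (1 + 8 * b / real N)"
    if f: "0 < frob N (X 1 \<omega>)" and w: "\<forall>w. sqn N (mulv N (X 1 \<omega>) w) \<le> b * (frob N (X 1 \<omega>) / real N) * sqn N w" for \<omega>
    by (intro conjI sign_moments[OF f b w])
  have ae: "AE \<omega> in M. ?S \<omega> k \<le> 2 ^ N * (1 + 8 * real k * b / real N) ^ k \<and> ?S \<omega> 1 = 2 ^ N \<and> ?S \<omega> 2 \<le> 2 ^ N * (1 + 8 * b / real N)"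
    using fr bd by eventually_elim (rule pt)
  have cancel: "x \<le> ennreal c" if "ennreal (2 ^ N) * x \<le> ennreal (2 ^ N * c)" "c \<ge> 0" for x c
  proof -
    have "ennreal (2 ^ N) * x \<le> ennreal (2 ^ N) * ennreal c" using that by (simp add: ennreal_mult)
    then show ?thesis by (subst (asm) ennreal_mult_le_mult_iff) (auto simp: ennreal_eq_0_iff not_le)
  qed
  have "ennreal (2 ^ N) * (\<integral>\<^sup>+\<omega>. ennreal (z \<omega> ^ k) \<partial>M) \<le> (\<integral>\<^sup>+\<omega>. ennreal (2 ^ N * (1 + 8 * real k * b / real N) ^ k) \<partial>M)"
    unfolding sign_average[OF S] by (rule nn_integral_mono_AE, use ae in eventually_elim) (simp add: ennreal_leI)
  also have "\<dots> = ennreal (2 ^ N * (1 + 8 * real k * b / real N) ^ k)" by (simp add: emeasure_space_1)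
  finally show "(\<integral>\<^sup>+\<omega>. ennreal (z \<omega> ^ k) \<partial>M) \<le> ennreal ((1 + 8 * real k * b / real N) ^ k)"
    by (rule cancel) (use b in simp)
  have "ennreal (2 ^ N) * (\<integral>\<^sup>+\<omega>. ennreal (z \<omega> ^ 2) \<partial>M) \<le> (\<integral>\<^sup>+\<omega>. ennreal (2 ^ N * (1 + 8 * b / real N)) \<partial>M)"
    unfolding sign_average[OF S] by (rule nn_integral_mono_AE, use ae in eventually_elim) (simp add: ennreal_leI)
  also have "\<dots> = ennreal (2 ^ N * (1 + 8 * b / real N))" by (simp add: emeasure_space_1)
  finally show "(\<integral>\<^sup>+\<omega>. ennreal ((z \<omega>)\<^sup>2) \<partial>M) \<le> ennreal (1 + 8 * b / real N)"
    by (rule cancel) (use b in simp)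
  have "ennreal (2 ^ N) * (\<integral>\<^sup>+\<omega>. ennreal (z \<omega> ^ 1) \<partial>M) = (\<integral>\<^sup>+\<omega>. ennreal (2 ^ N) \<partial>M)"
    unfolding sign_average[OF S] by (rule nn_integral_cong_AE, use ae in eventually_elim) simp
  also have "\<dots> = ennreal (2 ^ N)" by (simp add: emeasure_space_1)
  finally have "ennreal (2 ^ N) * (\<integral>\<^sup>+\<omega>. ennreal (z \<omega>) \<partial>M) = ennreal (2 ^ N) * 1" by simp
  moreover have "\<not> (2 ^ N \<le> (0::real))" by (simp add: not_le)
  ultimately show "(\<integral>\<^sup>+\<omega>. ennreal (z \<omega>) \<partial>M) = 1"
    by (subst (asm) ennreal_mult_cancel_left) (auto simp: ennreal_eq_0_iff)
qed

end

section \<open>From moment integrals to expectations, and the singular value case\<close>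

lemma (in prob_space) second_moment_deviation:
  fixes Z :: "'a \<Rightarrow> real"
  assumes m [measurable]: "Z \<in> borel_measurable M" and Z0: "\<And>\<omega>. 0 \<le> Z \<omega>"
    and one: "(\<integral>\<^sup>+\<omega>. ennreal (Z \<omega>) \<partial>M) = 1"
    and two: "(\<integral>\<^sup>+\<omega>. ennreal ((Z \<omega>)\<^sup>2) \<partial>M) \<le> ennreal (1 + v)" and v: "v \<ge> 0"
  shows "integrable M Z" "expectation Z = 1" "integrable M (\<lambda>\<omega>. (Z \<omega> - 1)\<^sup>2)" "expectation (\<lambda>\<omega>. (Z \<omega> - 1)\<^sup>2) \<le> v"
proof -
  have Z1: "integrable M Z \<and> expectation Z = 1"
    using nn_integral_eq_integrable[OF m, of 1] one Z0 by simp
  then show i1: "integrable M Z" and e1: "expectation Z = 1" by auto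
  have i2: "integrable M (\<lambda>\<omega>. (Z \<omega>)\<^sup>2)"
    by (rule integrableI_nonneg) (use two in \<open>auto simp: top_unique intro: le_less_trans\<close>)
  then show "integrable M (\<lambda>\<omega>. (Z \<omega> - 1)\<^sup>2)" using i1 by (simp add: power2_diff)
  have "(\<integral>\<^sup>+\<omega>. ennreal ((Z \<omega>)\<^sup>2) \<partial>M) = ennreal (expectation (\<lambda>\<omega>. (Z \<omega>)\<^sup>2))"
    by (rule nn_integral_eq_integral[OF i2]) simp
  with two have "ennreal (expectation (\<lambda>\<omega>. (Z \<omega>)\<^sup>2)) \<le> ennreal (1 + v)" by (simp only:)
  then have "expectation (\<lambda>\<omega>. (Z \<omega>)\<^sup>2) \<le> 1 + v" using v by (subst (asm) ennreal_le_iff) simp_all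
  moreover have "expectation (\<lambda>\<omega>. (Z \<omega> - 1)\<^sup>2) = expectation (\<lambda>\<omega>. (Z \<omega>)\<^sup>2) - 1"
    using i1 i2 e1 by (simp add: power2_diff prob_space)
  ultimately show "expectation (\<lambda>\<omega>. (Z \<omega> - 1)\<^sup>2) \<le> v" by simp
qed

lemma (in prob_space) square_integrable_of_nn_integral:
  fixes f :: "'a \<Rightarrow> real"
  assumes m [measurable]: "f \<in> borel_measurable M" and le: "(\<integral>\<^sup>+\<omega>. ennreal ((f \<omega>)\<^sup>2) \<partial>M) \<le> ennreal K" and K: "K \<ge> 0"
  shows "integrable M (\<lambda>\<omega>. (f \<omega>)\<^sup>2)" "expectation (\<lambda>\<omega>. (f \<omega>)\<^sup>2) \<le> K"
proof -
  show i: "integrable M (\<lambda>\<omega>. (f \<omega>)\<^sup>2)"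
    by (rule integrableI_nonneg) (use le in \<open>auto simp: top_unique intro: le_less_trans\<close>)
  show "expectation (\<lambda>\<omega>. (f \<omega>)\<^sup>2) \<le> K" using le nn_integral_eq_integral[OF i] K by (simp add: ennreal_le_iff)
qed

lemma isotropic_matricesI:
  assumes "prob_space M" "N \<ge> 1" "iid_matrices M N X" "rotationally_invariant M N (X 1)"
    and "S \<in> borel_measurable (borel_mat N)" "\<And>A. 0 \<le> S A"
    and "\<And>A U. A \<in> carrier_mat N N \<Longrightarrow> U \<in> carrier_mat N N \<Longrightarrow> transpose_mat U = U \<Longrightarrow>
      U * U = 1\<^sub>m N \<Longrightarrow> S (U * A * U) = S A"
  shows "isotropic_matrices M N X S"
proof -
  interpret prob_space M by fact
  show ?thesis
  proof unfold_locales
    show "indep_vars (\<lambda>_. borel_mat N) X {1..}" using assms(3) unfolding iid_matrices_def by blast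
    show "distr M (borel_mat N) (X i) = distr M (borel_mat N) (X 1)" if "i \<ge> 1" for i
      using assms(3) that unfolding iid_matrices_def by blast
  qed (fact assms)+
qed

text \<open>(C) bounds the squared operator norm by a multiple of S, as the sign moments require.
  The positivity contained in (D) excludes the zero matrix, from which positivity of q
  follows.\<close>

lemma singular_value_case:
  fixes M :: "'a measure"
  assumes M: "prob_space M" and N: "N \<ge> 1" and iid: "iid_matrices M N X" and inv: "rotationally_invariant M N (X 1)"
    and b: "AE \<omega> in M. max_sq_singular_value (X 1 \<omega>) \<le> b * mean_sq_singular_value (X 1 \<omega>)"
    and lv: "log_variance_exists M (\<lambda>\<omega>. mean_sq_singular_value (X 1 \<omega>))"
    and c: "prob_space.variance M (\<lambda>\<omega>. ln (mean_sq_singular_value (X 1 \<omega>))) \<le> c"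
  defines "S \<equiv> \<lambda>A. frob N A / real N"
  defines "Z \<equiv> \<lambda>\<omega>. sqn N (mulv N (X 1 \<omega>) (unitf 0)) / S (X 1 \<omega>)"
  shows "isotropic_product M N X S"
    and "prob_space.expectation M (\<lambda>\<omega>. (ln (Z \<omega>))\<^sup>2) \<le> 1312"
    and "prob_space.variance M (\<lambda>\<omega>. ln (S (X 1 \<omega>))) \<le> c"
    and "integrable M Z" "prob_space.expectation M Z = 1" "integrable M (\<lambda>\<omega>. (Z \<omega> - 1)\<^sup>2)"
    and "prob_space.expectation M (\<lambda>\<omega>. (Z \<omega> - 1)\<^sup>2) \<le> 8 * \<bar>b\<bar> / real N"
    and "(\<integral>\<^sup>+\<omega>. ennreal (Z \<omega> ^ k) \<partial>M) \<le> ennreal (exp ((8 * \<bar>b\<bar> + 1) * (real k)\<^sup>2 / real N))"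
proof -
  interpret isotropic_matrices M N X S
  proof (rule isotropic_matricesI[OF M N iid inv])
    show "S \<in> borel_measurable (borel_mat N)" unfolding S_def by measurable
    show "0 \<le> S A" for A by (simp add: S_def)
    show "S (U * A * U) = S A"
      if "A \<in> carrier_mat N N" "U \<in> carrier_mat N N" "transpose_mat U = U" "U * U = 1\<^sub>m N" for A U
      unfolding S_def frob_conj[OF that] ..
  qed
  have zZ: "z = Z" by (simp add: fun_eq_iff z_def q_def s_def Z_def)
  have mean: "mean_sq_singular_value (X 1 \<omega>) = S (X 1 \<omega>)" if "\<omega> \<in> space M" for \<omega>
    using sq_singular_values_facts(1)[OF X_carrier[OF order_refl that] N] by (simp add: S_def frob_def)
  have "AE \<omega> in M. 0 < mean_sq_singular_value (X 1 \<omega>)"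
    using lv unfolding log_variance_exists_def log_mean_exists_def by blast
  then have S_pos: "AE \<omega> in M. 0 < S (X 1 \<omega>)"
    using AE_space by eventually_elim (simp add: mean del: One_nat_def)
  then have fr: "AE \<omega> in M. 0 < frob N (X 1 \<omega>)"
    by eventually_elim (use N in \<open>simp add: S_def zero_less_divide_iff\<close>)
  have lnS: "integrable M (\<lambda>\<omega>. ln (S (X 1 \<omega>)))" "integrable M (\<lambda>\<omega>. (ln (S (X 1 \<omega>)))\<^sup>2)"
    using lv unfolding log_variance_exists_def log_mean_exists_def
    by (simp_all add: mean cong: Bochner_Integration.integrable_cong del: One_nat_def)
  \<comment> \<open>The sign of \<open>b\<close> is not prescribed; as S is nonnegative,
    \<open>b\<close> may be replaced by its absolute value.\<close>
  have bd: "AE \<omega> in M. \<forall>w. sqn N (mulv N (X 1 \<omega>) w) \<le> \<bar>b\<bar> * (frob N (X 1 \<omega>) / real N) * sqn N w"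
    using b fr AE_space
  proof eventually_elim
    case (elim \<omega>)
    show ?case
    proof
      fix w :: "nat \<Rightarrow> real"
      have Xc: "X 1 \<omega> \<in> carrier_mat N N" using X_carrier elim(3) by simp
      define u where "u = Matrix.vec N w"
      have u: "u \<in> carrier_vec N" by (simp add: u_def)
      have "sqn N (mulv N (X 1 \<omega>) w) = sqn N (mulv N (X 1 \<omega>) (($) u))"
        by (intro arg_cong[where f="sqn N"] mulv_cong) (simp add: u_def)
      also have "\<dots> \<le> max_sq_singular_value (X 1 \<omega>) * scalar_prod u u"
        using sq_singular_values_facts(2)[OF Xc N u] sqn_mulv_eq_scalar_prod[OF Xc u] by simp
      also have "scalar_prod u u = sqn N (($) u)" by (simp add: sqn_eq_scalar_prod[OF u])
      also have "sqn N (($) u) = sqn N w" by (rule sqn_cong) (simp add: u_def)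
      also have "max_sq_singular_value (X 1 \<omega>) \<le> \<bar>b\<bar> * (frob N (X 1 \<omega>) / real N)"
      proof -
        have "max_sq_singular_value (X 1 \<omega>) \<le> b * S (X 1 \<omega>)" using elim(1) mean[OF elim(3)] by simp
        also have "\<dots> \<le> \<bar>b\<bar> * S (X 1 \<omega>)" by (intro mult_right_mono S_nonneg) simp
        finally show ?thesis by (simp add: S_def)
      qed
      then have "max_sq_singular_value (X 1 \<omega>) * sqn N w \<le> \<bar>b\<bar> * (frob N (X 1 \<omega>) / real N) * sqn N w"
        by (rule mult_right_mono) simp
      finally show "sqn N (mulv N (X 1 \<omega>) w) \<le> \<bar>b\<bar> * (frob N (X 1 \<omega>) / real N) * sqn N w" .
    qed
  qed
  have SA: "\<And>A. S A = frob N A / real N" by (simp add: S_def)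
  have lm: "(\<lambda>\<omega>. ln (z \<omega>)) \<in> borel_measurable M" by measurable
  have lz0: "(\<integral>\<^sup>+\<omega>. ennreal ((ln (z \<omega>))\<^sup>2) \<partial>M) \<le> ennreal 1312" using ln_z_sq_frob[OF fr SA] by simp
  note lz = square_integrable_of_nn_integral[OF lm lz0]
  show iso: "isotropic_product M N X S"
  proof unfold_locales
    show "AE \<omega> in M. 0 < sqn N (mulv N (X 1 \<omega>) (unitf 0))" using q_pos_frob[OF fr] by (simp add: q_def)
    show "integrable M (\<lambda>\<omega>. (ln (sqn N (mulv N (X 1 \<omega>) (unitf 0)) / S (X 1 \<omega>)))\<^sup>2)"
      using lz(1) by (simp add: z_def q_def s_def)
  qed (rule S_pos lnS)+
  show "expectation (\<lambda>\<omega>. (ln (Z \<omega>))\<^sup>2) \<le> 1312" using lz(2) zZ by simp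
  have "expectation (\<lambda>\<omega>. ln (mean_sq_singular_value (X 1 \<omega>))) = expectation (\<lambda>\<omega>. ln (S (X 1 \<omega>)))"
    by (rule Bochner_Integration.integral_cong) (simp_all add: mean del: One_nat_def)
  then have "variance (\<lambda>\<omega>. ln (mean_sq_singular_value (X 1 \<omega>))) = variance (\<lambda>\<omega>. ln (S (X 1 \<omega>)))"
    by (intro Bochner_Integration.integral_cong) (simp_all add: mean del: One_nat_def)
  then show "variance (\<lambda>\<omega>. ln (S (X 1 \<omega>))) \<le> c" using c by simp
  have b0: "\<bar>b\<bar> \<ge> 0" by simp
  note zm = z_moments_frob[OF SA fr b0 bd]
  have v0: "0 \<le> 8 * \<bar>b\<bar> / real N" by simp
  have z0: "\<And>\<omega>. 0 \<le> z \<omega>" by (simp add: z_def q_def s_def S_nonneg)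
  note sm = second_moment_deviation[OF z_meas z0 zm(2,3) v0]
  show "integrable M Z" "expectation Z = 1" "integrable M (\<lambda>\<omega>. (Z \<omega> - 1)\<^sup>2)"
    "expectation (\<lambda>\<omega>. (Z \<omega> - 1)\<^sup>2) \<le> 8 * \<bar>b\<bar> / real N"
    using sm zZ by simp_all
  have "(1 + 8 * real k * \<bar>b\<bar> / real N) ^ k \<le> exp (8 * real k * \<bar>b\<bar> / real N) ^ k"
    by (intro power_mono exp_ge_add_one_self) (simp add: add_nonneg_nonneg)
  also have "\<dots> = exp (8 * \<bar>b\<bar> * (real k)\<^sup>2 / real N)"
    by (simp add: exp_of_nat_mult[symmetric] power2_eq_square mult_ac)
  \<comment> \<open>The added 1 makes the constant strictly positive even for b = 0, as
    \<open>uniform_deviation_moments\<close> demands of K4.\<close>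
  also have "\<dots> \<le> exp ((8 * \<bar>b\<bar> + 1) * (real k)\<^sup>2 / real N)"
    by (simp add: divide_right_mono mult_right_mono)
  finally have "ennreal ((1 + 8 * real k * \<bar>b\<bar> / real N) ^ k) \<le> ennreal (exp ((8 * \<bar>b\<bar> + 1) * (real k)\<^sup>2 / real N))"
    by (rule ennreal_leI)
  with zm(1)[of k] show "(\<integral>\<^sup>+\<omega>. ennreal (Z \<omega> ^ k) \<partial>M) \<le> ennreal (exp ((8 * \<bar>b\<bar> + 1) * (real k)\<^sup>2 / real N))"
    unfolding zZ by (rule order_trans)
qed

text \<open>Halve the quadratic error bound for ln (1 + x) at x = -2 t: the error 2 (2 t)^2 becomes
  4 t^2.\<close>

lemma gauss_mgf_bound:
  fixes t :: real
  assumes "\<bar>t\<bar> \<le> 1 / 4"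
  shows "1 / sqrt (1 - 2 * t) \<le> exp (t + 4 * t\<^sup>2)"
proof -
  have pos: "1 - 2 * t > 0" using assms by (simp add: abs_le_iff)
  have "\<bar>ln (1 + (- 2 * t)) - (- 2 * t)\<bar> \<le> 2 * (- 2 * t)\<^sup>2"
    by (rule abs_ln_one_plus_x_minus_x_bound) (use assms in \<open>simp add: abs_mult\<close>)
  then have "- ln (1 - 2 * t) / 2 \<le> t + 4 * t\<^sup>2" by (simp add: abs_le_iff power_mult_distrib)
  then have "exp (- ln (1 - 2 * t) / 2) \<le> exp (t + 4 * t\<^sup>2)" by simp
  moreover have "exp (- ln (1 - 2 * t) / 2) = 1 / sqrt (1 - 2 * t)"
  proof -
    have "exp (- ln (1 - 2 * t) / 2) = 1 / exp (ln (1 - 2 * t) / 2)" by (simp add: exp_minus field_simps)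
    also have "ln (1 - 2 * t) / 2 = ln (sqrt (1 - 2 * t))" using pos by (simp add: ln_sqrt)
    finally show ?thesis using pos by simp
  qed
  ultimately show ?thesis by linarith
qed

text \<open>The power and variance bounds both come from the exponential moment \<open>mgf\<close>.
  At t = k / n it controls Z^k through Z^k \<le> exp (k (Z - 1)), with 4 k \<le> n as the range of
  t; at t of order 1 / sqrt n it controls the variance.\<close>

lemma (in prob_space) normalized_chi_square:
  fixes h :: "'i \<Rightarrow> 'a \<Rightarrow> real"
  assumes J: "finite J" "J \<noteq> {}" and ind: "indep_vars (\<lambda>_. borel) h J"
    and laws: "\<forall>j\<in>J. distr M borel (h j) = std_gauss"
  defines "n \<equiv> real (card J)"
  defines "Z \<equiv> \<lambda>\<omega>. (\<Sum>j\<in>J. (h j \<omega>)\<^sup>2) / n"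
  shows "AE \<omega> in M. 0 < Z \<omega>"
    and "(\<integral>\<^sup>+\<omega>. ennreal ((ln (Z \<omega>))\<^sup>2) \<partial>M) \<le> 328"
    and "integrable M Z" "expectation Z = 1" "integrable M (\<lambda>\<omega>. (Z \<omega> - 1)\<^sup>2)"
    and "expectation (\<lambda>\<omega>. (Z \<omega> - 1)\<^sup>2) \<le> 128 / n"
    and "4 * k \<le> card J \<Longrightarrow> (\<integral>\<^sup>+\<omega>. ennreal (Z \<omega> ^ k) \<partial>M) \<le> ennreal (exp (4 * (real k)\<^sup>2 / n))"
proof -
  have law: "distr M borel (h j) = std_gauss" if "j \<in> J" for j using laws that by blast
  have n: "n \<ge> 1" using J by (simp add: n_def Suc_le_eq card_gt_0_iff)
  have hm: "h j \<in> borel_measurable M" if "j \<in> J" for j using ind that unfolding indep_vars_def by auto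
  have Zeq: "Z = (\<lambda>\<omega>. \<Sum>j\<in>J. (1 / n) * (h j \<omega>)\<^sup>2)" by (simp add: Z_def sum_divide_distrib)
  have p: "(\<Sum>j\<in>J. 1 / n) = 1" using n by (simp add: n_def)
  have p0: "0 \<le> 1 / n" using n by simp
  show "AE \<omega> in M. 0 < Z \<omega>" "(\<integral>\<^sup>+\<omega>. ennreal ((ln (Z \<omega>))\<^sup>2) \<partial>M) \<le> 328"
    unfolding Zeq by (rule weighted_gauss_squares[OF J(1) p0 p hm law]; assumption)+
  have Zm [measurable]: "Z \<in> borel_measurable M"
    unfolding Zeq by (intro borel_measurable_sum borel_measurable_times borel_measurable_power hm) auto
  have Z0: "0 \<le> Z \<omega>" for \<omega> using n by (simp add: Z_def sum_nonneg)
  have tr: "(\<integral>\<^sup>+\<omega>. F (h j \<omega>) \<partial>M) = (\<integral>\<^sup>+x. F x \<partial>std_gauss)"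
    if "j \<in> J" "F \<in> borel_measurable borel" for j and F :: "real \<Rightarrow> ennreal"
    unfolding law[OF that(1), symmetric] by (rule nn_integral_distr[symmetric]) (use that hm in auto)
  have "(\<integral>\<^sup>+\<omega>. ennreal (Z \<omega>) \<partial>M) = (\<integral>\<^sup>+\<omega>. (\<Sum>j\<in>J. ennreal (1 / n) * ennreal ((h j \<omega>)\<^sup>2)) \<partial>M)"
  proof (rule nn_integral_cong)
    fix \<omega>
    have "ennreal (Z \<omega>) = (\<Sum>j\<in>J. ennreal (1 / n * (h j \<omega>)\<^sup>2))"
      unfolding Zeq by (rule sum_ennreal[symmetric]) (use p0 in simp)
    then show "ennreal (Z \<omega>) = (\<Sum>j\<in>J. ennreal (1 / n) * ennreal ((h j \<omega>)\<^sup>2))"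
      by (simp only: ennreal_mult'[OF p0])
  qed
  also have "\<dots> = (\<Sum>j\<in>J. \<integral>\<^sup>+\<omega>. ennreal (1 / n) * ennreal ((h j \<omega>)\<^sup>2) \<partial>M)"
  proof (rule nn_integral_sum)
    fix j assume "j \<in> J"
    note [measurable] = hm[OF this]
    show "(\<lambda>\<omega>. ennreal (1 / n) * ennreal ((h j \<omega>)\<^sup>2)) \<in> borel_measurable M" by measurable
  qed
  also have "\<dots> = (\<Sum>j\<in>J. ennreal (1 / n))"
  proof (rule sum.cong[OF refl])
    fix j assume j: "j \<in> J"
    have "(\<integral>\<^sup>+\<omega>. ennreal (1 / n) * ennreal ((h j \<omega>)\<^sup>2) \<partial>M) = (\<integral>\<^sup>+x. ennreal (1 / n) * ennreal (x\<^sup>2) \<partial>std_gauss)"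
      by (rule tr[OF j]) measurable
    also have "\<dots> = ennreal (1 / n)" by (subst nn_integral_cmult) (simp_all add: nn_integral_gauss_sq)
    finally show "(\<integral>\<^sup>+\<omega>. ennreal (1 / n) * ennreal ((h j \<omega>)\<^sup>2) \<partial>M) = ennreal (1 / n)" .
  qed
  also have "\<dots> = ennreal (\<Sum>j\<in>J. 1 / n)" by (rule sum_ennreal) (rule p0)
  finally have "(\<integral>\<^sup>+\<omega>. ennreal (Z \<omega>) \<partial>M) = 1" by (simp only: p ennreal_1)
  then show "integrable M Z" "expectation Z = 1"
    using nn_integral_eq_integrable[OF Zm, of 1] Z0 by simp_all
  have mgf: "(\<integral>\<^sup>+\<omega>. ennreal (exp (t * n * (Z \<omega> - 1))) \<partial>M) \<le> ennreal (exp (4 * t\<^sup>2 * n))" if t: "\<bar>t\<bar> \<le> 1 / 4" for t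
  proof -
    have t2: "t < 1 / 2" using t by (simp add: abs_le_iff)
    have "(\<integral>\<^sup>+\<omega>. ennreal (exp (t * n * (Z \<omega> - 1))) \<partial>M) =
      (\<integral>\<^sup>+\<omega>. ennreal (exp (- (t * n))) * (\<Prod>j\<in>J. ennreal (exp (t * (h j \<omega>)\<^sup>2))) \<partial>M)"
    proof (rule nn_integral_cong)
      fix \<omega>
      have nZ: "n * Z \<omega> = (\<Sum>j\<in>J. (h j \<omega>)\<^sup>2)" using n by (simp add: Z_def)
      have "t * n * (Z \<omega> - 1) = - (t * n) + t * (n * Z \<omega>)" by (simp add: algebra_simps)
      then have "t * n * (Z \<omega> - 1) = - (t * n) + (\<Sum>j\<in>J. t * (h j \<omega>)\<^sup>2)"
        by (simp only: nZ sum_distrib_left)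
      then have "exp (t * n * (Z \<omega> - 1)) = exp (- (t * n)) * (\<Prod>j\<in>J. exp (t * (h j \<omega>)\<^sup>2))"
        using J(1) by (simp only: exp_add exp_sum)
      then show "ennreal (exp (t * n * (Z \<omega> - 1))) = ennreal (exp (- (t * n))) * (\<Prod>j\<in>J. ennreal (exp (t * (h j \<omega>)\<^sup>2)))"
        by (simp add: ennreal_mult' prod_ennreal)
    qed
    also have "\<dots> = ennreal (exp (- (t * n))) * (\<integral>\<^sup>+\<omega>. (\<Prod>j\<in>J. ennreal (exp (t * (h j \<omega>)\<^sup>2))) \<partial>M)"
    proof (intro nn_integral_cmult borel_measurable_prod_ennreal)
      fix j assume "j \<in> J"
      note [measurable] = hm[OF this]
      show "(\<lambda>\<omega>. ennreal (exp (t * (h j \<omega>)\<^sup>2))) \<in> borel_measurable M" by measurable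
    qed
    finally have 1: "(\<integral>\<^sup>+\<omega>. ennreal (exp (t * n * (Z \<omega> - 1))) \<partial>M) =
      ennreal (exp (- (t * n))) * (\<integral>\<^sup>+\<omega>. (\<Prod>j\<in>J. ennreal (exp (t * (h j \<omega>)\<^sup>2))) \<partial>M)" .
    have "(\<integral>\<^sup>+\<omega>. (\<Prod>j\<in>J. ennreal (exp (t * (h j \<omega>)\<^sup>2))) \<partial>M) = (\<Prod>j\<in>J. \<integral>\<^sup>+\<omega>. ennreal (exp (t * (h j \<omega>)\<^sup>2)) \<partial>M)"
      by (rule indep_vars_nn_integral[OF J(1) indep_vars_compose2[OF ind]]) auto
    also have "\<dots> = (\<Prod>j\<in>J. ennreal (1 / sqrt (1 - 2 * t)))"
    proof (rule prod.cong[OF refl])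
      fix j assume "j \<in> J"
      then have "(\<integral>\<^sup>+\<omega>. ennreal (exp (t * (h j \<omega>)\<^sup>2)) \<partial>M) = (\<integral>\<^sup>+x. ennreal (exp (t * x\<^sup>2)) \<partial>std_gauss)"
        by (rule tr) measurable
      then show "(\<integral>\<^sup>+\<omega>. ennreal (exp (t * (h j \<omega>)\<^sup>2)) \<partial>M) = ennreal (1 / sqrt (1 - 2 * t))"
        using nn_integral_gauss_exp_sq[OF t2] by simp
    qed
    also have "\<dots> = ennreal (\<Prod>j\<in>J. 1 / sqrt (1 - 2 * t))" by (rule prod_ennreal) (use t2 in simp)
    also have "\<dots> \<le> ennreal (\<Prod>j\<in>J. exp (t + 4 * t\<^sup>2))"
      by (intro ennreal_leI prod_mono conjI gauss_mgf_bound t) (use t2 in simp)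
    also have "(\<Prod>j\<in>J. exp (t + 4 * t\<^sup>2)) = exp (n * (t + 4 * t\<^sup>2))" by (simp add: n_def exp_of_nat_mult)
    finally have "(\<integral>\<^sup>+\<omega>. ennreal (exp (t * n * (Z \<omega> - 1))) \<partial>M) \<le>
      ennreal (exp (- (t * n))) * ennreal (exp (n * (t + 4 * t\<^sup>2)))"
      unfolding 1 by (intro mult_left_mono) simp_all
    also have "\<dots> = ennreal (exp (- (t * n)) * exp (n * (t + 4 * t\<^sup>2)))" by (rule ennreal_mult'[symmetric]) simp
    also have "exp (- (t * n)) * exp (n * (t + 4 * t\<^sup>2)) = exp (4 * t\<^sup>2 * n)"
      by (simp only: exp_add[symmetric]) (simp add: algebra_simps)
    finally show ?thesis .
  qed
  show "(\<integral>\<^sup>+\<omega>. ennreal (Z \<omega> ^ k) \<partial>M) \<le> ennreal (exp (4 * (real k)\<^sup>2 / n))" if k: "4 * k \<le> card J"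
  proof -
    have "4 * real k \<le> n" using k unfolding n_def by (metis of_nat_le_iff of_nat_mult of_nat_numeral)
    then have t: "\<bar>real k / n\<bar> \<le> 1 / 4" using n by (simp add: field_simps)
    have "(\<integral>\<^sup>+\<omega>. ennreal (Z \<omega> ^ k) \<partial>M) \<le> (\<integral>\<^sup>+\<omega>. ennreal (exp (real k / n * n * (Z \<omega> - 1))) \<partial>M)"
    proof (intro nn_integral_mono ennreal_leI)
      fix \<omega>
      have "Z \<omega> ^ k \<le> exp (Z \<omega> - 1) ^ k" using Z0 exp_ge_add_one_self[of "Z \<omega> - 1"] by (intro power_mono) auto
      then show "Z \<omega> ^ k \<le> exp (real k / n * n * (Z \<omega> - 1))" using n by (simp add: exp_of_nat_mult)
    qed
    also have "\<dots> \<le> ennreal (exp (4 * (real k / n)\<^sup>2 * n))" by (rule mgf[OF t])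
    also have "4 * (real k / n)\<^sup>2 * n = 4 * (real k)\<^sup>2 / n" using n by (simp add: power2_eq_square)
    finally show ?thesis .
  qed
  \<comment> \<open>This makes 4 t^2 n = 1/4, so both exponential moments are at most exp (1/4)
    \<le> 2. With y^2 = n / 16 (Z - 1)^2 and y^2 \<le> 2 (exp y + exp (- y)) the constant is 32 * (2
    + 2) = 128.\<close>
  define t where "t = 1 / (4 * sqrt n)"
  have t: "\<bar>t\<bar> \<le> 1 / 4" "t\<^sup>2 * n = 1 / 16" "t > 0" using n by (auto simp: t_def power_divide power_mult_distrib)
  have e2: "exp (1 / 4) \<le> (2 :: real)"
  proof -
    have "exp (1 / 4 :: real) \<le> 1 + 1 / 4 + (1 / 4)\<^sup>2" by (rule exp_bound) auto
    then show ?thesis by (simp add: power2_eq_square)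
  qed
  have "(\<integral>\<^sup>+\<omega>. ennreal ((Z \<omega> - 1)\<^sup>2) \<partial>M) \<le> (\<integral>\<^sup>+\<omega>. ennreal (32 / n) * (ennreal (exp (t * n * (Z \<omega> - 1))) + ennreal (exp (- t * n * (Z \<omega> - 1)))) \<partial>M)"
  proof (rule nn_integral_mono)
    fix \<omega>
    define y where "y = t * n * (Z \<omega> - 1)"
    have "y\<^sup>2 / 2 \<le> exp \<bar>y\<bar>" using exp_lower_Taylor_quadratic[of "\<bar>y\<bar>"] by simp
    also have "\<dots> \<le> exp y + exp (- y)" by (cases "y \<ge> 0") (simp_all add: abs_if)
    finally have "y\<^sup>2 \<le> 2 * (exp y + exp (- y))" by simp
    moreover have "y\<^sup>2 = n / 16 * (Z \<omega> - 1)\<^sup>2"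
    proof -
      have "y\<^sup>2 = (t\<^sup>2 * n) * n * (Z \<omega> - 1)\<^sup>2" by (simp add: y_def power_mult_distrib power2_eq_square)
      then show ?thesis unfolding t(2) by simp
    qed
    ultimately have "(Z \<omega> - 1)\<^sup>2 \<le> 32 / n * (exp y + exp (- y))" using n by (simp add: field_simps)
    then have "ennreal ((Z \<omega> - 1)\<^sup>2) \<le> ennreal (32 / n * (exp y + exp (- y)))" by (rule ennreal_leI)
    also have "\<dots> = ennreal (32 / n) * (ennreal (exp y) + ennreal (exp (- y)))"
      using n by (subst ennreal_mult, simp, simp, subst ennreal_plus) simp_all
    finally show "ennreal ((Z \<omega> - 1)\<^sup>2) \<le> ennreal (32 / n) * (ennreal (exp (t * n * (Z \<omega> - 1))) + ennreal (exp (- t * n * (Z \<omega> - 1))))"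
      by (simp add: y_def)
  qed
  also have "\<dots> = ennreal (32 / n) * ((\<integral>\<^sup>+\<omega>. ennreal (exp (t * n * (Z \<omega> - 1))) \<partial>M) + (\<integral>\<^sup>+\<omega>. ennreal (exp (- t * n * (Z \<omega> - 1))) \<partial>M))"
    by (subst nn_integral_cmult, measurable, subst nn_integral_add) measurable
  also have "\<dots> \<le> ennreal (32 / n) * (ennreal (exp (4 * t\<^sup>2 * n)) + ennreal (exp (4 * (- t)\<^sup>2 * n)))"
    using mgf[of t] mgf[of "- t"] t(1) by (intro mult_left_mono add_mono) auto
  also have "\<dots> = ennreal (32 / n * (exp (1 / 4) + exp (1 / 4)))"
  proof -
    have "4 * t\<^sup>2 * n = 1 / 4" "4 * (- t)\<^sup>2 * n = 1 / 4" using t(2) by simp_all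
    then show ?thesis using n by (simp only:) (subst ennreal_mult, simp, simp, subst ennreal_plus, simp_all)
  qed
  also have "\<dots> \<le> ennreal (128 / n)"
  proof (rule ennreal_leI)
    have "32 / n * (exp (1 / 4) + exp (1 / 4)) \<le> 32 / n * 4" using e2 n by (intro mult_left_mono) auto
    then show "32 / n * (exp (1 / 4) + exp (1 / 4)) \<le> 128 / n" by simp
  qed
  finally have le: "(\<integral>\<^sup>+\<omega>. ennreal ((Z \<omega> - 1)\<^sup>2) \<partial>M) \<le> ennreal (128 / n)" .
  have m1: "(\<lambda>\<omega>. Z \<omega> - 1) \<in> borel_measurable M" by measurable
  have n0: "0 \<le> 128 / n" using n by simp
  show "integrable M (\<lambda>\<omega>. (Z \<omega> - 1)\<^sup>2)" "expectation (\<lambda>\<omega>. (Z \<omega> - 1)\<^sup>2) \<le> 128 / n"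
    by (rule square_integrable_of_nn_integral[OF m1 le n0])+
qed

text \<open>With S constant the variance of ln S vanishes, and Z is the chi-square sum of the N
  standardised entries of the first column divided by N.\<close>

lemma gaussian_case:
  fixes M :: "'a measure"
  assumes M: "prob_space M" and N: "N \<ge> 1" and iid: "iid_matrices M N X" and inv: "rotationally_invariant M N (X 1)"
    and g: "gaussian_matrix M N \<sigma> (X 1)" and \<sigma>: "\<sigma> > 0"
  defines "S \<equiv> \<lambda>A :: real Matrix.mat. \<sigma>\<^sup>2"
  defines "Z \<equiv> \<lambda>\<omega>. sqn N (mulv N (X 1 \<omega>) (unitf 0)) / S (X 1 \<omega>)"
  shows "isotropic_product M N X S"
    and "prob_space.expectation M (\<lambda>\<omega>. (ln (Z \<omega>))\<^sup>2) \<le> 328"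
    and "prob_space.variance M (\<lambda>\<omega>. ln (S (X 1 \<omega>))) \<le> 0"
    and "integrable M Z" "prob_space.expectation M Z = 1" "integrable M (\<lambda>\<omega>. (Z \<omega> - 1)\<^sup>2)"
    and "prob_space.expectation M (\<lambda>\<omega>. (Z \<omega> - 1)\<^sup>2) \<le> 128 / real N"
    and "4 * k \<le> N \<Longrightarrow> (\<integral>\<^sup>+\<omega>. ennreal (Z \<omega> ^ k) \<partial>M) \<le> ennreal (exp (4 * (real k)\<^sup>2 / real N))"
proof -
  interpret isotropic_matrices M N X S
    by (rule isotropic_matricesI[OF M N iid inv]) (simp_all add: S_def)
  have zZ: "z = Z" by (simp add: fun_eq_iff z_def q_def s_def Z_def)
  define r where "r = sqrt (\<sigma>\<^sup>2 / real N)"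
  have r: "r > 0" "r\<^sup>2 = \<sigma>\<^sup>2 / real N" using \<sigma> N by (simp_all add: r_def)
  let ?J = "{..<N} \<times> {0::nat}"
  define h where "h = (\<lambda>(j,k) \<omega>. (X 1 \<omega> $$ (j,k)) / r)"
  have J: "finite ?J" "?J \<noteq> {}" "card ?J = N" using N by (auto simp: card_cartesian_product lessThan_empty_iff)
  have "indep_vars (\<lambda>_. borel) (\<lambda>(j, k) \<omega>. X 1 \<omega> $$ (j, k)) ?J"
    by (rule indep_vars_subset[of _ _ "{..<N} \<times> {..<N}"])
      (use g N in \<open>auto simp: gaussian_matrix_def\<close>)
  then have "indep_vars (\<lambda>_. borel) (\<lambda>i \<omega>. (\<lambda>x. x / r) ((\<lambda>(j, k) \<omega>. X 1 \<omega> $$ (j, k)) i \<omega>)) ?J"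
    by (rule indep_vars_compose2) simp
  then have ind: "indep_vars (\<lambda>_. borel) h ?J" by (simp add: h_def case_prod_beta')
  have law: "distr M borel (h i) = std_gauss" if i: "i \<in> ?J" for i
  proof -
    define j where "j = fst i"
    have j: "i = (j,0)" "j < N" using i by (simp_all add: j_def mem_Times_iff prod_eq_iff)
    have "distributed M lborel (\<lambda>\<omega>. X 1 \<omega> $$ (j, 0)) (\<lambda>x. ennreal (normal_density 0 r x))"
      using g j N unfolding gaussian_matrix_def r_def by auto
    then have "distributed M lborel (\<lambda>\<omega>. (X 1 \<omega> $$ (j, 0) - 0) / r) std_normal_density"
      using normal_standard_normal_convert[OF r(1), of "\<lambda>\<omega>. X 1 \<omega> $$ (j, 0)" 0] by simp
    then have "distr M lborel (h i) = std_gauss" by (simp add: distributed_def h_def j)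
    then show ?thesis by (simp add: distr_cong[OF refl sets_lborel[symmetric] refl])
  qed
  have Zc: "(\<Sum>i\<in>?J. (h i \<omega>)\<^sup>2) / real N = Z \<omega>" for \<omega>
  proof -
    have "(\<Sum>i\<in>?J. (h i \<omega>)\<^sup>2) = (\<Sum>j<N. (X 1 \<omega> $$ (j,0))\<^sup>2 / r\<^sup>2)"
      by (rule sum.reindex_bij_witness[of _ "\<lambda>j. (j,0)" fst]) (auto simp: h_def power_divide)
    also have "\<dots> = sqn N (mulv N (X 1 \<omega>) (unitf 0)) * real N / \<sigma>\<^sup>2"
      using N by (simp add: sqn_def mulv_unitf r(2) sum_divide_distrib sum_distrib_right)
    finally show ?thesis using N by (simp add: Z_def S_def)
  qed
  have laws: "\<forall>i\<in>?J. distr M borel (h i) = std_gauss" using law by blast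
  note chi = normalized_chi_square[OF J(1,2) ind laws, unfolded J(3) Zc]
  have lm: "(\<lambda>\<omega>. ln (Z \<omega>)) \<in> borel_measurable M" unfolding zZ[symmetric] by measurable
  have "(\<integral>\<^sup>+\<omega>. ennreal ((ln (Z \<omega>))\<^sup>2) \<partial>M) \<le> ennreal 328" using chi(2) by simp
  note lz = square_integrable_of_nn_integral[OF lm this]
  show "isotropic_product M N X S"
  proof unfold_locales
    show "AE \<omega> in M. 0 < sqn N (mulv N (X 1 \<omega>) (unitf 0))"
      using chi(1) by eventually_elim (use \<sigma> in \<open>simp add: Z_def S_def zero_less_divide_iff\<close>)
    show "integrable M (\<lambda>\<omega>. (ln (sqn N (mulv N (X 1 \<omega>) (unitf 0)) / S (X 1 \<omega>)))\<^sup>2)"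
      using lz(1) by (simp add: Z_def)
  qed (use \<sigma> in \<open>simp_all add: S_def\<close>)
  show "expectation (\<lambda>\<omega>. (ln (Z \<omega>))\<^sup>2) \<le> 328" using lz(2) by simp
  show "variance (\<lambda>\<omega>. ln (S (X 1 \<omega>))) \<le> 0" by (simp add: S_def prob_space)
  show "integrable M Z" "expectation Z = 1" "integrable M (\<lambda>\<omega>. (Z \<omega> - 1)\<^sup>2)"
    "expectation (\<lambda>\<omega>. (Z \<omega> - 1)\<^sup>2) \<le> 128 / real N"
    "4 * k \<le> N \<Longrightarrow> (\<integral>\<^sup>+\<omega>. ennreal (Z \<omega> ^ k) \<partial>M) \<le> ennreal (exp (4 * (real k)\<^sup>2 / real N))"
    using chi(3-7) by blast+
qed

theorem theorem2:
  fixes M :: "nat \<Rightarrow> 'a measure"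
    and X :: "nat \<Rightarrow> nat \<Rightarrow> 'a \<Rightarrow> real Matrix.mat"
  assumes prob: "\<And>N. N \<ge> 1 \<Longrightarrow> prob_space (M N)"
    and iid: "\<And>N. N \<ge> 1 \<Longrightarrow> iid_matrices (M N) N (X N)"
    and A: "\<And>N i. N \<ge> 1 \<Longrightarrow> i \<ge> 1 \<Longrightarrow> rotationally_invariant (M N) N (X N i)"
    and B: "\<And>N i. N \<ge> 1 \<Longrightarrow> i \<ge> 1 \<Longrightarrow>
      integrable (M N) (\<lambda>\<omega>. log_plus (op_norm (X N i \<omega>)))"
    and alternatives:
      "(\<exists>\<sigma>>0. \<forall>N\<ge>1. \<forall>i\<ge>1. gaussian_matrix (M N) N \<sigma> (X N i)) \<or>
       ((\<exists>b. \<forall>N\<ge>1. \<forall>i\<ge>1. AE \<omega> in M N.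
           max_sq_singular_value (X N i \<omega>) \<le> b * mean_sq_singular_value (X N i \<omega>)) \<and>
        (\<exists>c. \<forall>N\<ge>1. \<forall>i\<ge>1.
           log_variance_exists (M N) (\<lambda>\<omega>. mean_sq_singular_value (X N i \<omega>)) \<and>
           prob_space.variance (M N) (\<lambda>\<omega>. ln (mean_sq_singular_value (X N i \<omega>))) \<le> c))"
  shows
    "(\<forall>N\<ge>1. \<forall>v\<in>carrier_vec N. euclid_norm v = 1 \<longrightarrow>
        log_mean_exists (M N) (\<lambda>\<omega>. euclid_norm (X N 1 \<omega> *\<^sub>v v))) \<and>
     (\<forall>\<delta>>0. \<exists>n0. \<forall>n\<ge>n0. \<forall>N\<ge>1. \<forall>v\<in>carrier_vec N. euclid_norm v = 1 \<longrightarrow>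
        measure (M N) {\<omega> \<in> space (M N).
          \<bar>ln (op_norm (mat_prod N (\<lambda>i. X N i \<omega>) n)) / real n
            - prob_space.expectation (M N) (\<lambda>\<omega>. ln (euclid_norm (X N 1 \<omega> *\<^sub>v v)))\<bar> \<ge> \<delta>} \<le> \<delta>)"
proof -
  have inv: "rotationally_invariant (M N) N (X N 1)" if "N \<ge> 1" for N using A[OF that] by simp
  from alternatives have "uniform_growth M X"
  proof
    assume "\<exists>\<sigma>>0. \<forall>N\<ge>1. \<forall>i\<ge>1. gaussian_matrix (M N) N \<sigma> (X N i)"
    then obtain \<sigma> where \<sigma>: "\<sigma> > 0" and g: "\<And>N. N \<ge> 1 \<Longrightarrow> gaussian_matrix (M N) N \<sigma> (X N 1)" by blast
    show ?thesis
    proof (rule uniform_deviation_moments[where S = "\<lambda>N A. \<sigma>\<^sup>2" and ?K1.0 = 328 and ?K2.0 = 0 and ?K3.0 = 128 and ?K4.0 = 4])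
      fix N :: nat assume N: "N \<ge> 1"
      note gc = gaussian_case[OF prob[OF N] N iid[OF N] inv[OF N] g[OF N] \<sigma>]
      show "isotropic_product (M N) N (X N) (\<lambda>A. \<sigma>\<^sup>2)" by (rule gc(1))
      show "prob_space.expectation (M N) (\<lambda>\<omega>. (ln (sqn N (mulv N (X N 1 \<omega>) (unitf 0)) / \<sigma>\<^sup>2))\<^sup>2) \<le> 328" by (rule gc(2))
      show "prob_space.variance (M N) (\<lambda>\<omega>. ln (\<sigma>\<^sup>2)) \<le> 0" by (rule gc(3))
      show "integrable (M N) (\<lambda>\<omega>. sqn N (mulv N (X N 1 \<omega>) (unitf 0)) / \<sigma>\<^sup>2)" by (rule gc(4))
      show "prob_space.expectation (M N) (\<lambda>\<omega>. sqn N (mulv N (X N 1 \<omega>) (unitf 0)) / \<sigma>\<^sup>2) = 1" by (rule gc(5))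
      show "integrable (M N) (\<lambda>\<omega>. (sqn N (mulv N (X N 1 \<omega>) (unitf 0)) / \<sigma>\<^sup>2 - 1)\<^sup>2)" by (rule gc(6))
      show "prob_space.expectation (M N) (\<lambda>\<omega>. (sqn N (mulv N (X N 1 \<omega>) (unitf 0)) / \<sigma>\<^sup>2 - 1)\<^sup>2) \<le> 128 / real N" by (rule gc(7))
      show "(\<integral>\<^sup>+\<omega>. ennreal ((sqn N (mulv N (X N 1 \<omega>) (unitf 0)) / \<sigma>\<^sup>2) ^ k) \<partial>M N) \<le> ennreal (exp (4 * (real k)\<^sup>2 / real N))"
        if "4 * k \<le> N" for k by (rule gc(8)[OF that])
    qed simp
  next
    assume "(\<exists>b. \<forall>N\<ge>1. \<forall>i\<ge>1. AE \<omega> in M N.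
           max_sq_singular_value (X N i \<omega>) \<le> b * mean_sq_singular_value (X N i \<omega>)) \<and>
        (\<exists>c. \<forall>N\<ge>1. \<forall>i\<ge>1.
           log_variance_exists (M N) (\<lambda>\<omega>. mean_sq_singular_value (X N i \<omega>)) \<and>
           prob_space.variance (M N) (\<lambda>\<omega>. ln (mean_sq_singular_value (X N i \<omega>))) \<le> c)"
    then obtain b c where bc: "\<And>N. N \<ge> 1 \<Longrightarrow> (AE \<omega> in M N.
           max_sq_singular_value (X N 1 \<omega>) \<le> b * mean_sq_singular_value (X N 1 \<omega>)) \<and>
           log_variance_exists (M N) (\<lambda>\<omega>. mean_sq_singular_value (X N 1 \<omega>)) \<and>
           prob_space.variance (M N) (\<lambda>\<omega>. ln (mean_sq_singular_value (X N 1 \<omega>))) \<le> c" by blast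
    show ?thesis
    proof (rule uniform_deviation_moments[where S = "\<lambda>N A. frob N A / real N" and ?K1.0 = 1312 and ?K2.0 = c
          and ?K3.0 = "8 * \<bar>b\<bar>" and ?K4.0 = "8 * \<bar>b\<bar> + 1"])
      fix N :: nat assume N: "N \<ge> 1"
      let ?Z = "\<lambda>\<omega>. sqn N (mulv N (X N 1 \<omega>) (unitf 0)) / (frob N (X N 1 \<omega>) / real N)"
      note sc = singular_value_case[OF prob[OF N] N iid[OF N] inv[OF N] conjunct1[OF bc[OF N]]
          conjunct1[OF conjunct2[OF bc[OF N]]] conjunct2[OF conjunct2[OF bc[OF N]]]]
      show "isotropic_product (M N) N (X N) (\<lambda>A. frob N A / real N)" by (rule sc(1))
      show "prob_space.expectation (M N) (\<lambda>\<omega>. (ln (?Z \<omega>))\<^sup>2) \<le> 1312" by (rule sc(2))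
      show "prob_space.variance (M N) (\<lambda>\<omega>. ln (frob N (X N 1 \<omega>) / real N)) \<le> c" by (rule sc(3))
      show "integrable (M N) ?Z" by (rule sc(4))
      show "prob_space.expectation (M N) ?Z = 1" by (rule sc(5))
      show "integrable (M N) (\<lambda>\<omega>. (?Z \<omega> - 1)\<^sup>2)" by (rule sc(6))
      show "prob_space.expectation (M N) (\<lambda>\<omega>. (?Z \<omega> - 1)\<^sup>2) \<le> 8 * \<bar>b\<bar> / real N" by (rule sc(7))
      show "(\<integral>\<^sup>+\<omega>. ennreal (?Z \<omega> ^ k) \<partial>M N) \<le> ennreal (exp ((8 * \<bar>b\<bar> + 1) * (real k)\<^sup>2 / real N))" for k
        by (rule sc(8))
    qed simp
  qed
  then show ?thesis unfolding uniform_growth_def .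
qed

end
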